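(* Let $(M,\omega)$ be a compact connected quantizable Kähler manifold with very ample quantum line bundle $(L,h)$, and let $i:M\to\mathbb{P}^N(\mathbb{C})$ be the coherent state embedding with respect to an orthonormal basis $s_0,\dots,s_N$ of $\Gamma_{hol}(M,L)$. Let $t\not\equiv0$ be a global holomorphic section of the hyperplane bundle $H$ and $s=i^*(t)$ the corresponding section of $L$. (a) For all $x,y\in M$ with $s(x)\ne0\ne s(y)$: $$\hat\phi_{M,\,i^*(t)}(x,y)=\hat\phi_{\mathbb{P}^N(\mathbb{C}),\,t}(i(x),i(y))=i^*(\hat\phi_{\mathbb{P}^N(\mathbb{C}),\,t})(x,y).$$ (b) For $s_0=i^*(t_0)$, for all $x,y\in M$ with $s_0(x)\neq0\neq s_0(y)$, and with $\widehat{i(x)}\in\mathbb{C}^{N+1}$ the normalized homogeneous representative of $i(x)$ (first component equal to $1$): $$\hat\phi_{M,s_0}(x,y)=\frac{\langle\widehat{i(y)},\widehat{i(x)}\rangle}{\|\widehat{i(x)}\|\,\|\widehat{i(y)}\|}.$$ (c) For all $x,y\in M$, with $\widehat{i(x)},\widehat{i(y)}\in\mathbb{C}^{N+1}$ homogeneous representatives of $i(x),i(y)$: $$\psi_M(x,y)=i^*\psi_{\mathbb{P}^N(\mathbb{C})}(x,y)=\psi_{\mathbb{P}^N(\mathbb{C})}(i(x),i(y))=\frac{|\langle\widehat{i(y)},\widehat{i(x)}\rangle|^2}{\|\widehat{i(x)}\|^2\,\|\widehat{i(y)}\|^2}.$$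
   Context: Quantum line bundle: a holomorphic line bundle $\pi:L\to M$ over the Kähler manifold $(M,\omega)$ with hermitian metric $h$ whose Chern connection has curvature $-\mathrm{i}\,\omega$; locally $\omega=-\mathrm{i}\,\partial\bar\partial\log\hat h$. $M$ is quantizable if such a bundle exists. $L$ very ample means that a basis of global holomorphic sections of $L$ defines a holomorphic embedding of $M$ into projective space. All hermitian metrics and scalar products are conjugate linear in the first argument; on $\mathbb{C}^{N+1}$, $\langle u,v\rangle=\sum_j\bar u_jv_j$. Scalar product on the space $\Gamma_{hol}(M,L)$ of global holomorphic sections: $\langle\varphi,\psi\rangle=\int_M h(\varphi,\psi)\,\Omega$, where $\Omega=\frac{1}{n!}\omega^n$, $n=\dim_{\mathbb{C}}M$, is the (positive) Liouville volume form. Coherent vectors: let $L_0$ be the total space of $L$ minus the zero section. For $q\in L_0$ define a linear form $\hat q$ on $\Gamma_{hol}(M,L)$ by $s(\pi(q))=\hat q(s)\,q$. The coherent vector $e_q\in\Gamma_{hol}(M,L)$ is the unique section with $\langle e_q,s\rangle=\hat q(s)$ for all $s$; $e_{cq}=\bar c^{-1}e_q$ for $c\in\mathbb{C}^*$. Two-point functions: for a global holomorphic section $s\not\equiv0$ and points $x,y$ with $s(x)\neq0\neq s(y)$, $\hat\phi_{M,s}(x,y):=\dfrac{\langle e_{s(x)},e_{s(y)}\rangle}{\|e_{s(x)}\|\,\|e_{s(y)}\|}$. For all $x,y\in M$, $\psi_M(x,y):=\dfrac{|\langle e_q,e_{q'}\rangle|^2}{\|e_q\|^2\|e_{q'}\|^2}$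 with any $0\neq q\in\pi^{-1}(x)$, $0\neq q'\in\pi^{-1}(y)$. Coherent state embedding: $i(x)=(s_0(x):\cdots:s_N(x))$. Projective space: $\mathbb{P}^N(\mathbb{C})$ carries the Fubini-Study form $\omega_{FS}=\mathrm{i}\,\partial\bar\partial\log(1+\|w\|^2)$ (affine coordinates $w_j=z_j/z_0$), with quantum line bundle the hyperplane bundle $H$ (dual of the tautological bundle) whose metric in the affine chart $z_0\neq0$, in the frame $t_0$, is $1/(1+\|w\|^2)$. Global sections of $H$ are the linear forms in the coordinates; $t_j$ is the section corresponding to $Z_j$. Coherent vectors and two-point functions for $(\mathbb{P}^N(\mathbb{C}),\omega_{FS},H)$ are defined by the same recipe as for $(M,\omega,L)$. The isomorphism $i^*H\cong L$ is the one under which $i^*(t_j)=s_j$, $j=0,\dots,N$. *)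

theory Defs
  imports "HOL-Analysis.Analysis"
begin

section \<open>Calculus on open subsets of complex n-space\<close>

primrec Ck_on :: "nat \<Rightarrow> 'a::real_normed_vector set \<Rightarrow> ('a \<Rightarrow> 'b::real_normed_vector) \<Rightarrow> bool" where
  "Ck_on 0 S f \<longleftrightarrow> continuous_on S f"
| "Ck_on (Suc k) S f \<longleftrightarrow>
     (\<forall>p\<in>S. f differentiable (at p)) \<and>
     (\<forall>v. Ck_on k S (\<lambda>p. frechet_derivative f (at p) v))"

definition smooth_on :: "'a::real_normed_vector set \<Rightarrow> ('a \<Rightarrow> 'b::real_normed_vector) \<Rightarrow> bool" where
  "smooth_on S f \<longleftrightarrow> (\<forall>k. Ck_on k S f)"

definition mv_holomorphic_on :: "(complex^'n::finite) set \<Rightarrow> (complex^'n \<Rightarrow> complex) \<Rightarrow> bool" where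
  "mv_holomorphic_on S f \<longleftrightarrow>
     (\<forall>p\<in>S. \<exists>f'. (f has_derivative f') (at p) \<and> (\<forall>c v. f' (c *s v) = c * f' v))"

text \<open>The operators \<open>\<partial>\<close> and \<open>\<partial>\<close>-bar on functions; \<open>i v\<close> is the complex structure applied to \<open>v\<close>.\<close>

definition del :: "(complex^'n::finite \<Rightarrow> complex) \<Rightarrow> complex^'n \<Rightarrow> complex^'n \<Rightarrow> complex" where
  "del f p v = (frechet_derivative f (at p) v - \<i> * frechet_derivative f (at p) (\<i> *s v)) / 2"

definition delbar :: "(complex^'n::finite \<Rightarrow> complex) \<Rightarrow> complex^'n \<Rightarrow> complex^'n \<Rightarrow> complex" where
  "delbar f p v = (frechet_derivative f (at p) v + \<i> * frechet_derivative f (at p) (\<i> *s v)) / 2"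

text \<open>Exterior derivative of a 1-form \<open>\<alpha>\<close>, with the convention \<open>(\<alpha> \<and> \<beta>)(u,v) = \<alpha>(u) \<beta>(v) - \<alpha>(v) \<beta>(u)\<close>.\<close>

definition ext_d :: "(complex^'n::finite \<Rightarrow> complex^'n \<Rightarrow> complex) \<Rightarrow>
    complex^'n \<Rightarrow> complex^'n \<Rightarrow> complex^'n \<Rightarrow> complex" where
  "ext_d \<alpha> p u v =
     frechet_derivative (\<lambda>p. \<alpha> p v) (at p) u - frechet_derivative (\<lambda>p. \<alpha> p u) (at p) v"

text \<open>Since the square of \<open>\<partial>\<close>-bar vanishes, \<open>\<partial>\<close> agrees with \<open>d\<close> on the image of \<open>\<partial>\<close>-bar.\<close>

definition del_delbar :: "(complex^'n::finite \<Rightarrow> complex) \<Rightarrow>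
    complex^'n \<Rightarrow> complex^'n \<Rightarrow> complex^'n \<Rightarrow> complex" where
  "del_delbar f = ext_d (delbar f)"

section \<open>Complex and Kaehler manifolds\<close>

type_synonym ('m, 'n) chart = "'m set \<times> ('m \<Rightarrow> complex^'n)"

text \<open>
  A manifold of complex dimension \<open>CARD('n)\<close>, whose points are those of \<open>topspace (mtop M)\<close>.
  A real 2-form is given by its local expressions: \<open>kform M c x u v\<close> is its value
  at the point \<open>x\<close> on the tangent vectors whose coordinates in the chart \<open>c\<close> are \<open>u\<close> and \<open>v\<close>.
\<close>

record ('m, 'n::finite) kaehler_data =
  mtop :: "'m topology"
  atlas :: "('m, 'n) chart set"
  kform :: "('m, 'n) chart \<Rightarrow> 'm \<Rightarrow> complex^'n \<Rightarrow> complex^'n \<Rightarrow> real"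

abbreviation points :: "('m, 'n::finite, 'z) kaehler_data_scheme \<Rightarrow> 'm set" where
  "points M \<equiv> topspace (mtop M)"

definition complex_manifold :: "('m, 'n::finite, 'z) kaehler_data_scheme \<Rightarrow> bool" where
  "complex_manifold M \<longleftrightarrow>
     Hausdorff_space (mtop M) \<and> second_countable (mtop M) \<and>
     (\<Union>(U, z)\<in>atlas M. U) = points M \<and>
     (\<forall>(U, z)\<in>atlas M. openin (mtop M) U \<and> open (z ` U) \<and>
        homeomorphic_map (subtopology (mtop M) U) (top_of_set (z ` U)) z) \<and>
     (\<forall>(U, z)\<in>atlas M. \<forall>(V, y)\<in>atlas M.
        \<forall>a. mv_holomorphic_on (z ` (U \<inter> V)) (\<lambda>p. y (inv_into U z p) $ a))"

text \<open>The second conjunct says that the local expressions fit together under changes of charts.\<close>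

definition smooth_two_form :: "('m, 'n::finite, 'z) kaehler_data_scheme \<Rightarrow> bool" where
  "smooth_two_form M \<longleftrightarrow>
     (\<forall>(U, z)\<in>atlas M.
        (\<forall>x\<in>U. bilinear (kform M (U, z) x) \<and> (\<forall>v. kform M (U, z) x v v = 0)) \<and>
        (\<forall>u v. smooth_on (z ` U) (\<lambda>p. kform M (U, z) (inv_into U z p) u v))) \<and>
     (\<forall>(U, z)\<in>atlas M. \<forall>(V, y)\<in>atlas M. \<forall>x\<in>U \<inter> V. \<forall>u v.
        let D = frechet_derivative (\<lambda>p. y (inv_into U z p)) (at (z x))
        in kform M (U, z) x u v = kform M (V, y) x (D u) (D v))"

definition closed_two_form :: "('m, 'n::finite, 'z) kaehler_data_scheme \<Rightarrow> bool" where
  "closed_two_form M \<longleftrightarrow>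
     (\<forall>(U, z)\<in>atlas M. \<forall>p\<in>z ` U. \<forall>u v w.
        let D = (\<lambda>a b. frechet_derivative (\<lambda>p. kform M (U, z) (inv_into U z p) a b) (at p))
        in D v w u + D w u v + D u v w = 0)"

definition kaehler_manifold :: "('m, 'n::finite, 'z) kaehler_data_scheme \<Rightarrow> bool" where
  "kaehler_manifold M \<longleftrightarrow>
     complex_manifold M \<and> smooth_two_form M \<and> closed_two_form M \<and>
     (\<forall>(U, z)\<in>atlas M. \<forall>x\<in>U.
        (\<forall>u v. kform M (U, z) x (\<i> *s u) (\<i> *s v) = kform M (U, z) x u v) \<and>
        (\<forall>v. v \<noteq> 0 \<longrightarrow> 0 < kform M (U, z) x v (\<i> *s v)))"

text \<open>
  The value of \<open>\<beta>^n / n!\<close> on the positively oriented real coordinate frame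
  \<open>d/dx_1, d/dy_1, ..., d/dx_n, d/dy_n\<close>, for an alternating form \<open>\<beta>\<close> of degree 2:
  \<open>\<beta>^n (v_1, ..., v_2n) = 2^(-n) \<Sum> sign \<sigma> \<Prod> \<beta>(v_\<sigma>(2j-1), v_\<sigma>(2j))\<close>, the sum being over all
  permutations \<open>\<sigma>\<close>. The index \<open>(j, False)\<close> stands for \<open>x_j\<close> and \<open>(j, True)\<close> for \<open>y_j\<close>.
\<close>

definition coord_frame :: "'n::finite \<times> bool \<Rightarrow> complex^'n" where
  "coord_frame a = axis (fst a) (if snd a then \<i> else 1)"

definition liouville_density :: "(complex^'n::finite \<Rightarrow> complex^'n \<Rightarrow> real) \<Rightarrow> real" where
  "liouville_density \<beta> =
     (\<Sum>\<sigma> | \<sigma> permutes (UNIV :: ('n \<times> bool) set).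
        of_int (sign \<sigma>) *
        (\<Prod>j\<in>UNIV. \<beta> (coord_frame (\<sigma> (j, False))) (coord_frame (\<sigma> (j, True)))))
     / 2 ^ CARD('n) / fact (CARD('n))"

text \<open>Integration against the positive volume form \<open>\<omega>^n / n!\<close>, as a Borel measure on the manifold.\<close>

definition liouville_measure :: "('m, 'n::finite, 'z) kaehler_data_scheme \<Rightarrow> 'm measure" where
  "liouville_measure M =
     (THE \<mu>. sets \<mu> = sets (sigma (points M) {U. openin (mtop M) U}) \<and>
        (\<forall>(U, z)\<in>atlas M. \<forall>B\<in>sets \<mu>. B \<subseteq> U \<longrightarrow>
           emeasure \<mu> B =
             (\<integral>\<^sup>+p\<in>z ` B. ennreal (liouville_density (kform M (U, z) (inv_into U z p))) \<partial>lborel)))"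

definition holomorphic_map :: "('m, 'n::finite, 'z) kaehler_data_scheme \<Rightarrow>
    ('p, 'k::finite, 'y) kaehler_data_scheme \<Rightarrow> ('m \<Rightarrow> 'p) \<Rightarrow> bool" where
  "holomorphic_map M P f \<longleftrightarrow>
     continuous_map (mtop M) (mtop P) f \<and>
     (\<forall>(U, z)\<in>atlas M. \<forall>(V, y)\<in>atlas P.
        \<forall>a. mv_holomorphic_on (z ` (U \<inter> f -` V)) (\<lambda>p. y (f (inv_into U z p)) $ a))"

definition holomorphic_embedding :: "('m, 'n::finite, 'z) kaehler_data_scheme \<Rightarrow>
    ('p, 'k::finite, 'y) kaehler_data_scheme \<Rightarrow> ('m \<Rightarrow> 'p) \<Rightarrow> bool" where
  "holomorphic_embedding M P f \<longleftrightarrow>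
     holomorphic_map M P f \<and> embedding_map (mtop M) (mtop P) f \<and>
     (\<forall>(U, z)\<in>atlas M. \<forall>(V, y)\<in>atlas P. \<forall>x\<in>U \<inter> f -` V.
        inj (frechet_derivative (\<lambda>p. y (f (inv_into U z p))) (at (z x))))"

section \<open>Hermitian holomorphic line bundles\<close>

text \<open>
  The total space is the set \<open>total Q\<close>, with its fibrewise linear structure. A local
  trivialisation \<open>(U, \<tau>)\<close> consists of an open set \<open>U\<close> and the fibre coordinate \<open>\<tau>\<close> over \<open>U\<close>.
\<close>

record ('m, 'n::finite, 'l) line_bundle_data = "('m, 'n) kaehler_data" +
  total :: "'l set"
  proj :: "'l \<Rightarrow> 'm"
  bzero :: "'m \<Rightarrow> 'l"
  badd :: "'l \<Rightarrow> 'l \<Rightarrow> 'l"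
  bscale :: "complex \<Rightarrow> 'l \<Rightarrow> 'l"
  trivs :: "('m set \<times> ('l \<Rightarrow> complex)) set"
  metric :: "'l \<Rightarrow> 'l \<Rightarrow> complex"

definition fibre :: "('m, 'n::finite, 'l) line_bundle_data \<Rightarrow> 'm \<Rightarrow> 'l set" where
  "fibre Q x = {q \<in> total Q. proj Q q = x}"

definition nonzero_fibre :: "('m, 'n::finite, 'l) line_bundle_data \<Rightarrow> 'm \<Rightarrow> 'l set" where
  "nonzero_fibre Q x = fibre Q x - {bzero Q x}"

definition holomorphic_line_bundle :: "('m, 'n::finite, 'l) line_bundle_data \<Rightarrow> bool" where
  "holomorphic_line_bundle Q \<longleftrightarrow>
     proj Q ` total Q \<subseteq> points Q \<and>
     (\<forall>x\<in>points Q. bzero Q x \<in> fibre Q x \<and>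
        (\<forall>q\<in>fibre Q x. \<forall>q'\<in>fibre Q x. badd Q q q' \<in> fibre Q x) \<and>
        (\<forall>c. \<forall>q\<in>fibre Q x. bscale Q c q \<in> fibre Q x)) \<and>
     (\<Union>(U, \<tau>)\<in>trivs Q. U) = points Q \<and>
     (\<forall>(U, \<tau>)\<in>trivs Q. openin (mtop Q) U \<and>
        (\<forall>x\<in>U. bij_betw \<tau> (fibre Q x) UNIV \<and> \<tau> (bzero Q x) = 0 \<and>
           (\<forall>q\<in>fibre Q x. \<forall>q'\<in>fibre Q x. \<tau> (badd Q q q') = \<tau> q + \<tau> q') \<and>
           (\<forall>c. \<forall>q\<in>fibre Q x. \<tau> (bscale Q c q) = c * \<tau> q))) \<and>
     (\<forall>(U, \<tau>)\<in>trivs Q. \<forall>(U', \<tau>')\<in>trivs Q. \<exists>g.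
        (\<forall>x\<in>U \<inter> U'. \<forall>q\<in>fibre Q x. \<tau>' q = g x * \<tau> q) \<and>
        (\<forall>(V, z)\<in>atlas Q. mv_holomorphic_on (z ` (U \<inter> U' \<inter> V)) (\<lambda>p. g (inv_into V z p))))"

definition local_frame :: "('m, 'n::finite, 'l) line_bundle_data \<Rightarrow> ('l \<Rightarrow> complex) \<Rightarrow> 'm \<Rightarrow> 'l" where
  "local_frame Q \<tau> x = (THE q. q \<in> fibre Q x \<and> \<tau> q = 1)"

definition local_metric :: "('m, 'n::finite, 'l) line_bundle_data \<Rightarrow> ('l \<Rightarrow> complex) \<Rightarrow> 'm \<Rightarrow> real" where
  "local_metric Q \<tau> x = Re (metric Q (local_frame Q \<tau> x) (local_frame Q \<tau> x))"

definition hermitian_metric :: "('m, 'n::finite, 'l) line_bundle_data \<Rightarrow> bool" where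
  "hermitian_metric Q \<longleftrightarrow>
     (\<forall>x\<in>points Q. \<forall>q\<in>fibre Q x. \<forall>q'\<in>fibre Q x.
        metric Q q' q = cnj (metric Q q q') \<and>
        (\<forall>c. metric Q q (bscale Q c q') = c * metric Q q q') \<and>
        (\<forall>q''\<in>fibre Q x. metric Q q (badd Q q' q'') = metric Q q q' + metric Q q q'') \<and>
        (q \<noteq> bzero Q x \<longrightarrow> 0 < Re (metric Q q q))) \<and>
     (\<forall>(U, \<tau>)\<in>trivs Q. \<forall>(V, z)\<in>atlas Q.
        smooth_on (z ` (U \<inter> V)) (\<lambda>p. local_metric Q \<tau> (inv_into V z p)))"

text \<open>
  In a holomorphic frame of squared length \<open>h\<close> the Chern connection is \<open>d + \<theta>\<close> with
  \<open>\<theta> = \<partial> log h\<close>; its curvature is \<open>d \<theta>\<close>, as \<open>\<theta> \<and> \<theta> = 0\<close> in rank one.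
\<close>

definition chern_connection_form :: "('m, 'n::finite, 'l) line_bundle_data \<Rightarrow>
    ('l \<Rightarrow> complex) \<Rightarrow> ('m, 'n) chart \<Rightarrow> complex^'n \<Rightarrow> complex^'n \<Rightarrow> complex" where
  "chern_connection_form Q \<tau> c =
     del (\<lambda>p. complex_of_real (ln (local_metric Q \<tau> (inv_into (fst c) (snd c) p))))"

definition chern_curvature :: "('m, 'n::finite, 'l) line_bundle_data \<Rightarrow>
    ('l \<Rightarrow> complex) \<Rightarrow> ('m, 'n) chart \<Rightarrow> complex^'n \<Rightarrow> complex^'n \<Rightarrow> complex^'n \<Rightarrow> complex" where
  "chern_curvature Q \<tau> c = ext_d (chern_connection_form Q \<tau> c)"

definition quantum_line_bundle :: "('m, 'n::finite, 'l) line_bundle_data \<Rightarrow> bool" where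
  "quantum_line_bundle Q \<longleftrightarrow>
     holomorphic_line_bundle Q \<and> hermitian_metric Q \<and>
     (\<forall>(U, \<tau>)\<in>trivs Q. \<forall>(V, z)\<in>atlas Q. \<forall>x\<in>U \<inter> V. \<forall>u v.
        chern_curvature Q \<tau> (V, z) (z x) u v = - \<i> * complex_of_real (kform Q (V, z) x u v))"

section \<open>Global holomorphic sections and coherent vectors\<close>

text \<open>Sections are extensional, so that equal sections are equal as functions.\<close>

definition hol_sections :: "('m, 'n::finite, 'l) line_bundle_data \<Rightarrow> ('m \<Rightarrow> 'l) set" where
  "hol_sections Q =
     {s \<in> extensional (points Q).
        (\<forall>x\<in>points Q. s x \<in> fibre Q x) \<and>
        (\<forall>(U, \<tau>)\<in>trivs Q. \<forall>(V, z)\<in>atlas Q.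
           mv_holomorphic_on (z ` (U \<inter> V)) (\<lambda>p. \<tau> (s (inv_into V z p))))}"

definition sec_inner :: "('m, 'n::finite, 'l) line_bundle_data \<Rightarrow> ('m \<Rightarrow> 'l) \<Rightarrow> ('m \<Rightarrow> 'l) \<Rightarrow> complex" where
  "sec_inner Q \<phi> \<psi> = (\<integral>x. metric Q (\<phi> x) (\<psi> x) \<partial>liouville_measure Q)"

definition sec_norm :: "('m, 'n::finite, 'l) line_bundle_data \<Rightarrow> ('m \<Rightarrow> 'l) \<Rightarrow> real" where
  "sec_norm Q \<phi> = sqrt (Re (sec_inner Q \<phi> \<phi>))"

text \<open>\<open>\<phi> = \<Sum>j. c_j s_j\<close>, expressed through the trivialisations, which are linear on the fibres.\<close>

definition is_lin_comb :: "('m, 'n::finite, 'l) line_bundle_data \<Rightarrow>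
    ('j::finite \<Rightarrow> complex) \<Rightarrow> ('j \<Rightarrow> 'm \<Rightarrow> 'l) \<Rightarrow> ('m \<Rightarrow> 'l) \<Rightarrow> bool" where
  "is_lin_comb Q c s \<phi> \<longleftrightarrow>
     (\<forall>(U, \<tau>)\<in>trivs Q. \<forall>x\<in>U. \<tau> (\<phi> x) = (\<Sum>j\<in>UNIV. c j * \<tau> (s j x)))"

definition section_basis :: "('m, 'n::finite, 'l) line_bundle_data \<Rightarrow> ('j::finite \<Rightarrow> 'm \<Rightarrow> 'l) \<Rightarrow> bool" where
  "section_basis Q s \<longleftrightarrow>
     (\<forall>j. s j \<in> hol_sections Q) \<and> (\<forall>\<phi>\<in>hol_sections Q. \<exists>!c. is_lin_comb Q c s \<phi>)"

definition orthonormal_section_basis ::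
    "('m, 'n::finite, 'l) line_bundle_data \<Rightarrow> ('j::finite \<Rightarrow> 'm \<Rightarrow> 'l) \<Rightarrow> bool" where
  "orthonormal_section_basis Q s \<longleftrightarrow>
     section_basis Q s \<and> (\<forall>j k. sec_inner Q (s j) (s k) = (if j = k then 1 else 0))"

text \<open>The linear form \<open>q^\<close> attached to a nonzero element \<open>q\<close> of the total space.\<close>

definition qhat :: "('m, 'n::finite, 'l) line_bundle_data \<Rightarrow> 'l \<Rightarrow> ('m \<Rightarrow> 'l) \<Rightarrow> complex" where
  "qhat Q q s = (THE c. s (proj Q q) = bscale Q c q)"

definition coherent_vector :: "('m, 'n::finite, 'l) line_bundle_data \<Rightarrow> 'l \<Rightarrow> 'm \<Rightarrow> 'l" where
  "coherent_vector Q q =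
     (THE e. e \<in> hol_sections Q \<and> (\<forall>s\<in>hol_sections Q. sec_inner Q e s = qhat Q q s))"

definition two_point :: "('m, 'n::finite, 'l) line_bundle_data \<Rightarrow> ('m \<Rightarrow> 'l) \<Rightarrow> 'm \<Rightarrow> 'm \<Rightarrow> complex" where
  "two_point Q s x y =
     sec_inner Q (coherent_vector Q (s x)) (coherent_vector Q (s y)) /
     complex_of_real (sec_norm Q (coherent_vector Q (s x)) * sec_norm Q (coherent_vector Q (s y)))"

text \<open>The value does not depend on the nonzero \<open>q\<close> over \<open>x\<close> and \<open>q'\<close> over \<open>y\<close>.\<close>

definition psi :: "('m, 'n::finite, 'l) line_bundle_data \<Rightarrow> 'm \<Rightarrow> 'm \<Rightarrow> real" where
  "psi Q x y =
     (THE r. \<forall>q\<in>nonzero_fibre Q x. \<forall>q'\<in>nonzero_fibre Q y.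
        r = (cmod (sec_inner Q (coherent_vector Q q) (coherent_vector Q q')))\<^sup>2 /
            ((sec_norm Q (coherent_vector Q q))\<^sup>2 * (sec_norm Q (coherent_vector Q q'))\<^sup>2))"

section \<open>Projective space and its hyperplane bundle\<close>

text \<open>
  Homogeneous coordinates on the projective space of dimension \<open>N = CARD('k)\<close> are indexed by
  \<open>'k option\<close>: the index \<open>None\<close> is \<open>0\<close>, and the indices \<open>1, ..., N\<close> are the \<open>Some a\<close>.
  Points are the one-dimensional subspaces of \<open>complex^('k option)\<close>.
\<close>

type_synonym 'k hvec = "complex^('k option)"

definition hinner :: "complex^'j::finite \<Rightarrow> complex^'j \<Rightarrow> complex" where
  "hinner u v = (\<Sum>j\<in>UNIV. cnj (u $ j) * v $ j)"

definition hline :: "'k::finite hvec \<Rightarrow> 'k hvec set" where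
  "hline v = range (\<lambda>c. c *s v)"

definition proj_points :: "'k::finite hvec set set" where
  "proj_points = hline ` (- {0})"

text \<open>The quotient topology.\<close>

definition proj_topology :: "'k::finite hvec set topology" where
  "proj_topology = topology (\<lambda>W. W \<subseteq> proj_points \<and> open {v. v \<noteq> 0 \<and> hline v \<in> W})"

definition normalized_rep :: "'k::finite option \<Rightarrow> 'k hvec set \<Rightarrow> 'k hvec" where
  "normalized_rep j L = (THE v. v \<in> L \<and> v $ j = 1)"

definition affine_domain :: "'k::finite option \<Rightarrow> 'k hvec set set" where
  "affine_domain j = {L \<in> proj_points. \<exists>v\<in>L. v $ j \<noteq> 0}"

text \<open>
  The affine coordinates \<open>z_b / z_j\<close>, \<open>b \<noteq> j\<close>, relabelled by \<open>'k\<close>: for \<open>j = Some a\<close> the free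
  slot \<open>a\<close> receives \<open>z_0 / z_j\<close>.
\<close>

definition affine_coord :: "'k::finite option \<Rightarrow> 'k hvec set \<Rightarrow> complex^'k" where
  "affine_coord j L = (\<chi> a. normalized_rep j L $ (if Some a = j then None else Some a))"

text \<open>
  The Fubini-Study form has the same expression in all affine charts, since
  \<open>log (\<parallel>z\<parallel>^2 / |z_j|^2)\<close> changes with \<open>j\<close> only by a pluriharmonic function.
\<close>

definition fubini_study :: "('k::finite hvec set, 'k) chart \<Rightarrow> 'k hvec set \<Rightarrow>
    complex^'k \<Rightarrow> complex^'k \<Rightarrow> real" where
  "fubini_study c L u v =
     Re (\<i> * del_delbar (\<lambda>w. complex_of_real (ln (1 + (norm w)\<^sup>2))) (snd c L) u v)"

text \<open>
  The fibre of the hyperplane bundle at a line \<open>L\<close> is the dual of \<open>L\<close>, with the metric dual to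
  the standard one; the choice of \<open>v\<close> in \<open>L\<close> is immaterial. For \<open>v\<close> normalized by
  \<open>z_0 = 1\<close> this gives \<open>1 / (1 + \<parallel>w\<parallel>^2)\<close> in the frame \<open>t_0\<close>.
\<close>

definition hyperplane_metric ::
    "'k::finite hvec set \<times> ('k hvec \<Rightarrow> complex) \<Rightarrow> 'k hvec set \<times> ('k hvec \<Rightarrow> complex) \<Rightarrow> complex" where
  "hyperplane_metric q q' =
     (let v = (SOME v. v \<in> fst q \<and> v \<noteq> 0)
      in cnj (snd q v) * snd q' v / complex_of_real ((norm v)\<^sup>2))"

definition projective_space ::
    "('k::finite hvec set, 'k, 'k hvec set \<times> ('k hvec \<Rightarrow> complex)) line_bundle_data" where
  "projective_space =
     \<lparr> mtop = proj_topology,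
       atlas = range (\<lambda>j. (affine_domain j, affine_coord j)),
       kform = fubini_study,
       total = {(L, f). L \<in> proj_points \<and> f \<in> extensional L \<and>
                  (\<forall>u\<in>L. \<forall>v\<in>L. f (u + v) = f u + f v) \<and>
                  (\<forall>c. \<forall>v\<in>L. f (c *s v) = c * f v)},
       proj = fst,
       bzero = (\<lambda>L. (L, \<lambda>v\<in>L. 0)),
       badd = (\<lambda>(L, f) (L', g). (L, \<lambda>v\<in>L. f v + g v)),
       bscale = (\<lambda>c (L, f). (L, \<lambda>v\<in>L. c * f v)),
       trivs = range (\<lambda>j. (affine_domain j, \<lambda>(L, f). f (normalized_rep j L))),
       metric = hyperplane_metric \<rparr>"

definition coord_section :: "'k::finite option \<Rightarrow> 'k hvec set \<Rightarrow> 'k hvec set \<times> ('k hvec \<Rightarrow> complex)" where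
  "coord_section j = (\<lambda>L\<in>proj_points. (L, \<lambda>v\<in>L. v $ j))"

section \<open>The coherent state embedding\<close>

text \<open>
  The point \<open>(s_0(x) : ... : s_N(x))\<close>: the choice of \<open>q \<noteq> 0\<close> over \<open>x\<close> identifies the fibre with
  the complex numbers, \<open>s_j(x)\<close> becoming \<open>q^(s_j)\<close>, and changing \<open>q\<close> rescales the vector.
  At a common zero of the \<open>s_j\<close> the value is \<open>{0}\<close>, which is not a point of projective space.
\<close>

definition coherent_map :: "('m, 'n::finite, 'l) line_bundle_data \<Rightarrow>
    ('k::finite option \<Rightarrow> 'm \<Rightarrow> 'l) \<Rightarrow> 'm \<Rightarrow> 'k hvec set" where
  "coherent_map Q s x = (\<Union>q\<in>nonzero_fibre Q x. hline (\<chi> j. qhat Q q (s j)))"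

text \<open>The type argument records \<open>N + 1\<close>, the dimension of the space of global sections.\<close>

definition very_ample :: "'k::finite itself \<Rightarrow> ('m, 'n::finite, 'l) line_bundle_data \<Rightarrow> bool" where
  "very_ample k Q \<longleftrightarrow>
     (\<exists>b :: 'k option \<Rightarrow> 'm \<Rightarrow> 'l. section_basis Q b \<and>
        holomorphic_embedding Q
          (projective_space :: ('k hvec set, 'k, 'k hvec set \<times> ('k hvec \<Rightarrow> complex)) line_bundle_data)
          (coherent_map Q b))"

text \<open>
  The fibre over \<open>x\<close> of the isomorphism from the pulled back hyperplane bundle to the bundle \<open>Q\<close>,
  under which the \<open>j\<close>-th coordinate section goes to \<open>s_j\<close>.
\<close>

definition pullback_iso :: "('m, 'n::finite, 'l) line_bundle_data \<Rightarrow>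
    ('k::finite option \<Rightarrow> 'm \<Rightarrow> 'l) \<Rightarrow> 'm \<Rightarrow> 'k hvec set \<times> ('k hvec \<Rightarrow> complex) \<Rightarrow> 'l" where
  "pullback_iso Q s x =
     (THE \<Phi>. let H = projective_space; F = fibre H (coherent_map Q s x) in
        \<Phi> \<in> extensional F \<and> bij_betw \<Phi> F (fibre Q x) \<and>
        (\<forall>p\<in>F. \<forall>p'\<in>F. \<Phi> (badd H p p') = badd Q (\<Phi> p) (\<Phi> p')) \<and>
        (\<forall>c. \<forall>p\<in>F. \<Phi> (bscale H c p) = bscale Q c (\<Phi> p)) \<and>
        (\<forall>j. \<Phi> (coord_section j (coherent_map Q s x)) = s j x))"

definition pullback_section :: "('m, 'n::finite, 'l) line_bundle_data \<Rightarrow>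
    ('k::finite option \<Rightarrow> 'm \<Rightarrow> 'l) \<Rightarrow>
    ('k hvec set \<Rightarrow> 'k hvec set \<times> ('k hvec \<Rightarrow> complex)) \<Rightarrow> 'm \<Rightarrow> 'l" where
  "pullback_section Q s t = (\<lambda>x\<in>points Q. pullback_iso Q s x (t (coherent_map Q s x)))"

definition pullback_fun2 :: "('m \<Rightarrow> 'p) \<Rightarrow> ('p \<Rightarrow> 'p \<Rightarrow> 'c) \<Rightarrow> 'm \<Rightarrow> 'm \<Rightarrow> 'c" where
  "pullback_fun2 f F x y = F (f x) (f y)"

end

theory Submission
  imports Defs "HOL-Complex_Analysis.Cauchy_Integral_Formula"
begin

text \<open>
  If \<open>s\<^sub>0, \<dots>, s\<^sub>N\<close> are orthogonal of common squared norm \<open>\<kappa>\<close> and span the sections, the coherent vector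
  \<open>e\<^sub>q\<close> has coordinates \<open>cnj (q^(s\<^sub>j)) / \<kappa>\<close>, so that normalised products of coherent vectors are
  normalised products of the vectors \<open>(q^(s\<^sub>j))\<^sub>j\<close>, which represent the points \<open>i(x)\<close>; \<open>\<kappa>\<close> cancels.
  This applies with \<open>\<kappa> = 1\<close> to the manifold, and to projective space as soon as its
  sections are known to be the linear forms and the coordinate forms to be orthogonal of equal norm.
  The latter follows from the invariance of the Liouville measure under sign changes and
  transpositions of the coordinates. The Liouville measure exists because the top power of a 2-form
  transforms by the real Jacobian determinant of a holomorphic map, which is nonnegative.
\<close>

section \<open>Change of variables for the Liouville density\<close>

text \<open>The measure is given by a definite description over an atlas that may be uncountable, so
  no scalar product can be evaluated before existence and uniqueness are proved. A countable
  subcover, cut into disjoint pieces, gives both, and uniqueness also turns symmetries of the form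
  into symmetries of the measure. The sign of the Jacobian is at stake because the density
  transforms by the determinant itself, Lebesgue measure by its absolute value. On projective space
  no integral is computed explicitly: the common squared norm of the \<open>N + 1\<close> coordinate
  forms is the total mass divided by \<open>N + 1\<close>, and it suffices that the mass is finite
  and positive. Equality of the lines \<open>i(x)\<close> settles (c), where only moduli occur. In
  (a) phases occur as well; they agree because the pullback isomorphism can be written down
  explicitly and respects the chosen vectors in these lines.\<close>

definition real_coord :: "'n::finite \<times> bool \<Rightarrow> complex^'n \<Rightarrow> real" where
  "real_coord a x = (if snd a then Im (x $ fst a) else Re (x $ fst a))"

lemma linear_real_coord: "linear (real_coord a)"
  by (intro linearI) (auto simp: real_coord_def)

lemma sum_prod_bool: "(\<Sum>a\<in>(UNIV::('n::finite \<times> bool) set). f a) = (\<Sum>j\<in>UNIV. f (j, False) + f (j, True))"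
proof -
  have "(\<Sum>a\<in>(UNIV::('n \<times> bool) set). f a) = (\<Sum>j\<in>UNIV. \<Sum>b\<in>UNIV. f (j, b))"
    by (subst sum.cartesian_product) (auto simp: UNIV_Times_UNIV[symmetric] simp del: UNIV_Times_UNIV)
  then show ?thesis by (simp add: UNIV_bool)
qed

lemma prod_prod_bool: "(\<Prod>a\<in>(UNIV::('n::finite \<times> bool) set). f a) = (\<Prod>j\<in>UNIV. f (j, False) * f (j, True))"
proof -
  have "(\<Prod>a\<in>(UNIV::('n \<times> bool) set). f a) = (\<Prod>j\<in>UNIV. \<Prod>b\<in>UNIV. f (j, b))"
    by (subst prod.cartesian_product) (auto simp: UNIV_Times_UNIV[symmetric] simp del: UNIV_Times_UNIV)
  then show ?thesis by (simp add: UNIV_bool)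
qed

lemma coord_frame_nth: "coord_frame (j, b) $ i = (if i = j then (if b then \<i> else 1) else 0)"
  by (auto simp: coord_frame_def axis_def)

lemma coord_frame_expansion: "x = (\<Sum>a\<in>UNIV. real_coord a x *\<^sub>R coord_frame a)"
proof (rule vec_eq_iff[THEN iffD2], rule allI)
  fix i
  have "(\<Sum>a\<in>UNIV. real_coord a x *\<^sub>R coord_frame a) $ i
      = (\<Sum>j\<in>UNIV. if i = j then complex_of_real (Re (x $ j)) + complex_of_real (Im (x $ j)) * \<i> else 0)"
    unfolding sum_component sum_prod_bool
    by (intro sum.cong refl) (auto simp: real_coord_def coord_frame_nth complex_eq_iff)
  also have "\<dots> = x $ i" by (simp add: complex_eq_iff)
  finally show "x $ i = (\<Sum>a\<in>UNIV. real_coord a x *\<^sub>R coord_frame a) $ i" by simp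
qed

lemma real_coord_coord_frame: "real_coord a (coord_frame b) = (if a = b then 1 else 0)"
  by (cases a; cases b) (auto simp: real_coord_def coord_frame_nth)

definition real_matrix :: "(complex^'n::finite \<Rightarrow> complex^'n) \<Rightarrow> real^('n \<times> bool)^('n \<times> bool)" where
  "real_matrix D = (\<chi> a b. real_coord a (D (coord_frame b)))"

text \<open>The Liouville density is a Pfaffian; expanding all products turns the sum over permutations into
  determinants of the matrices whose rows are selected from that of \<open>D\<close>.\<close>

lemma liouville_density_compose:
  fixes D :: "complex^'n::finite \<Rightarrow> complex^'n"
  assumes "bilinear \<beta>"
  shows "liouville_density (\<lambda>u v. \<beta> (D u) (D v)) = det (real_matrix D) * liouville_density \<beta>"
proof -
  define M where "M a b = real_coord a (D (coord_frame b))" for a b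
  define B where "B a b = \<beta> (coord_frame a) (coord_frame b)" for a b :: "'n \<times> bool"
  have exp: "\<beta> (D (coord_frame p)) (D (coord_frame q)) = (\<Sum>(a,b)\<in>UNIV. M a p * M b q * B a b)" for p q
  proof -
    have "\<beta> (D (coord_frame p)) (D (coord_frame q)) =
       \<beta> (\<Sum>a\<in>UNIV. M a p *\<^sub>R coord_frame a) (\<Sum>b\<in>UNIV. M b q *\<^sub>R coord_frame b)"
      using coord_frame_expansion[of "D (coord_frame p)"] coord_frame_expansion[of "D (coord_frame q)"]
      by (simp add: M_def)
    also have "\<dots> = (\<Sum>(a,b)\<in>UNIV \<times> UNIV. \<beta> (M a p *\<^sub>R coord_frame a) (M b q *\<^sub>R coord_frame b))"
      by (rule bilinear_sum[OF assms])
    also have "\<dots> = (\<Sum>(a,b)\<in>UNIV. M a p * M b q * B a b)"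
      by (auto intro!: sum.cong simp: bilinear_lmul[OF assms] bilinear_rmul[OF assms] B_def)
    finally show ?thesis .
  qed
  \<comment> \<open>Choosing a pair of indices for every \<open>j\<close> amounts to choosing one
    index for every element of \<open>'n \<times> bool\<close>.\<close>
  have reindex: "(\<Sum>h\<in>(UNIV::('n \<Rightarrow> ('n\<times>bool)\<times>('n\<times>bool)) set). F h) =
     (\<Sum>\<tau>\<in>(UNIV::('n\<times>bool \<Rightarrow> 'n\<times>bool) set). F (\<lambda>j. (\<tau> (j,False), \<tau> (j,True))))" for F :: "_ \<Rightarrow> real"
    by (rule sum.reindex_bij_witness[of _ "\<lambda>\<tau> j. (\<tau> (j,False), \<tau> (j,True))" "\<lambda>h (j,b). if b then snd (h j) else fst (h j)"])
      (auto simp: fun_eq_iff)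
  have prod_exp: "(\<Prod>j\<in>UNIV. \<beta> (D (coord_frame (\<sigma> (j, False)))) (D (coord_frame (\<sigma> (j, True))))) =
      (\<Sum>\<tau>\<in>UNIV. (\<Prod>i\<in>UNIV. M (\<tau> i) (\<sigma> i)) * (\<Prod>j\<in>UNIV. B (\<tau> (j,False)) (\<tau> (j,True))))" for \<sigma> :: "'n \<times> bool \<Rightarrow> 'n \<times> bool"
  proof -
    have "(\<Prod>j\<in>UNIV. \<beta> (D (coord_frame (\<sigma> (j, False)))) (D (coord_frame (\<sigma> (j, True))))) =
       (\<Prod>j\<in>UNIV. \<Sum>c\<in>UNIV. M (fst c) (\<sigma> (j,False)) * M (snd c) (\<sigma> (j,True)) * B (fst c) (snd c))"
      by (simp add: exp case_prod_beta)
    also have "\<dots> = (\<Sum>h\<in>Pi\<^sub>E UNIV (\<lambda>_. UNIV). \<Prod>j\<in>UNIV. M (fst (h j)) (\<sigma> (j,False)) * M (snd (h j)) (\<sigma> (j,True)) * B (fst (h j)) (snd (h j)))"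
      by (rule prod_sum_PiE) auto
    also have "\<dots> = (\<Sum>h\<in>UNIV. \<Prod>j\<in>UNIV. M (fst (h j)) (\<sigma> (j,False)) * M (snd (h j)) (\<sigma> (j,True)) * B (fst (h j)) (snd (h j)))"
      by simp
    also have "\<dots> = (\<Sum>\<tau>\<in>UNIV. (\<Prod>i\<in>UNIV. M (\<tau> i) (\<sigma> i)) * (\<Prod>j\<in>UNIV. B (\<tau> (j,False)) (\<tau> (j,True))))"
      by (subst reindex) (simp add: prod_prod_bool prod.distrib)
    finally show ?thesis .
  qed
  let ?P = "{\<sigma>. \<sigma> permutes (UNIV :: ('n \<times> bool) set)}"
  \<comment> \<open>For fixed \<open>\<tau>\<close> the signed sum over \<open>\<sigma>\<close> is
    the determinant whose \<open>i\<close>-th row is row \<open>\<tau> i\<close> of the matrix of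
    \<open>D\<close>. A \<open>\<tau>\<close> that is not injective repeats a row and contributes 0;
    a permutation contributes its sign.\<close>
  have rows: "(\<Sum>\<sigma>\<in>?P. of_int (sign \<sigma>) * (\<Prod>i\<in>UNIV. M (\<tau> i) (\<sigma> i))) =
      (if \<tau> permutes UNIV then of_int (sign \<tau>) * det (real_matrix D) else 0)" for \<tau>
  proof -
    have eq: "(\<Sum>\<sigma>\<in>?P. of_int (sign \<sigma>) * (\<Prod>i\<in>UNIV. M (\<tau> i) (\<sigma> i))) = det (\<chi> i. real_matrix D $ \<tau> i)"
      by (simp add: det_def real_matrix_def M_def)
    show ?thesis
    proof (cases "\<tau> permutes UNIV")
      case True
      then show ?thesis unfolding eq by (simp add: det_permute_rows)
    next
      case False
      then have "\<not> inj \<tau>"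
        using bij_imp_permutes[of \<tau> UNIV] finite_UNIV_inj_surj[of \<tau>] by (auto simp: bij_def)
      then obtain i j where "i \<noteq> j" "\<tau> i = \<tau> j" unfolding inj_def by blast
      then have "det (\<chi> i. real_matrix D $ \<tau> i) = 0"
        by (intro det_identical_rows[of i j]) (auto simp: row_def)
      then show ?thesis using False eq by simp
    qed
  qed
  have "(\<Sum>\<sigma>\<in>?P. of_int (sign \<sigma>) * (\<Prod>j\<in>UNIV. \<beta> (D (coord_frame (\<sigma> (j, False)))) (D (coord_frame (\<sigma> (j, True))))))
     = (\<Sum>\<tau>\<in>UNIV. (\<Sum>\<sigma>\<in>?P. of_int (sign \<sigma>) * (\<Prod>i\<in>UNIV. M (\<tau> i) (\<sigma> i))) * (\<Prod>j\<in>UNIV. B (\<tau> (j,False)) (\<tau> (j,True))))"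
    unfolding prod_exp sum_distrib_left sum_distrib_right
    by (subst sum.swap) (simp add: mult.assoc)
  also have "\<dots> = (\<Sum>\<tau>\<in>UNIV. if \<tau> permutes UNIV then of_int (sign \<tau>) * det (real_matrix D) * (\<Prod>j\<in>UNIV. B (\<tau> (j,False)) (\<tau> (j,True))) else 0)"
    unfolding rows by (intro sum.cong) auto
  also have "\<dots> = (\<Sum>\<tau>\<in>?P. of_int (sign \<tau>) * det (real_matrix D) * (\<Prod>j\<in>UNIV. B (\<tau> (j,False)) (\<tau> (j,True))))"
    by (simp add: sum.If_cases)
  also have "\<dots> = det (real_matrix D) * (\<Sum>\<tau>\<in>?P. of_int (sign \<tau>) * (\<Prod>j\<in>UNIV. B (\<tau> (j,False)) (\<tau> (j,True))))"
    by (simp add: sum_distrib_left mult_ac)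
  finally show ?thesis by (simp add: liouville_density_def B_def)
qed

lemma real_matrix_mult:
  assumes "linear D"
  shows "real_matrix (D \<circ> E) = real_matrix D ** real_matrix E"
proof -
  interpret D: linear D by fact
  have "real_coord a (D (E (coord_frame b))) =
      (\<Sum>k\<in>UNIV. real_coord a (D (coord_frame k)) * real_coord k (E (coord_frame b)))" for a b
  proof -
    interpret r: linear "real_coord a" by (rule linear_real_coord)
    have "D (E (coord_frame b)) = (\<Sum>k\<in>UNIV. real_coord k (E (coord_frame b)) *\<^sub>R D (coord_frame k))"
      by (subst coord_frame_expansion[of "E (coord_frame b)"]) (simp add: D.sum D.scaleR)
    then show ?thesis by (simp add: r.sum r.scaleR mult.commute)
  qed
  then show ?thesis by (simp add: real_matrix_def matrix_matrix_mult_def vec_eq_iff)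
qed

lemma real_matrix_ident: "real_matrix (\<lambda>v. v) = mat 1"
  by (simp add: real_matrix_def mat_def vec_eq_iff real_coord_coord_frame)

text \<open>The real determinant along \<open>(1 - z) I + z D\<close> does not vanish off the finitely many zeros of a
  complex polynomial, whose complement is connected, so that it keeps its sign at \<open>z = 0\<close>.\<close>

lemma det_real_matrix_complex_linear_nonneg:
  fixes D :: "complex^'n::finite \<Rightarrow> complex^'n"
  assumes lin: "linear D" and cl: "\<And>c v. D (c *s v) = c *s D v"
  shows "0 \<le> det (real_matrix D)"
proof -
  define A where "A = (\<chi> i j. D (axis j 1) $ i)"
  have DA: "D v = A *v v" for v
  proof -
    interpret D: linear D by fact
    have "D v = D (\<Sum>i\<in>UNIV. v $ i *s axis i 1)" by (simp add: basis_expansion)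
    also have "\<dots> = (\<Sum>i\<in>UNIV. v $ i *s D (axis i 1))" by (simp add: D.sum cl)
    also have "\<dots> = A *v v"
      by (simp add: vec_eq_iff A_def matrix_vector_mult_def mult.commute)
    finally show ?thesis .
  qed
  define Az where "Az z = (\<chi> i j. (if i = j then 1 - z else 0) + z * A $ i $ j)" for z
  define P where "P = det (\<chi> i j. [: if i = j then 1 else 0, A $ i $ j - (if i = j then 1 else 0) :])"
  have P: "poly P z = det (Az z)" for z
    unfolding P_def det_def poly_sum poly_mult poly_prod Az_def
    by (intro sum.cong arg_cong2[where f = "(*)"] prod.cong) (auto simp: algebra_simps sign_def)
  have "Az 0 = mat 1" by (simp add: Az_def mat_def vec_eq_iff)
  then have "poly P 0 = 1" by (simp add: P)
  then have "P \<noteq> 0" by auto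
  define S where "S = - {z. poly P z = 0}"
  have fin: "finite {z. poly P z = 0}" using \<open>P \<noteq> 0\<close> by (rule poly_roots_finite)
  have "connected S" unfolding S_def
    using connected_open_delete_finite[of "UNIV::complex set" "{z. poly P z = 0}"] fin convex_connected[OF convex_UNIV]
    by (simp add: Compl_eq_Diff_UNIV)
  define d where "d z = det (real_matrix (\<lambda>v. Az z *v v))" for z
  have Azv: "(Az z *v v) $ i = (1 - z) * v $ i + z * D v $ i" for z v i
    by (simp add: Az_def DA matrix_vector_mult_def distrib_right sum.distrib sum_distrib_left mult.assoc
        if_distrib[of "\<lambda>x. x * _"] cong: if_cong)
  have linA: "linear (\<lambda>v. Az z *v v)" for z
    by (simp add: matrix_vector_right_distrib linearI vec_eq_iff Azv scaleR_conv_of_real algebra_simps linear_scale[OF lin] linear_add[OF lin])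
  have "continuous_on UNIV (\<lambda>z. real_coord a (Az z *v v))" for a v
    by (cases "snd a") (auto simp: real_coord_def Azv intro!: continuous_intros)
  note entry = this
  have cont: "continuous_on UNIV d"
    unfolding d_def det_def real_matrix_def
    by (simp only: vec_lambda_beta) (intro continuous_on_sum continuous_on_mult continuous_on_const continuous_on_prod entry)
  \<comment> \<open>A complex inverse of \<open>Az z\<close> yields an inverse of its real matrix,
    so the real determinant can vanish only where the complex one does.\<close>
  have nz: "d z \<noteq> 0" if "z \<in> S" for z
  proof -
    have "det (Az z) \<noteq> 0" using that by (simp add: S_def P)
    then obtain B where B: "Az z ** B = mat 1" unfolding invertible_det_nz[symmetric] invertible_def by blast
    have "(\<lambda>v. Az z *v v) \<circ> (\<lambda>v. B *v v) = (\<lambda>v. v)" by (simp add: fun_eq_iff matrix_vector_mul_assoc B)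
    then have "real_matrix (\<lambda>v. Az z *v v) ** real_matrix (\<lambda>v. B *v v) = mat 1"
      by (metis real_matrix_mult[OF linA] real_matrix_ident)
    then have "d z * det (real_matrix (\<lambda>v. B *v v)) = 1"
      unfolding d_def by (metis det_mul det_I)
    then show ?thesis by auto
  qed
  have d0: "d 0 = 1" using \<open>Az 0 = mat 1\<close> by (simp add: d_def real_matrix_ident)
  have pos: "0 < d z" if "z \<in> S" for z
  proof (rule ccontr)
    assume *: "\<not> 0 < d z"
    have "0 \<in> S" using \<open>poly P 0 = 1\<close> by (simp add: S_def)
    have "connected (d ` S)"
      by (rule connected_continuous_image[OF continuous_on_subset[OF cont subset_UNIV] \<open>connected S\<close>])
    then have "0 \<in> d ` S"
      by (rule connectedD_interval[OF _ imageI[OF that] imageI[OF \<open>0 \<in> S\<close>]]) (use * d0 in auto)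
    with nz show False by auto
  qed
  \<comment> \<open>The point 1 is itself a zero of \<open>P\<close> when \<open>D\<close> is
    singular, so it is reached through density of \<open>S\<close> and continuity of
    \<open>d\<close>.\<close>
  have "closure S = UNIV" unfolding S_def closure_complement
    using fin by (simp add: empty_interior_finite)
  moreover have "closed {z. 0 \<le> d z}"
    by (rule closed_Collect_le[OF continuous_on_const cont])
  moreover have "S \<subseteq> {z. 0 \<le> d z}" using pos by (auto intro: less_imp_le)
  ultimately have "0 \<le> d 1" using closure_minimal by blast
  moreover have "(\<lambda>v. Az 1 *v v) = D" by (simp add: fun_eq_iff vec_eq_iff Azv)
  ultimately show ?thesis by (simp add: d_def)
qed

text \<open>Both sides may be infinite. The change of variables for absolutely integrable functions
  applies on the bounded sets \<open>G n\<close>, where the integrand is bounded too, and monotone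
  convergence passes to their union.\<close>

lemma nn_integral_change_of_variables:
  fixes g :: "real^'m::{finite,wellorder} \<Rightarrow> real^'m::_" and f :: "real^'m::_ \<Rightarrow> real"
  assumes S [measurable]: "S \<in> sets borel" and gS [measurable]: "g ` S \<in> sets borel"
    and der: "\<And>x. x \<in> S \<Longrightarrow> (g has_derivative g' x) (at x within S)"
    and inj: "inj_on g S"
    and mf: "(\<lambda>y. indicator (g ` S) y * f y) \<in> borel_measurable borel"
    and mJ: "(\<lambda>x. indicator S x * (\<bar>det (matrix (g' x))\<bar> * f (g x))) \<in> borel_measurable borel"
    and f0: "\<And>y. y \<in> g ` S \<Longrightarrow> 0 \<le> f y"
  shows "(\<integral>\<^sup>+x. ennreal (indicator S x * (\<bar>det (matrix (g' x))\<bar> * f (g x))) \<partial>lborel)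
       = (\<integral>\<^sup>+y. ennreal (indicator (g ` S) y * f y) \<partial>lborel)"
proof -
  define F where "F y = indicator (g ` S) y * f y" for y
  define J where "J x = indicator S x * (\<bar>det (matrix (g' x))\<bar> * f (g x))" for x
  have [measurable]: "F \<in> borel_measurable borel" "J \<in> borel_measurable borel"
    using mf mJ by (simp_all add: F_def[abs_def] J_def[abs_def])
  have F0: "0 \<le> F y" for y using f0 by (auto simp: F_def indicator_def)
  have J0: "0 \<le> J x" for x using f0 by (auto simp: J_def indicator_def)
  define G where "G n = {y \<in> g ` S. norm y \<le> real n \<and> F y \<le> real n}" for n
  have Gm [measurable]: "G n \<in> sets borel" for n unfolding G_def by measurable
  define T where "T n = {x \<in> S. g x \<in> G n}" for n
  have Tm [measurable]: "T n \<in> sets borel" for n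
  proof -
    have "continuous_on S g" using der by (meson continuous_on_eq_continuous_within has_derivative_continuous)
    then have "g \<in> borel_measurable (restrict_space borel S)" by (rule borel_measurable_continuous_on_restrict)
    then have "g -` G n \<inter> space (restrict_space borel S) \<in> sets (restrict_space borel S)"
      using Gm by (rule measurable_sets)
    moreover have "g -` G n \<inter> space (restrict_space borel S) = T n" by (auto simp: T_def space_restrict_space)
    ultimately show ?thesis by (simp add: sets_restrict_space_iff)
  qed
  have gT: "g ` T n = G n" for n by (auto simp: T_def G_def)
  have part: "(\<integral>\<^sup>+x. ennreal (indicator (T n) x * J x) \<partial>lborel) = (\<integral>\<^sup>+y. ennreal (indicator (G n) y * F y) \<partial>lborel)" for n
  proof -
    \<comment> \<open>The change of variables theorem is stated for vector-valued integrands, hence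
      the passage through \<open>real^1\<close>.\<close>
    let ?v = "\<lambda>y. vec (f y) :: real^1"
    have "integrable lborel (\<lambda>y. indicator (G n) y * F y)"
    proof (rule Bochner_Integration.integrable_bound)
      show "integrable lborel (\<lambda>y. indicator (cball 0 (real n)) y * real n)"
        by (rule integrable_mult_left) (rule integrable_real_indicator, simp, rule emeasure_bounded_finite, simp)
      show "AE y in lborel. norm (indicator (G n) y * F y) \<le> norm (indicator (cball 0 (real n)) y * real n)"
        using F0 by (auto simp: G_def indicator_def)
    qed measurable
    moreover have "(\<lambda>y. indicator (G n) y * F y) = (\<lambda>y. indicator (G n) y *\<^sub>R f y)"
      by (auto simp: F_def G_def indicator_def)
    ultimately have "integrable lebesgue (\<lambda>y. indicator (G n) y *\<^sub>R f y)"
      by (metis borel_measurable_integrable integrable_completion)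
    then have ai: "f absolutely_integrable_on (G n)" by (simp add: set_integrable_def)
    have eq: "(\<lambda>x. \<bar>det (matrix (g' x))\<bar> *\<^sub>R ?v (g x)) absolutely_integrable_on T n \<and>
           integral (T n) (\<lambda>x. \<bar>det (matrix (g' x))\<bar> *\<^sub>R ?v (g x)) = b
     \<longleftrightarrow> ?v absolutely_integrable_on (g ` T n) \<and> integral (g ` T n) ?v = b" for b
    proof (rule has_absolute_integral_change_of_variables)
      show "T n \<in> sets lebesgue" by simp
      show "(g has_derivative g' x) (at x within T n)" if "x \<in> T n" for x
        using der that by (auto simp: T_def intro: has_derivative_subset)
      show "inj_on g (T n)" using inj by (auto simp: T_def inj_on_def)
    qed
    have av: "?v absolutely_integrable_on (g ` T n)"
      using ai by (simp add: gT absolutely_integrable_on_1_iff)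
    with eq[of "integral (g ` T n) ?v"]
    have "(\<lambda>x. \<bar>det (matrix (g' x))\<bar> *\<^sub>R ?v (g x)) absolutely_integrable_on T n"
      and ie: "integral (T n) (\<lambda>x. \<bar>det (matrix (g' x))\<bar> *\<^sub>R ?v (g x)) = integral (G n) ?v"
      by (auto simp: gT)
    then have aj: "(\<lambda>x. \<bar>det (matrix (g' x))\<bar> * f (g x)) absolutely_integrable_on T n"
      by (simp add: absolutely_integrable_on_1_iff)
    from ie have ie': "integral (T n) (\<lambda>x. \<bar>det (matrix (g' x))\<bar> * f (g x)) = integral (G n) f"
      by (simp add: integral_on_1_eq vec_eq_iff)
    have "(\<integral>\<^sup>+x. ennreal (indicator (T n) x * (\<bar>det (matrix (g' x))\<bar> * f (g x))) \<partial>lborel)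
      = ennreal (integral (T n) (\<lambda>x. \<bar>det (matrix (g' x))\<bar> * f (g x)))"
      using aj f0 by (intro nn_integral_has_integral_lebesgue)
        (auto simp: T_def absolutely_integrable_on_def intro: integrable_integral)
    moreover have "(\<integral>\<^sup>+y. ennreal (indicator (G n) y * f y) \<partial>lborel) = ennreal (integral (G n) f)"
      using ai f0 by (intro nn_integral_has_integral_lebesgue)
        (auto simp: G_def absolutely_integrable_on_def intro: integrable_integral)
    moreover have "indicator (T n) x * (\<bar>det (matrix (g' x))\<bar> * f (g x)) = indicator (T n) x * J x" for x
      by (auto simp: J_def T_def indicator_def)
    moreover have "indicator (G n) y * f y = indicator (G n) y * F y" for y
      by (auto simp: F_def G_def indicator_def)
    ultimately show ?thesis by (simp add: ie')
  qed
  have lim: "(\<integral>\<^sup>+y. ennreal (h y) \<partial>lborel) = (SUP n. \<integral>\<^sup>+y. ennreal (indicator (H n) y * h y) \<partial>lborel)"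
    if [measurable]: "h \<in> borel_measurable borel" "\<And>n. H n \<in> sets borel" and h0: "\<And>y. 0 \<le> h y" and
      inc: "incseq H" and ex: "\<And>y. h y \<noteq> 0 \<Longrightarrow> \<exists>n. y \<in> H n"
    for h :: "real^'m::_ \<Rightarrow> real" and H
  proof -
    have "(SUP n. ennreal (indicator (H n) y * h y)) = ennreal (h y)" for y
    proof (cases "h y = 0")
      case False
      then obtain n where "y \<in> H n" using ex by blast
      then show ?thesis
        by (intro antisym SUP_least SUP_upper2[of n]) (auto simp: indicator_def h0)
    qed simp
    then have "(\<integral>\<^sup>+y. ennreal (h y) \<partial>lborel) = (\<integral>\<^sup>+y. (SUP n. ennreal (indicator (H n) y * h y)) \<partial>lborel)" by simp
    also have "\<dots> = (SUP n. \<integral>\<^sup>+y. ennreal (indicator (H n) y * h y) \<partial>lborel)"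
    proof (rule nn_integral_monotone_convergence_SUP)
      show "incseq (\<lambda>n y. ennreal (indicator (H n) y * h y))"
        using inc h0 by (auto simp: incseq_def le_fun_def indicator_def)
    qed measurable
    finally show ?thesis .
  qed
  have incG: "incseq G" by (auto simp: incseq_def G_def)
  have exG: "\<exists>n. y \<in> G n" if "y \<in> g ` S" for y
  proof -
    obtain n :: nat where "max (norm y) (F y) \<le> real n" using real_arch_simple by blast
    then show ?thesis using that by (auto simp: G_def)
  qed
  have "(\<integral>\<^sup>+y. ennreal (F y) \<partial>lborel) = (SUP n. \<integral>\<^sup>+y. ennreal (indicator (G n) y * F y) \<partial>lborel)"
  proof (rule lim)
    show "\<exists>n. y \<in> G n" if "F y \<noteq> 0" for y
      using that exG[of y] by (auto simp: F_def indicator_def split: if_splits)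
  qed (auto simp: F0 incG)
  moreover have "(\<integral>\<^sup>+x. ennreal (J x) \<partial>lborel) = (SUP n. \<integral>\<^sup>+x. ennreal (indicator (T n) x * J x) \<partial>lborel)"
  proof (rule lim)
    show "incseq T" using incG by (auto simp: incseq_def T_def)
    show "\<exists>n. y \<in> T n" if "J y \<noteq> 0" for y
      using that exG[of "g y"] by (auto simp: J_def T_def indicator_def split: if_splits)
  qed (auto simp: J0)
  ultimately have "(\<integral>\<^sup>+x. ennreal (J x) \<partial>lborel) = (\<integral>\<^sup>+y. ennreal (F y) \<partial>lborel)" by (simp add: part)
  then show ?thesis by (simp only: F_def J_def)
qed

text \<open>Conjugating a permutation by \<open>e\<close> preserves its sign, so the two Leibniz
  sums agree term by term. It compares a determinant over the real coordinates
  \<open>'n \<times> bool\<close> with one over the index type used for integration.\<close>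

lemma det_reindex:
  fixes A :: "'a::comm_ring_1^'b::finite^'b" and e :: "'c::finite \<Rightarrow> 'b"
  assumes e: "bij e"
  shows "det (\<chi> i j. A $ e i $ e j) = det A"
proof -
  let ?m = "map_permutation (UNIV :: 'c set) e"
  have inj: "inj e" and surj: "surj e" using e by (auto simp: bij_def)
  have mp: "?m p (e i) = e (p i)" for p i
    by (rule map_permutation_apply) (use inj in auto)
  have bij: "bij_betw ?m {p. p permutes UNIV} {p. p permutes UNIV}"
  proof (rule bij_betwI[where g = "map_permutation UNIV (inv e)"])
    have mp': "map_permutation UNIV (inv e) q (inv e i) = inv e (q i)" for q i
      by (rule map_permutation_apply) (use bij_imp_bij_inv[OF e] in \<open>auto simp: bij_def\<close>)
    show "map_permutation UNIV (inv e) (?m p) = p" for p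
    proof
      fix x show "map_permutation UNIV (inv e) (?m p) x = p x"
        using mp'[of "?m p" "e x"] inj by (simp add: mp)
    qed
    show "?m (map_permutation UNIV (inv e) q) = q" for q
    proof
      fix x show "?m (map_permutation UNIV (inv e) q) x = q x"
        using mp[of "map_permutation UNIV (inv e) q" "inv e x"] surj by (simp add: mp' surj_f_inv_f)
    qed
  qed (auto intro!: map_permutation_permutes[where A = UNIV] e bij_imp_bij_inv)
  have "det A = (\<Sum>p | p permutes (UNIV::'c set). of_int (sign (?m p)) * (\<Prod>i\<in>UNIV. A $ i $ ?m p i))"
    unfolding det_def by (rule sum.reindex_bij_betw[OF bij, symmetric])
  also have "\<dots> = (\<Sum>p | p permutes (UNIV::'c set). of_int (sign p) * (\<Prod>i\<in>UNIV. A $ e i $ e (p i)))"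
  proof (intro sum.cong refl)
    fix p assume p: "p \<in> {p. p permutes (UNIV::'c set)}"
    have "(\<Prod>i\<in>UNIV. A $ i $ ?m p i) = (\<Prod>i\<in>UNIV. A $ e i $ ?m p (e i))"
      by (rule prod.reindex_bij_betw[symmetric]) (rule e)
    then show "of_int (sign (?m p)) * (\<Prod>i\<in>UNIV. A $ i $ ?m p i) = of_int (sign p) * (\<Prod>i\<in>UNIV. A $ e i $ e (p i))"
      using p inj by (simp add: mp sign_map_permutation)
  qed
  finally show ?thesis by (simp add: det_def)
qed

section \<open>Lebesgue measure in complex and in real coordinates\<close>

lemma Basis_complex_vec: "(Basis :: (complex^'n::finite) set) = range coord_frame"
proof -
  have "axis j u \<in> range coord_frame" if "u \<in> Basis" for j :: 'n and u :: complex
    using that by (auto simp: Basis_complex_def coord_frame_def image_iff intro!: exI[of _ "u = \<i>"] exI[of _ j])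
  moreover have "coord_frame a \<in> Basis" for a :: "'n \<times> bool"
    by (auto simp: coord_frame_def Basis_complex_def)
  ultimately show ?thesis by (auto simp: Basis_vec_def)
qed

lemma inj_coord_frame: "inj coord_frame"
  by (intro injI) (metis real_coord_coord_frame zero_neq_one)

lemma inner_coord_frame: "x \<bullet> coord_frame a = real_coord a x"
  by (cases a) (auto simp: coord_frame_def inner_axis real_coord_def inner_complex_def)

lemma mem_box_complex_vec: "x \<in> box l u \<longleftrightarrow> (\<forall>a. real_coord a l < real_coord a x \<and> real_coord a x < real_coord a u)"
  by (auto simp: mem_box Basis_complex_vec inner_coord_frame)

definition to_real_vec :: "('i::finite \<Rightarrow> 'n::finite \<times> bool) \<Rightarrow> complex^'n \<Rightarrow> real^'i" where
  "to_real_vec e x = (\<chi> i. real_coord (e i) x)"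

definition of_real_vec :: "('i::finite \<Rightarrow> 'n::finite \<times> bool) \<Rightarrow> real^'i \<Rightarrow> complex^'n" where
  "of_real_vec e y = (\<Sum>i\<in>UNIV. y $ i *\<^sub>R coord_frame (e i))"

lemma linear_to_real_vec: "linear (to_real_vec e)"
  by (intro linearI) (simp_all add: to_real_vec_def vec_eq_iff
      linear_add[OF linear_real_coord] linear_scale[OF linear_real_coord])

lemma linear_of_real_vec: "linear (of_real_vec e)"
  by (intro linearI) (simp_all add: of_real_vec_def scaleR_left_distrib sum.distrib scaleR_sum_right)

context
  fixes e :: "'i::finite \<Rightarrow> 'n::finite \<times> bool"
  assumes e: "bij e"
begin

lemma real_coord_of_real_vec: "real_coord (e i) (of_real_vec e y) = y $ i"
proof -
  interpret r: linear "real_coord (e i)" by (rule linear_real_coord)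
  have "real_coord (e i) (of_real_vec e y) = (\<Sum>j\<in>UNIV. if j = i then y $ j else 0)"
    unfolding of_real_vec_def r.sum r.scaleR real_coord_coord_frame
    using e by (intro sum.cong) (auto dest: bij_is_inj injD)
  then show ?thesis by simp
qed

lemma to_of_real_vec: "to_real_vec e (of_real_vec e y) = y"
  by (simp add: to_real_vec_def real_coord_of_real_vec vec_eq_iff)

lemma of_to_real_vec: "of_real_vec e (to_real_vec e x) = x"
proof -
  have "of_real_vec e (to_real_vec e x) = (\<Sum>i\<in>UNIV. real_coord (e i) x *\<^sub>R coord_frame (e i))"
    by (simp add: of_real_vec_def to_real_vec_def)
  also have "\<dots> = (\<Sum>a\<in>UNIV. real_coord a x *\<^sub>R coord_frame a)"
    by (rule sum.reindex_bij_betw) (rule e)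
  finally show ?thesis using coord_frame_expansion[of x] by simp
qed

text \<open>Since \<open>coord_frame\<close> enumerates the standard basis, the preimage of a box is
  a box with the same side lengths, and the volumes of boxes determine Lebesgue measure.\<close>

lemma lborel_distr_of_real_vec: "distr lborel borel (of_real_vec e) = lborel"
proof (rule lborel_eqI[symmetric])
  fix l u :: "complex^'n" assume lu: "\<And>b. b \<in> Basis \<Longrightarrow> l \<bullet> b \<le> u \<bullet> b"
  have lu': "real_coord a l \<le> real_coord a u" for a
    using lu[of "coord_frame a"] by (simp add: Basis_complex_vec inner_coord_frame)
  have m: "of_real_vec e \<in> borel_measurable borel"
    by (intro borel_measurable_continuous_onI linear_continuous_on linear_conv_bounded_linear[THEN iffD1] linear_of_real_vec)
  have "of_real_vec e -` box l u = box (to_real_vec e l) (to_real_vec e u)"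
  proof -
    have "(\<forall>a. P a) \<longleftrightarrow> (\<forall>i. P (e i))" for P using e by (metis bij_pointE)
    note all_e = this
    show ?thesis
      unfolding mem_box_complex_vec set_eq_iff vimage_eq all_e
      by (auto simp: real_coord_of_real_vec mem_box_cart to_real_vec_def)
  qed
  then have "emeasure (distr lborel borel (of_real_vec e)) (box l u) = emeasure lborel (box (to_real_vec e l) (to_real_vec e u))"
    using m by (simp add: emeasure_distr)
  also have "\<dots> = (\<Prod>b\<in>Basis. (to_real_vec e u - to_real_vec e l) \<bullet> b)"
    by (intro emeasure_lborel_box) (auto simp: Basis_vec_def inner_axis to_real_vec_def intro: lu')
  also have "(\<Prod>b\<in>Basis. (to_real_vec e u - to_real_vec e l) \<bullet> b) = (\<Prod>i\<in>UNIV. real_coord (e i) u - real_coord (e i) l)"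
    by (rule prod.reindex_bij_witness[of _ "\<lambda>i. axis i 1" "\<lambda>b. axis_index b"])
      (auto simp: Basis_vec_def inner_axis to_real_vec_def)
  also have "\<dots> = (\<Prod>a\<in>UNIV. real_coord a u - real_coord a l)"
    by (rule prod.reindex_bij_betw) (rule e)
  also have "\<dots> = (\<Prod>b\<in>Basis. (u - l) \<bullet> b)"
    unfolding Basis_complex_vec
    by (subst prod.reindex) (auto simp: inj_coord_frame inner_coord_frame linear_diff[OF linear_real_coord])
  finally show "emeasure (distr lborel borel (of_real_vec e)) (box l u) = ennreal (\<Prod>b\<in>Basis. (u - l) \<bullet> b)" .
qed simp

lemma nn_integral_of_real_vec:
  assumes [measurable]: "h \<in> borel_measurable borel"
  shows "(\<integral>\<^sup>+x. h x \<partial>lborel) = (\<integral>\<^sup>+y. h (of_real_vec e y) \<partial>lborel)"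
proof -
  have m: "of_real_vec e \<in> measurable lborel borel"
    by (simp, intro borel_measurable_continuous_onI linear_continuous_on linear_conv_bounded_linear[THEN iffD1] linear_of_real_vec)
  show ?thesis
    by (subst lborel_distr_of_real_vec[symmetric]) (rule nn_integral_distr[OF m], simp)
qed

lemma det_matrix_real_vec:
  "det (matrix (to_real_vec e \<circ> D \<circ> of_real_vec e)) = det (real_matrix D)"
proof -
  have "of_real_vec e (axis k 1) = coord_frame (e k)" for k
  proof -
    have "of_real_vec e (axis k 1) = (\<Sum>i\<in>UNIV. if i = k then coord_frame (e i) else 0)"
      unfolding of_real_vec_def by (intro sum.cong) (auto simp: axis_def)
    then show ?thesis by simp
  qed
  note axis = this
  have "matrix (to_real_vec e \<circ> D \<circ> of_real_vec e) = (\<chi> i k. real_matrix D $ e i $ e k)"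
    by (simp add: matrix_def axis to_real_vec_def real_matrix_def)
  then show ?thesis by (simp add: det_reindex[OF e])
qed

end

text \<open>The density picks up the determinant of \<open>g' x\<close>, the Lebesgue integral its
  absolute value. The two coincide because \<open>g' x\<close> is complex linear.\<close>

lemma nn_integral_liouville_density_change:
  fixes g :: "complex^'n::finite \<Rightarrow> complex^'n"
  assumes S [measurable]: "S \<in> sets borel" and gS [measurable]: "g ` S \<in> sets borel"
    and der: "\<And>x. x \<in> S \<Longrightarrow> (g has_derivative g' x) (at x)"
    and cl: "\<And>x c v. x \<in> S \<Longrightarrow> g' x (c *s v) = c *s g' x v"
    and inj: "inj_on g S"
    and bil: "\<And>x. x \<in> S \<Longrightarrow> bilinear (\<beta> (g x))"
    and form: "\<And>x u v. x \<in> S \<Longrightarrow> \<alpha> x u v = \<beta> (g x) (g' x u) (g' x v)"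
    and ma: "(\<lambda>x. indicator S x * liouville_density (\<alpha> x)) \<in> borel_measurable borel"
    and mb: "(\<lambda>y. indicator (g ` S) y * liouville_density (\<beta> y)) \<in> borel_measurable borel"
  shows "(\<integral>\<^sup>+x\<in>S. ennreal (liouville_density (\<alpha> x)) \<partial>lborel)
       = (\<integral>\<^sup>+y\<in>g ` S. ennreal (liouville_density (\<beta> y)) \<partial>lborel)"
proof -
  \<comment> \<open>The type \<open>'n bit0\<close> has twice as many elements as \<open>'n\<close>
    and is wellordered, as the index type in \<open>nn_integral_change_of_variables\<close> has to
    be.\<close>
  have "card (UNIV :: 'n bit0 set) = card (UNIV :: ('n \<times> bool) set)"
    by (simp add: card_cartesian_product flip: UNIV_Times_UNIV)
  then obtain e :: "'n bit0 \<Rightarrow> 'n \<times> bool" where e: "bij e"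
    using finite_same_card_bij[of "UNIV :: 'n bit0 set" "UNIV :: ('n \<times> bool) set"] by auto
  define to' where "to' = to_real_vec e"
  define of' where "of' = of_real_vec e"
  note to_of = to_of_real_vec[OF e, folded to'_def of'_def]
  note of_to = of_to_real_vec[OF e, folded to'_def of'_def]
  have of_m [measurable]: "of' \<in> borel_measurable borel" unfolding of'_def
    by (intro borel_measurable_continuous_onI linear_continuous_on linear_conv_bounded_linear[THEN iffD1] linear_of_real_vec)
  have to_m [measurable]: "to' \<in> borel_measurable borel" unfolding to'_def
    by (intro borel_measurable_continuous_onI linear_continuous_on linear_conv_bounded_linear[THEN iffD1] linear_to_real_vec)
  define T where "T = of' -` S"
  define G where "G = to' \<circ> g \<circ> of'"
  define G' where "G' y = to' \<circ> g' (of' y) \<circ> of'" for y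
  \<comment> \<open>The densities carry no sign assumption. Since \<open>ennreal\<close> sends
    negative numbers to 0, truncating them at 0 changes neither integral and supplies the
    nonnegative integrand required.\<close>
  define a where "a x = max 0 (liouville_density (\<alpha> x))" for x
  define b where "b y = max 0 (liouville_density (\<beta> y))" for y
  have Tm: "T \<in> sets borel" unfolding T_def using of_m S by (metis measurable_sets_borel)
  have "y \<in> G ` T" if "of' y \<in> g ` S" for y
  proof -
    from that obtain x where x: "x \<in> S" "of' y = g x" by auto
    then have "y = G (to' x)" by (metis G_def comp_apply of_to to_of)
    moreover have "to' x \<in> T" using x by (simp add: T_def of_to)
    ultimately show ?thesis by blast
  qed
  then have GT: "G ` T = of' -` (g ` S)"
    by (auto simp: G_def T_def of_to)
  have GTm: "G ` T \<in> sets borel" unfolding GT using of_m gS by (metis measurable_sets_borel)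
  have am [measurable]: "(\<lambda>x. indicator S x * a x) \<in> borel_measurable borel"
  proof -
    have "(\<lambda>x. indicator S x * a x) = (\<lambda>x. max 0 (indicator S x * liouville_density (\<alpha> x)))"
      by (auto simp: a_def fun_eq_iff indicator_def)
    then show ?thesis using ma by simp
  qed
  have bm [measurable]: "(\<lambda>y. indicator (g ` S) y * b y) \<in> borel_measurable borel"
  proof -
    have "(\<lambda>y. indicator (g ` S) y * b y) = (\<lambda>y. max 0 (indicator (g ` S) y * liouville_density (\<beta> y)))"
      by (auto simp: b_def fun_eq_iff indicator_def)
    then show ?thesis using mb by simp
  qed
  have J: "\<bar>det (matrix (G' y))\<bar> * b (of' (G y)) = a (of' y)" if "y \<in> T" for y
  proof -
    let ?x = "of' y"
    have x: "?x \<in> S" using that by (simp add: T_def)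
    have d: "det (matrix (G' y)) = det (real_matrix (g' ?x))"
      unfolding G'_def to'_def of'_def by (rule det_matrix_real_vec[OF e])
    have d0: "0 \<le> det (real_matrix (g' ?x))"
      using der[OF x] cl[OF x] by (intro det_real_matrix_complex_linear_nonneg has_derivative_linear)
    have "\<alpha> ?x = (\<lambda>u v. \<beta> (g ?x) (g' ?x u) (g' ?x v))" by (intro ext) (rule form[OF x])
    then have "liouville_density (\<alpha> ?x) = det (real_matrix (g' ?x)) * liouville_density (\<beta> (g ?x))"
      using liouville_density_compose[OF bil[OF x], of "g' ?x"] by (simp only:)
    moreover have "of' (G y) = g ?x" by (simp add: G_def of_to)
    ultimately show ?thesis
      unfolding a_def b_def d abs_of_nonneg[OF d0] using d0 by (simp add: max_mult_distrib_left)
  qed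
  have m1: "(\<lambda>y. indicator S (of' y) * a (of' y)) \<in> borel_measurable borel"
    using measurable_compose[OF of_m am] .
  have m2: "(\<lambda>y. indicator (g ` S) (of' y) * b (of' y)) \<in> borel_measurable borel"
    using measurable_compose[OF of_m bm] .
  have i1: "indicator T y * (\<bar>det (matrix (G' y))\<bar> * b (of' (G y))) = indicator S (of' y) * a (of' y)" for y
    using J[of y] by (auto simp: indicator_def T_def)
  have i2: "indicator (G ` T) y * b (of' y) = indicator (g ` S) (of' y) * b (of' y)" for y
    by (simp add: GT indicator_def)
  have main: "(\<integral>\<^sup>+y. ennreal (indicator T y * (\<bar>det (matrix (G' y))\<bar> * b (of' (G y)))) \<partial>lborel)
       = (\<integral>\<^sup>+y. ennreal (indicator (G ` T) y * b (of' y)) \<partial>lborel)"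
  proof (rule nn_integral_change_of_variables[OF Tm GTm])
    show "inj_on G T" using inj unfolding inj_on_def G_def T_def by (metis comp_apply of_to to_of vimageE)
    show "(G has_derivative G' y) (at y within T)" if "y \<in> T" for y
    proof -
      have o: "(of' has_derivative of') (at y)" unfolding of'_def
        by (intro bounded_linear_imp_has_derivative linear_conv_bounded_linear[THEN iffD1] linear_of_real_vec)
      have t: "(to' has_derivative to') (at (g (of' y)))" unfolding to'_def
        by (intro bounded_linear_imp_has_derivative linear_conv_bounded_linear[THEN iffD1] linear_to_real_vec)
      have "(g has_derivative g' (of' y)) (at (of' y))" using der that by (simp add: T_def)
      then have "((\<lambda>y. to' (g (of' y))) has_derivative (\<lambda>v. to' (g' (of' y) (of' v)))) (at y)"
        by (rule has_derivative_compose[OF has_derivative_compose[OF o, of g], of _ to', OF _ t])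
      then show ?thesis
        unfolding G_def G'_def comp_def by (rule has_derivative_at_withinI)
    qed
    show "(\<lambda>y. indicator (G ` T) y * b (of' y)) \<in> borel_measurable borel"
      unfolding i2 by (rule m2)
    show "(\<lambda>y. indicator T y * (\<bar>det (matrix (G' y))\<bar> * b (of' (G y)))) \<in> borel_measurable borel"
      unfolding i1 by (rule m1)
  qed (auto simp: b_def)
  have "(\<integral>\<^sup>+x\<in>S. ennreal (liouville_density (\<alpha> x)) \<partial>lborel) = (\<integral>\<^sup>+x. ennreal (indicator S x * a x) \<partial>lborel)"
    by (intro nn_integral_cong) (auto simp: a_def indicator_def max_def ennreal_neg)
  also have "\<dots> = (\<integral>\<^sup>+y. ennreal (indicator S (of' y) * a (of' y)) \<partial>lborel)"
    unfolding of'_def by (rule nn_integral_of_real_vec[OF e]) measurable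
  also have "\<dots> = (\<integral>\<^sup>+y. ennreal (indicator (g ` S) (of' y) * b (of' y)) \<partial>lborel)"
    using main unfolding i1 i2 .
  also have "\<dots> = (\<integral>\<^sup>+y. ennreal (indicator (g ` S) y * b y) \<partial>lborel)"
    unfolding of'_def by (rule nn_integral_of_real_vec[OF e, symmetric]) measurable
  also have "\<dots> = (\<integral>\<^sup>+y\<in>g ` S. ennreal (liouville_density (\<beta> y)) \<partial>lborel)"
    by (intro nn_integral_cong) (auto simp: b_def indicator_def max_def ennreal_neg)
  finally show ?thesis .
qed

section \<open>The Liouville measure\<close>

definition chart_measure :: "('m, 'n::finite, 'z) kaehler_data_scheme \<Rightarrow> ('m, 'n) chart \<Rightarrow> 'm set \<Rightarrow> ennreal" where
  "chart_measure M c B =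
     (\<integral>\<^sup>+p\<in>snd c ` B. ennreal (liouville_density (kform M c (inv_into (fst c) (snd c) p))) \<partial>lborel)"

definition liouville_spec :: "('m, 'n::finite, 'z) kaehler_data_scheme \<Rightarrow> 'm measure \<Rightarrow> bool" where
  "liouville_spec M \<mu> \<longleftrightarrow> sets \<mu> = sets (sigma (points M) {U. openin (mtop M) U}) \<and>
     (\<forall>c\<in>atlas M. \<forall>B\<in>sets \<mu>. B \<subseteq> fst c \<longrightarrow> emeasure \<mu> B = chart_measure M c B)"

text \<open>For the identity this is compatibility of the form with a change of charts; for other
  \<open>\<phi>\<close> it says that \<open>\<phi>\<close> is a holomorphic symmetry at
  \<open>x\<close>. One notion thus serves both the gluing of the local measures and their
  invariance.\<close>

definition pulls_back_form ::
  "('m, 'n::finite, 'z) kaehler_data_scheme \<Rightarrow> ('m, 'n) chart \<Rightarrow> ('m, 'n) chart \<Rightarrow> ('m \<Rightarrow> 'm) \<Rightarrow> 'm \<Rightarrow> bool" where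
  "pulls_back_form M c d \<phi> x \<longleftrightarrow> (\<exists>D.
     ((\<lambda>p. snd d (\<phi> (inv_into (fst c) (snd c) p))) has_derivative D) (at (snd c x)) \<and>
     (\<forall>a v. D (a *s v) = a *s D v) \<and>
     (\<forall>u v. kform M c x u v = kform M d (\<phi> x) (D u) (D v)))"

lemma liouville_measure_spec: "liouville_measure M = (THE \<mu>. liouville_spec M \<mu>)"
  unfolding liouville_measure_def liouville_spec_def chart_measure_def by (simp add: case_prod_beta)

text \<open>The charts in \<open>C\<close> are singled out because measures can be glued by
  countable sums, while the atlas may be uncountable.\<close>

locale liouville_manifold =
  fixes M :: "('m, 'n::finite, 'z) kaehler_data_scheme" and C :: "('m, 'n) chart set"
  assumes chart: "c \<in> atlas M \<Longrightarrow> openin (mtop M) (fst c) \<and> open (snd c ` fst c) \<and>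
      homeomorphic_map (subtopology (mtop M) (fst c)) (top_of_set (snd c ` fst c)) (snd c)"
    and C: "C \<subseteq> atlas M" "countable C" "(\<Union>c\<in>C. fst c) = points M"
    and transition: "c \<in> atlas M \<Longrightarrow> d \<in> atlas M \<Longrightarrow> x \<in> fst c \<inter> fst d \<Longrightarrow> pulls_back_form M c d (\<lambda>x. x) x"
    and bilinear_kform: "c \<in> atlas M \<Longrightarrow> x \<in> fst c \<Longrightarrow> bilinear (kform M c x)"
    and continuous_density: "c \<in> atlas M \<Longrightarrow>
      continuous_on (snd c ` fst c) (\<lambda>p. liouville_density (kform M c (inv_into (fst c) (snd c) p)))"
begin

section \<open>Borel sets and charts\<close>

definition borel_sets :: "'m measure" where
  "borel_sets = sigma (points M) {U. openin (mtop M) U}"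

lemma space_borel_sets: "space borel_sets = points M"
  unfolding borel_sets_def by (rule space_measure_of) (auto dest: openin_subset)

lemma open_in_borel_sets: "openin (mtop M) U \<Longrightarrow> U \<in> sets borel_sets"
  unfolding borel_sets_def by (subst sets_measure_of) (auto dest: openin_subset)

lemma measurable_borel_setsI:
  assumes "\<And>x. x \<in> space N \<Longrightarrow> f x \<in> points M"
    and "\<And>U. openin (mtop M) U \<Longrightarrow> f -` U \<inter> space N \<in> sets N"
  shows "f \<in> measurable N borel_sets"
  unfolding borel_sets_def by (rule measurable_measure_of) (use assms in \<open>auto dest: openin_subset\<close>)

lemma chart_borel: "c \<in> atlas M \<Longrightarrow> fst c \<in> sets borel_sets"
  using chart by (blast intro: open_in_borel_sets)

lemma chart_subset: "c \<in> atlas M \<Longrightarrow> fst c \<subseteq> points M"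
  using chart openin_subset by blast

lemma inj_chart: assumes "c \<in> atlas M" shows "inj_on (snd c) (fst c)"
  using chart[OF assms] chart_subset[OF assms] homeomorphic_imp_injective_map
  by (fastforce simp: Int_absorb1)

lemma inv_chart: "c \<in> atlas M \<Longrightarrow> x \<in> fst c \<Longrightarrow> inv_into (fst c) (snd c) (snd c x) = x"
  using inj_chart by (simp add: inv_into_f_f)

lemma open_chart_image:
  assumes c: "c \<in> atlas M" and W: "openin (mtop M) W"
  shows "open (snd c ` (fst c \<inter> W))"
proof -
  have "open_map (subtopology (mtop M) (fst c)) (top_of_set (snd c ` fst c)) (snd c)"
    using chart[OF c] homeomorphic_imp_open_map by blast
  moreover have "openin (subtopology (mtop M) (fst c)) (fst c \<inter> W)"
    using W by (auto simp: openin_subtopology)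
  ultimately have "openin (top_of_set (snd c ` fst c)) (snd c ` (fst c \<inter> W))"
    by (auto simp: open_map_def)
  then show ?thesis using chart[OF c] openin_open_trans by blast
qed

lemma measurable_inv_chart:
  assumes c: "c \<in> atlas M"
  shows "inv_into (fst c) (snd c) \<in> measurable (restrict_space borel (snd c ` fst c)) borel_sets"
proof (rule measurable_borel_setsI)
  show "inv_into (fst c) (snd c) x \<in> points M" if "x \<in> space (restrict_space borel (snd c ` fst c))" for x
    using that chart_subset[OF c] inv_chart[OF c] by (auto simp: space_restrict_space)
  fix U assume U: "openin (mtop M) U"
  have "inv_into (fst c) (snd c) -` U \<inter> space (restrict_space borel (snd c ` fst c)) = snd c ` (fst c \<inter> U)"
    using inv_chart[OF c] by (auto simp: space_restrict_space)
  moreover have "snd c ` (fst c \<inter> U) \<in> sets borel" using open_chart_image[OF c U] by simp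
  ultimately show "inv_into (fst c) (snd c) -` U \<inter> space (restrict_space borel (snd c ` fst c))
      \<in> sets (restrict_space borel (snd c ` fst c))"
    using chart[OF c] by (auto simp: sets_restrict_space_iff)
qed

lemma chart_image_borel:
  assumes c: "c \<in> atlas M" and B: "B \<in> sets borel_sets"
  shows "snd c ` (fst c \<inter> B) \<in> sets borel"
proof -
  have "inv_into (fst c) (snd c) -` B \<inter> space (restrict_space borel (snd c ` fst c)) = snd c ` (fst c \<inter> B)"
    using inv_chart[OF c] by (auto simp: space_restrict_space)
  with measurable_sets[OF measurable_inv_chart[OF c] B] show ?thesis
    using chart[OF c] by (auto simp: sets_restrict_space_iff)
qed

lemma measurable_density:
  assumes c: "c \<in> atlas M" and B: "B \<in> sets borel" "B \<subseteq> snd c ` fst c"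
  shows "(\<lambda>p. indicator B p * liouville_density (kform M c (inv_into (fst c) (snd c) p))) \<in> borel_measurable borel"
proof -
  have "(\<lambda>p. indicator B p *\<^sub>R liouville_density (kform M c (inv_into (fst c) (snd c) p))) \<in> borel_measurable borel"
    by (rule borel_measurable_continuous_on_indicator[OF B(1) continuous_on_subset[OF continuous_density[OF c] B(2)]])
  then show ?thesis by simp
qed

text \<open>As a push-forward this is a measure by construction, so countable additivity of
  \<open>chart_measure\<close> inside one chart needs no separate argument.\<close>

definition local_measure :: "('m, 'n) chart \<Rightarrow> 'm measure" where
  "local_measure c = distr (density (restrict_space lborel (snd c ` fst c))
      (\<lambda>p. ennreal (liouville_density (kform M c (inv_into (fst c) (snd c) p))))) borel_sets (inv_into (fst c) (snd c))"

lemma sets_local_measure: "sets (local_measure c) = sets borel_sets"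
  by (simp add: local_measure_def)

lemma emeasure_local_measure:
  assumes c: "c \<in> atlas M" and B: "B \<in> sets borel_sets" "B \<subseteq> fst c"
  shows "emeasure (local_measure c) B = chart_measure M c B"
proof -
  let ?d = "\<lambda>p. ennreal (liouville_density (kform M c (inv_into (fst c) (snd c) p)))"
  let ?R = "restrict_space lborel (snd c ` fst c)"
  have U: "snd c ` fst c \<in> sets borel" using chart[OF c] by auto
  have "(\<lambda>p. liouville_density (kform M c (inv_into (fst c) (snd c) p))) \<in> borel_measurable (restrict_space borel (snd c ` fst c))"
    by (rule borel_measurable_continuous_on_restrict[OF continuous_density[OF c]])
  then have dm: "?d \<in> borel_measurable ?R"
    by (simp cong: measurable_cong_sets sets_restrict_space_cong add: measurable_compose[OF _ measurable_ennreal] sets_restrict_space_cong[of lborel borel])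
  have Bm: "snd c ` B \<in> sets borel" using chart_image_borel[OF c B(1)] B(2) by (simp add: Int_absorb1)
  have pre: "inv_into (fst c) (snd c) -` B \<inter> snd c ` fst c = snd c ` B"
    using inv_chart[OF c] B(2) by auto
  have im: "inv_into (fst c) (snd c) \<in> measurable (density ?R ?d) borel_sets"
    using measurable_inv_chart[OF c]
    by (simp cong: measurable_cong_sets add: sets_restrict_space_cong[of lborel borel])
  have "emeasure (local_measure c) B = emeasure (density ?R ?d) (snd c ` B)"
    unfolding local_measure_def using im B by (simp add: emeasure_distr space_restrict_space pre)
  also have "\<dots> = (\<integral>\<^sup>+p\<in>snd c ` B. ?d p \<partial>?R)"
    using dm Bm U B by (subst emeasure_density) (auto simp: sets_restrict_space_iff)
  also have "\<dots> = (\<integral>\<^sup>+p. ?d p * indicator (snd c ` B) p * indicator (snd c ` fst c) p \<partial>lborel)"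
    using U by (subst nn_integral_restrict_space) auto
  also have "\<dots> = chart_measure M c B"
    unfolding chart_measure_def using B(2) by (intro nn_integral_cong) (auto simp: indicator_def)
  finally show ?thesis .
qed

section \<open>Change of charts and gluing of the local measures\<close>

lemma chart_measure_change:
  assumes c: "c \<in> atlas M" and d: "d \<in> atlas M"
    and B: "B \<in> sets borel_sets" "B \<subseteq> fst c"
    and \<phi>: "\<phi> ` B \<in> sets borel_sets" "\<phi> ` B \<subseteq> fst d" "inj_on \<phi> B"
    and pb: "\<And>x. x \<in> B \<Longrightarrow> pulls_back_form M c d \<phi> x"
  shows "chart_measure M c B = chart_measure M d (\<phi> ` B)"
proof -
  define g where "g p = snd d (\<phi> (inv_into (fst c) (snd c) p))" for p
  have g: "g (snd c x) = snd d (\<phi> x)" if "x \<in> B" for x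
    using that B(2) inv_chart[OF c] by (auto simp: g_def)
  have gB: "g ` snd c ` B = snd d ` \<phi> ` B" using g by (force simp: image_image)
  have "\<exists>D. \<forall>x\<in>B. (g has_derivative D x) (at (snd c x)) \<and> (\<forall>a v. D x (a *s v) = a *s D x v) \<and>
     (\<forall>u v. kform M c x u v = kform M d (\<phi> x) (D x u) (D x v))"
    using pb unfolding pulls_back_form_def g_def by (intro bchoice) auto
  then obtain D where D: "\<And>x. x \<in> B \<Longrightarrow> (g has_derivative D x) (at (snd c x))"
    "\<And>x a v. x \<in> B \<Longrightarrow> D x (a *s v) = a *s D x v"
    "\<And>x u v. x \<in> B \<Longrightarrow> kform M c x u v = kform M d (\<phi> x) (D x u) (D x v)" by blast
  have ic: "inv_into (fst c) (snd c) (snd c x) = x" if "x \<in> B" for x using that B(2) inv_chart[OF c] by auto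
  have id: "inv_into (fst d) (snd d) (snd d (\<phi> x)) = \<phi> x" if "x \<in> B" for x using that \<phi>(2) inv_chart[OF d] by auto
  have sB: "snd c ` B \<in> sets borel" using chart_image_borel[OF c B(1)] B(2) by (simp add: Int_absorb1)
  have sB': "snd d ` \<phi> ` B \<in> sets borel" using chart_image_borel[OF d \<phi>(1)] \<phi>(2) by (simp add: Int_absorb1)
  have "chart_measure M c B = (\<integral>\<^sup>+y\<in>g ` snd c ` B. ennreal (liouville_density (kform M d (inv_into (fst d) (snd d) y))) \<partial>lborel)"
    unfolding chart_measure_def
  proof (rule nn_integral_liouville_density_change[where g' = "\<lambda>p. D (inv_into (fst c) (snd c) p)"])
    show "inj_on g (snd c ` B)"
    proof (intro inj_onI, elim imageE, hypsubst)
      fix x y assume *: "x \<in> B" "y \<in> B" "g (snd c x) = g (snd c y)"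
      then have "\<phi> x = \<phi> y" using inj_chart[OF d] \<phi>(2) g by (auto simp: inj_on_def)
      then show "snd c x = snd c y" using * \<phi>(3) by (auto simp: inj_on_def)
    qed
  qed (use sB sB' gB B \<phi> D g ic id bilinear_kform[OF d] in \<open>auto intro!: measurable_density c d image_mono\<close>)
  then show ?thesis by (simp add: gB chart_measure_def)
qed

text \<open>Every point is given to the first chart of \<open>C\<close> that contains it. This cuts
  the manifold into countably many disjoint Borel sets, each inside one chart.\<close>

definition piece :: "('m, 'n) chart \<Rightarrow> 'm set" where
  "piece c = fst c - (\<Union>d\<in>{d\<in>C. to_nat_on C d < to_nat_on C c}. fst d)"

lemma piece_borel:
  assumes "c \<in> C"
  shows "piece c \<in> sets borel_sets"
proof -
  have "fst d \<in> sets borel_sets" if "d \<in> C" for d using that C(1) chart_borel by blast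
  moreover have "countable {d \<in> C. to_nat_on C d < to_nat_on C c}" using C(2) by (rule countable_subset[rotated]) auto
  ultimately show ?thesis
    unfolding piece_def using assms by (intro sets.Diff sets.countable_UN') blast+
qed

lemma piece_subset: "piece c \<subseteq> fst c" by (auto simp: piece_def)

lemma disjoint_pieces: "disjoint_family_on piece C"
proof -
  have "piece c \<inter> piece d = {}" if "c \<in> C" "to_nat_on C c < to_nat_on C d" for c d
    using that unfolding piece_def by blast
  moreover have "to_nat_on C c \<noteq> to_nat_on C d" if "c \<in> C" "d \<in> C" "c \<noteq> d" for c d
    using that C(2) by simp
  ultimately show ?thesis
    unfolding disjoint_family_on_def by (metis inf_commute linorder_neqE_nat)
qed

lemma Union_pieces: "(\<Union>c\<in>C. piece c) = points M"
proof
  show "(\<Union>c\<in>C. piece c) \<subseteq> points M" using piece_subset C(3) by blast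
  show "points M \<subseteq> (\<Union>c\<in>C. piece c)"
  proof
    fix x assume "x \<in> points M"
    then obtain c where "c \<in> C" "x \<in> fst c" using C(3) by blast
    then obtain d where "d \<in> C \<and> x \<in> fst d" "\<forall>e. to_nat_on C e < to_nat_on C d \<longrightarrow> \<not> (e \<in> C \<and> x \<in> fst e)"
      using ex_has_least_nat[of "\<lambda>d. d \<in> C \<and> x \<in> fst d" c "to_nat_on C"] by (meson leD)
    then show "x \<in> (\<Union>c\<in>C. piece c)" by (auto simp: piece_def)
  qed
qed

lemma emeasure_pieces:
  assumes N: "sets N = sets borel_sets" and B: "B \<in> sets borel_sets"
  shows "emeasure N B = (\<integral>\<^sup>+c. emeasure N (B \<inter> piece c) \<partial>count_space C)"
proof -
  have "B \<subseteq> points M" using sets.sets_into_space[OF B] by (simp add: space_borel_sets)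
  then have "B = (\<Union>c\<in>C. B \<inter> piece c)" using Union_pieces by blast
  then have "emeasure N B = emeasure N (\<Union>c\<in>C. B \<inter> piece c)" by simp
  also have "\<dots> = (\<integral>\<^sup>+c. emeasure N (B \<inter> piece c) \<partial>count_space C)"
  proof (rule emeasure_UN_countable)
    show "disjoint_family_on (\<lambda>c. B \<inter> piece c) C"
      using disjoint_pieces unfolding disjoint_family_on_def by blast
  qed (use C(2) B N piece_borel in auto)
  finally show ?thesis .
qed

text \<open>The right-hand side does not mention \<open>N\<close>, whence uniqueness.\<close>

lemma liouville_spec_emeasure:
  assumes "liouville_spec M N" and "B \<in> sets borel_sets"
  shows "emeasure N B = (\<integral>\<^sup>+c. chart_measure M c (B \<inter> piece c) \<partial>count_space C)"
proof -
  have N: "sets N = sets borel_sets" using assms(1) by (simp add: liouville_spec_def borel_sets_def)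
  show ?thesis unfolding emeasure_pieces[OF N assms(2)]
  proof (rule nn_integral_cong)
    fix c assume "c \<in> space (count_space C)"
    then have "c \<in> C" by simp
    then show "emeasure N (B \<inter> piece c) = chart_measure M c (B \<inter> piece c)"
      using assms piece_borel[of c] piece_subset[of c] C(1) N unfolding liouville_spec_def by blast
  qed
qed

text \<open>The measure is the sum of the local measures over the pieces, each taken in its own
  chart. For a set inside an arbitrary chart \<open>c\<close> of the atlas, every summand may be
  computed in \<open>c\<close> instead, by \<open>chart_measure_change\<close> for the identity; the
  sum is then the value prescribed by \<open>c\<close>.\<close>

lemma ex_liouville_spec: "\<exists>N. liouville_spec M N"
proof -
  define m where "m B = (\<integral>\<^sup>+c. emeasure (local_measure c) (B \<inter> piece c) \<partial>count_space C)" for B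
  define N where "N = measure_of (points M) (sets borel_sets) m"
  have sa: "sigma_algebra (points M) (sets borel_sets)"
    using sets.sigma_algebra_axioms[of borel_sets] by (simp add: space_borel_sets)
  have sN: "sets N = sets borel_sets"
    unfolding N_def using sigma_algebra.sets_measure_of_eq[OF sa] by simp
  have eN: "emeasure N B = m B" if "B \<in> sets borel_sets" for B
  proof (rule emeasure_measure_of_sigma[OF sa, of m, folded N_def])
    show "positive (sets borel_sets) m" by (simp add: positive_def m_def)
    show "countably_additive (sets borel_sets) m"
    proof (rule countably_additiveI)
      fix A :: "nat \<Rightarrow> 'm set" assume A: "range A \<subseteq> sets borel_sets" "disjoint_family A"
      have "(\<Sum>i. m (A i)) = (\<integral>\<^sup>+c. (\<Sum>i. emeasure (local_measure c) (A i \<inter> piece c)) \<partial>count_space C)"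
        unfolding m_def by (rule nn_integral_suminf[symmetric]) simp
      also have "\<dots> = m (\<Union>i. A i)"
        unfolding m_def
      proof (rule nn_integral_cong)
        fix c assume "c \<in> space (count_space C)"
        then have "c \<in> C" by simp
        have "(\<Sum>i. emeasure (local_measure c) (A i \<inter> piece c)) = emeasure (local_measure c) (\<Union>i. A i \<inter> piece c)"
          using A piece_borel[OF \<open>c \<in> C\<close>]
          by (intro suminf_emeasure) (auto simp: sets_local_measure disjoint_family_on_def)
        moreover have "(\<Union>i. A i \<inter> piece c) = (\<Union>i. A i) \<inter> piece c" by blast
        ultimately show "(\<Sum>i. emeasure (local_measure c) (A i \<inter> piece c)) = emeasure (local_measure c) ((\<Union>i. A i) \<inter> piece c)"
          by (simp only:)
      qed
      finally show "(\<Sum>i. m (A i)) = m (\<Union>i. A i)" .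
    qed
  qed (use that in simp)
  have "emeasure N B = chart_measure M c B" if c: "c \<in> atlas M" and B: "B \<in> sets borel_sets" "B \<subseteq> fst c" for c B
  proof -
    have "emeasure N B = (\<integral>\<^sup>+d. emeasure (local_measure c) (B \<inter> piece d) \<partial>count_space C)"
      unfolding eN[OF B(1)] m_def
    proof (rule nn_integral_cong)
      fix d assume "d \<in> space (count_space C)"
      then have d: "d \<in> C" by simp
      then have d': "d \<in> atlas M" using C(1) by blast
      have Bd: "B \<inter> piece d \<in> sets borel_sets" using B piece_borel[OF d] by blast
      have sub: "B \<inter> piece d \<subseteq> fst c" "B \<inter> piece d \<subseteq> fst d" using B piece_subset[of d] by auto
      have "chart_measure M d (B \<inter> piece d) = chart_measure M c ((\<lambda>x. x) ` (B \<inter> piece d))"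
      proof (rule chart_measure_change[OF d' c Bd sub(2)])
        show "pulls_back_form M d c (\<lambda>x. x) x" if "x \<in> B \<inter> piece d" for x
          using transition[OF d' c, of x] sub that by blast
      qed (use Bd sub in \<open>simp_all only: image_ident inj_on_id2\<close>)
      then show "emeasure (local_measure d) (B \<inter> piece d) = emeasure (local_measure c) (B \<inter> piece d)"
        by (simp add: emeasure_local_measure[OF d' Bd sub(2)] emeasure_local_measure[OF c Bd sub(1)])
    qed
    also have "\<dots> = emeasure (local_measure c) B"
      by (rule emeasure_pieces[symmetric]) (use B sets_local_measure in auto)
    finally show ?thesis using emeasure_local_measure[OF c B] by simp
  qed
  then have "liouville_spec M N" using sN by (auto simp: liouville_spec_def borel_sets_def)
  then show ?thesis ..
qed

lemma liouville_spec_unique: "liouville_spec M N \<Longrightarrow> liouville_spec M N' \<Longrightarrow> N = N'"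
  by (rule measure_eqI) (auto simp: liouville_spec_def borel_sets_def[symmetric] liouville_spec_emeasure)

text \<open>Existence and uniqueness turn the definite description into a characterisation, so that
  a measure is identified by checking its values inside charts.\<close>

lemma liouville_spec_iff: "liouville_spec M N \<longleftrightarrow> N = liouville_measure M"
  unfolding liouville_measure_spec
  using ex_liouville_spec liouville_spec_unique by (metis the_equality)

lemma sets_liouville_measure: "sets (liouville_measure M) = sets borel_sets"
  using liouville_spec_iff by (auto simp: liouville_spec_def borel_sets_def)

lemma space_liouville_measure: "space (liouville_measure M) = points M"
  using sets_eq_imp_space_eq[OF sets_liouville_measure] space_borel_sets by simp

lemma emeasure_liouville_measure:
  "c \<in> atlas M \<Longrightarrow> B \<in> sets borel_sets \<Longrightarrow> B \<subseteq> fst c \<Longrightarrow> emeasure (liouville_measure M) B = chart_measure M c B"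
  using liouville_spec_iff sets_liouville_measure unfolding liouville_spec_def by blast

text \<open>By uniqueness it is enough that the image measure has the prescribed values on a set
  \<open>B\<close> inside a chart \<open>d\<close>. The preimage of \<open>B\<close> is cut along
  the pieces, each part is carried into \<open>d\<close> by \<open>chart_measure_change\<close>, and
  the images partition \<open>B\<close>.\<close>

lemma distr_liouville_measure:
  assumes \<phi>: "\<phi> \<in> measurable borel_sets borel_sets" "\<psi> \<in> measurable borel_sets borel_sets"
    and inv: "\<And>x. x \<in> points M \<Longrightarrow> \<psi> (\<phi> x) = x" "\<And>x. x \<in> points M \<Longrightarrow> \<phi> (\<psi> x) = x"
    and pb: "\<And>c d x. c \<in> atlas M \<Longrightarrow> d \<in> atlas M \<Longrightarrow> x \<in> fst c \<Longrightarrow> \<phi> x \<in> fst d \<Longrightarrow> pulls_back_form M c d \<phi> x"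
  shows "distr (liouville_measure M) (liouville_measure M) \<phi> = liouville_measure M"
proof -
  let ?L = "liouville_measure M"
  have m: "\<phi> \<in> measurable ?L ?L" using \<phi>(1) by (simp cong: measurable_cong_sets add: sets_liouville_measure)
  have \<psi>p: "\<psi> x \<in> points M" if "x \<in> points M" for x
    using measurable_space[OF \<phi>(2)] that by (simp add: space_borel_sets)
  have "emeasure (distr ?L ?L \<phi>) B = chart_measure M d B" if d: "d \<in> atlas M" and B: "B \<in> sets borel_sets" "B \<subseteq> fst d" for d B
  proof -
    let ?P = "\<phi> -` B \<inter> points M"
    have P: "?P \<in> sets borel_sets" using measurable_sets[OF \<phi>(1) B(1)] by (simp add: space_borel_sets)
    \<comment> \<open>Images under \<open>\<phi>\<close> are rewritten as preimages under its
      inverse \<open>\<psi>\<close>, which are Borel by measurability of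
      \<open>\<psi>\<close>.\<close>
    have PhiP: "\<phi> ` (?P \<inter> X) = B \<inter> (\<psi> -` X \<inter> points M)" if "X \<subseteq> points M" for X
    proof (intro set_eqI iffI)
      fix x assume x: "x \<in> B \<inter> (\<psi> -` X \<inter> points M)"
      then have "\<psi> x \<in> ?P \<inter> X" "x = \<phi> (\<psi> x)" using inv(2) \<psi>p by auto
      then show "x \<in> \<phi> ` (?P \<inter> X)" by (rule rev_image_eqI)
    qed (use inv(1) chart_subset[OF d] B(2) in auto)
    have "emeasure (distr ?L ?L \<phi>) B = emeasure ?L ?P"
      using m B by (simp add: emeasure_distr sets_liouville_measure space_liouville_measure)
    also have "\<dots> = (\<integral>\<^sup>+c. chart_measure M c (?P \<inter> piece c) \<partial>count_space C)"
      by (rule liouville_spec_emeasure[OF _ P]) (simp add: liouville_spec_iff)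
    also have "\<dots> = (\<integral>\<^sup>+c. emeasure (local_measure d) (B \<inter> (\<psi> -` piece c \<inter> points M)) \<partial>count_space C)"
    proof (rule nn_integral_cong)
      fix c assume "c \<in> space (count_space C)"
      then have c: "c \<in> C" by simp
      then have c': "c \<in> atlas M" using C(1) by blast
      have pc: "piece c \<subseteq> points M" using piece_subset chart_subset[OF c'] by blast
      have m': "B \<inter> (\<psi> -` piece c \<inter> points M) \<in> sets borel_sets"
        using measurable_sets[OF \<phi>(2) piece_borel[OF c]] B by (auto simp: space_borel_sets)
      have "chart_measure M c (?P \<inter> piece c) = chart_measure M d (\<phi> ` (?P \<inter> piece c))"
        using P piece_borel[OF c] piece_subset[of c] m' B inv PhiP[OF pc]
        by (intro chart_measure_change[OF c' d] pb[OF c' d])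
          (auto intro: inj_on_inverseI[of _ \<psi>])
      also have "\<dots> = emeasure (local_measure d) (B \<inter> (\<psi> -` piece c \<inter> points M))"
        using m' B by (subst emeasure_local_measure[OF d]) (auto simp: PhiP[OF pc])
      finally show "chart_measure M c (?P \<inter> piece c) = emeasure (local_measure d) (B \<inter> (\<psi> -` piece c \<inter> points M))" .
    qed
    also have "\<dots> = emeasure (local_measure d) (\<Union>c\<in>C. B \<inter> (\<psi> -` piece c \<inter> points M))"
    proof (rule emeasure_UN_countable[symmetric])
      show "disjoint_family_on (\<lambda>c. B \<inter> (\<psi> -` piece c \<inter> points M)) C"
        using disjoint_pieces unfolding disjoint_family_on_def by blast
      show "B \<inter> (\<psi> -` piece c \<inter> points M) \<in> sets (local_measure d)" if "c \<in> C" for c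
        using measurable_sets[OF \<phi>(2) piece_borel[OF that]] B by (auto simp: space_borel_sets sets_local_measure)
    qed (rule C)
    also have "(\<Union>c\<in>C. B \<inter> (\<psi> -` piece c \<inter> points M)) = B"
    proof (intro equalityI subsetI)
      fix x assume x: "x \<in> B"
      then have "x \<in> points M" using B chart_subset[OF d] by blast
      moreover from this obtain c where "c \<in> C" "\<psi> x \<in> piece c" using Union_pieces \<psi>p by blast
      ultimately show "x \<in> (\<Union>c\<in>C. B \<inter> (\<psi> -` piece c \<inter> points M))" using x by blast
    qed blast
    finally show ?thesis using emeasure_local_measure[OF d B] by simp
  qed
  then have "liouville_spec M (distr ?L ?L \<phi>)"
    by (simp add: liouville_spec_def sets_liouville_measure borel_sets_def[symmetric])
  then show ?thesis by (simp add: liouville_spec_iff)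
qed

end

section \<open>Coherent vectors in a frame of sections\<close>

lemma hinner_self: "hinner v v = complex_of_real ((norm v)\<^sup>2)"
proof -
  have "hinner v v = (\<Sum>j\<in>UNIV. complex_of_real ((norm (v $ j))\<^sup>2))"
    unfolding hinner_def by (intro sum.cong refl) (metis complex_norm_square mult.commute)
  also have "\<dots> = complex_of_real ((norm v)\<^sup>2)"
    by (simp add: norm_vec_def L2_set_def sum_nonneg)
  finally show ?thesis .
qed

lemma hinner_scale: "hinner (c *s u) v = cnj c * hinner u v" "hinner u (c *s v) = c * hinner u v"
  by (simp_all add: hinner_def sum_distrib_left mult_ac)

lemma norm_cscale: "norm (c *s (v :: complex^'j::finite)) = cmod c * norm v"
proof -
  have "complex_of_real ((norm (c *s v))\<^sup>2) = complex_of_real ((cmod c * norm v)\<^sup>2)"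
    unfolding hinner_self[symmetric] hinner_scale power_mult_distrib of_real_mult
    by (simp add: hinner_self complex_norm_square mult_ac del: of_real_power)
  then have "(norm (c *s v))\<^sup>2 = (cmod c * norm v)\<^sup>2" by (simp only: of_real_eq_iff)
  then show ?thesis by (simp add: power2_eq_iff_nonneg)
qed

lemma ratio_cscale:
  fixes u v :: "complex^'j::finite"
  assumes "a \<noteq> 0" "b \<noteq> 0"
  shows "(cmod (hinner (a *s v) (b *s u)))\<^sup>2 / ((norm (b *s u))\<^sup>2 * (norm (a *s v))\<^sup>2)
       = (cmod (hinner v u))\<^sup>2 / ((norm u)\<^sup>2 * (norm v)\<^sup>2)"
  using assms by (simp add: hinner_scale norm_cscale norm_mult power_mult_distrib field_simps)

text \<open>Multiplying \<open>q\<close> by a nonzero \<open>c\<close> divides this vector by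
  \<open>c\<close>: choosing \<open>q\<close> over \<open>x\<close> is choosing a homogeneous
  representative.\<close>

definition hcoord :: "('m, 'n::finite, 'l) line_bundle_data \<Rightarrow> ('j::finite \<Rightarrow> 'm \<Rightarrow> 'l) \<Rightarrow> 'l \<Rightarrow> complex^'j" where
  "hcoord Q s q = (\<chi> j. qhat Q q (s j))"

text \<open>Here \<open>comb a\<close> stands for the linear combination of the \<open>s j\<close>
  with coefficients \<open>a j\<close>. It is left abstract because over the manifold it is
  assembled fibrewise through trivialisations, whereas over projective space it is an explicit
  linear form.\<close>

locale section_frame =
  fixes Q :: "('m, 'n::finite, 'l) line_bundle_data" and s :: "'j::finite \<Rightarrow> 'm \<Rightarrow> 'l"
    and \<kappa> :: real and comb :: "('j \<Rightarrow> complex) \<Rightarrow> 'm \<Rightarrow> 'l"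
  assumes \<kappa>: "0 < \<kappa>"
    and comb_hol: "comb c \<in> hol_sections Q"
    and hol_comb: "\<phi> \<in> hol_sections Q \<Longrightarrow> \<exists>c. \<phi> = comb c"
    and inner_comb: "sec_inner Q (comb a) (comb b) = complex_of_real \<kappa> * (\<Sum>j\<in>UNIV. cnj (a j) * b j)"
    and qhat_comb: "x \<in> points Q \<Longrightarrow> q \<in> nonzero_fibre Q x \<Longrightarrow> qhat Q q (comb a) = (\<Sum>j\<in>UNIV. a j * qhat Q q (s j))"
begin

lemma coherent_vector_eq:
  assumes "x \<in> points Q" "q \<in> nonzero_fibre Q x"
  shows "coherent_vector Q q = comb (\<lambda>j. cnj (hcoord Q s q $ j) / complex_of_real \<kappa>)"
  unfolding coherent_vector_def
proof (rule the_equality, intro conjI ballI)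
  show "comb (\<lambda>j. cnj (hcoord Q s q $ j) / complex_of_real \<kappa>) \<in> hol_sections Q" by (rule comb_hol)
  show "sec_inner Q (comb (\<lambda>j. cnj (hcoord Q s q $ j) / complex_of_real \<kappa>)) \<phi> = qhat Q q \<phi>" if \<phi>: "\<phi> \<in> hol_sections Q" for \<phi>
  proof -
    obtain a where "\<phi> = comb a" using hol_comb \<phi> by blast
    then show ?thesis using \<kappa>
      by (simp add: inner_comb qhat_comb[OF assms] sum_distrib_left hcoord_def mult_ac)
  qed
next
  fix e assume e: "e \<in> hol_sections Q \<and> (\<forall>\<phi>\<in>hol_sections Q. sec_inner Q e \<phi> = qhat Q q \<phi>)"
  then obtain a where a: "e = comb a" using hol_comb by blast
  have "a j = cnj (hcoord Q s q $ j) / complex_of_real \<kappa>" for j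
  proof -
    have "sec_inner Q e (comb (\<lambda>k. if k = j then 1 else 0)) = qhat Q q (comb (\<lambda>k. if k = j then 1 else 0))"
      using e comb_hol by blast
    then have "complex_of_real \<kappa> * cnj (a j) = hcoord Q s q $ j"
      by (simp add: a inner_comb qhat_comb[OF assms] hcoord_def if_distrib[of "\<lambda>x. x * _"] if_distrib[of "\<lambda>x. _ * x"] cong: if_cong)
    then have "complex_of_real \<kappa> * a j = cnj (hcoord Q s q $ j)"
      by (metis complex_cnj_cnj complex_cnj_complex_of_real complex_cnj_mult)
    then show ?thesis using \<kappa> by (simp add: field_simps)
  qed
  then show "e = comb (\<lambda>j. cnj (hcoord Q s q $ j) / complex_of_real \<kappa>)" unfolding a by metis
qed

text \<open>The coordinates of a coherent vector are conjugated, and the scalar product conjugates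
  its first argument: together they exchange the order of the two vectors. Of the factors
  \<open>\<kappa>\<close> and \<open>1 / \<kappa>\<^sup>2\<close> there remains
  \<open>1 / \<kappa>\<close>.\<close>

lemma inner_coherent_vectors:
  assumes "x \<in> points Q" "q \<in> nonzero_fibre Q x" "y \<in> points Q" "q' \<in> nonzero_fibre Q y"
  shows "sec_inner Q (coherent_vector Q q) (coherent_vector Q q') = hinner (hcoord Q s q') (hcoord Q s q) / complex_of_real \<kappa>"
  using \<kappa> by (simp add: coherent_vector_eq[OF assms(1,2)] coherent_vector_eq[OF assms(3,4)] inner_comb hinner_def
      sum_distrib_left sum_divide_distrib field_simps)

lemma norm_coherent_vector:
  assumes "x \<in> points Q" "q \<in> nonzero_fibre Q x"
  shows "sec_norm Q (coherent_vector Q q) = norm (hcoord Q s q) / sqrt \<kappa>"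
  unfolding sec_norm_def inner_coherent_vectors[OF assms assms] hinner_self of_real_divide[symmetric] Re_complex_of_real
  by (simp add: real_sqrt_divide)

lemma normalized_inner:
  assumes "x \<in> points Q" "q \<in> nonzero_fibre Q x" "y \<in> points Q" "q' \<in> nonzero_fibre Q y"
  shows "sec_inner Q (coherent_vector Q q) (coherent_vector Q q') /
      complex_of_real (sec_norm Q (coherent_vector Q q) * sec_norm Q (coherent_vector Q q')) =
    hinner (hcoord Q s q') (hcoord Q s q) / complex_of_real (norm (hcoord Q s q) * norm (hcoord Q s q'))"
proof -
  have "sqrt \<kappa> * sqrt \<kappa> = \<kappa>" using \<kappa> by simp
  then have "sec_norm Q (coherent_vector Q q) * sec_norm Q (coherent_vector Q q') = norm (hcoord Q s q) * norm (hcoord Q s q') / \<kappa>"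
    by (simp add: norm_coherent_vector[OF assms(1,2)] norm_coherent_vector[OF assms(3,4)])
  then show ?thesis using \<kappa> by (simp add: inner_coherent_vectors[OF assms])
qed

text \<open>The ratio is invariant under separate rescaling of the two vectors, so all
  \<open>q\<close> and \<open>q'\<close> give the same number; the witnesses \<open>q0\<close> and
  \<open>q0'\<close> keep the quantifiers in \<open>psi\<close> from being vacuous, which makes it
  the only candidate.\<close>

lemma psi_eq:
  assumes x: "x \<in> points Q" "q0 \<in> nonzero_fibre Q x" and y: "y \<in> points Q" "q0' \<in> nonzero_fibre Q y"
    and xs: "\<And>q. q \<in> nonzero_fibre Q x \<Longrightarrow> \<exists>c. c \<noteq> 0 \<and> hcoord Q s q = c *s hcoord Q s q0"
    and ys: "\<And>q. q \<in> nonzero_fibre Q y \<Longrightarrow> \<exists>c. c \<noteq> 0 \<and> hcoord Q s q = c *s hcoord Q s q0'"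
  shows "psi Q x y = (cmod (hinner (hcoord Q s q0') (hcoord Q s q0)))\<^sup>2 / ((norm (hcoord Q s q0))\<^sup>2 * (norm (hcoord Q s q0'))\<^sup>2)"
    (is "_ = ?r")
proof -
  have eq: "(cmod (sec_inner Q (coherent_vector Q q) (coherent_vector Q q')))\<^sup>2 /
            ((sec_norm Q (coherent_vector Q q))\<^sup>2 * (sec_norm Q (coherent_vector Q q'))\<^sup>2) = ?r"
    if q: "q \<in> nonzero_fibre Q x" "q' \<in> nonzero_fibre Q y" for q q'
  proof -
    obtain c c' where c: "c \<noteq> 0" "hcoord Q s q = c *s hcoord Q s q0" "c' \<noteq> 0" "hcoord Q s q' = c' *s hcoord Q s q0'"
      using xs ys q by blast
    have "(cmod (sec_inner Q (coherent_vector Q q) (coherent_vector Q q')))\<^sup>2 /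
            ((sec_norm Q (coherent_vector Q q))\<^sup>2 * (sec_norm Q (coherent_vector Q q'))\<^sup>2) =
       (cmod (sec_inner Q (coherent_vector Q q) (coherent_vector Q q') /
          complex_of_real (sec_norm Q (coherent_vector Q q) * sec_norm Q (coherent_vector Q q'))))\<^sup>2"
      by (simp add: norm_divide norm_mult power_divide power_mult_distrib)
    also have "\<dots> = (cmod (hinner (hcoord Q s q') (hcoord Q s q)))\<^sup>2 / ((norm (hcoord Q s q))\<^sup>2 * (norm (hcoord Q s q'))\<^sup>2)"
      unfolding normalized_inner[OF x(1) q(1) y(1) q(2)]
      by (simp add: norm_divide norm_mult power_divide power_mult_distrib)
    finally show ?thesis unfolding c(2,4) ratio_cscale[OF c(3,1)] .
  qed
  show ?thesis unfolding psi_def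
  proof (rule the_equality)
    show "r = ?r" if "\<forall>q\<in>nonzero_fibre Q x. \<forall>q'\<in>nonzero_fibre Q y. r =
        (cmod (sec_inner Q (coherent_vector Q q) (coherent_vector Q q')))\<^sup>2 /
            ((sec_norm Q (coherent_vector Q q))\<^sup>2 * (sec_norm Q (coherent_vector Q q'))\<^sup>2)" for r
      using that x(2) y(2) eq[OF x(2) y(2)] by metis
  qed (use eq in auto)
qed

end

section \<open>Holomorphic sections and metrics in local coordinates\<close>

lemma mv_holomorphic_on_imp_continuous_on: "mv_holomorphic_on S f \<Longrightarrow> continuous_on S f"
  unfolding mv_holomorphic_on_def
  by (meson continuous_at_imp_continuous_on has_derivative_continuous)

lemma mv_holomorphic_on_cong:
  assumes "open S" "mv_holomorphic_on S f" "\<And>p. p \<in> S \<Longrightarrow> f p = g p"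
  shows "mv_holomorphic_on S g"
  unfolding mv_holomorphic_on_def
proof
  fix p assume p: "p \<in> S"
  then obtain f' where "(f has_derivative f') (at p)" "\<forall>c v. f' (c *s v) = c * f' v"
    using assms(2) unfolding mv_holomorphic_on_def by blast
  then show "\<exists>f'. (g has_derivative f') (at p) \<and> (\<forall>c v. f' (c *s v) = c * f' v)"
    using has_derivative_transform_within_open[OF _ assms(1) p] assms(3) by blast
qed

lemma mv_holomorphic_on_lin_comb:
  assumes "\<And>j. mv_holomorphic_on S (f j)"
  shows "mv_holomorphic_on S (\<lambda>p. \<Sum>j\<in>(UNIV::'j::finite set). c j * f j p)"
  unfolding mv_holomorphic_on_def
proof
  fix p assume "p \<in> S"
  then have "\<forall>j. \<exists>f'. (f j has_derivative f') (at p) \<and> (\<forall>c v. f' (c *s v) = c * f' v)"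
    using assms unfolding mv_holomorphic_on_def by blast
  then obtain f' where f': "\<And>j. (f j has_derivative f' j) (at p)" "\<And>j c v. f' j (c *s v) = c * f' j v" by metis
  show "\<exists>g'. ((\<lambda>p. \<Sum>j\<in>UNIV. c j * f j p) has_derivative g') (at p) \<and> (\<forall>c v. g' (c *s v) = c * g' v)"
    by (rule exI[of _ "\<lambda>v. \<Sum>j\<in>UNIV. c j * f' j v"])
      (auto intro!: derivative_eq_intros f' simp: f' sum_distrib_left mult_ac)
qed

locale hermitian_line_bundle =
  fixes Q :: "('m, 'n::finite, 'l) line_bundle_data"
  assumes line_bundle: "holomorphic_line_bundle Q" and herm: "hermitian_metric Q"
    and manifold: "complex_manifold Q"
begin

lemmas line_bundle_parts = line_bundle[unfolded holomorphic_line_bundle_def]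

lemma triv_at: assumes "x \<in> points Q" obtains U \<tau> where "(U, \<tau>) \<in> trivs Q" "x \<in> U"
proof -
  have "x \<in> (\<Union>(U, \<tau>)\<in>trivs Q. U)"
    using line_bundle_parts[THEN conjunct2, THEN conjunct2, THEN conjunct1] assms by simp
  then show ?thesis using that by auto
qed

lemma triv:
  assumes "(U, \<tau>) \<in> trivs Q" "x \<in> U"
  shows "bij_betw \<tau> (fibre Q x) UNIV" "\<tau> (bzero Q x) = 0"
    "q \<in> fibre Q x \<Longrightarrow> q' \<in> fibre Q x \<Longrightarrow> \<tau> (badd Q q q') = \<tau> q + \<tau> q'"
    "q \<in> fibre Q x \<Longrightarrow> \<tau> (bscale Q c q) = c * \<tau> q"
  using line_bundle_parts[THEN conjunct2, THEN conjunct2, THEN conjunct2, THEN conjunct1] assms by fast+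

lemma triv_open: "(U, \<tau>) \<in> trivs Q \<Longrightarrow> openin (mtop Q) U"
  using line_bundle_parts[THEN conjunct2, THEN conjunct2, THEN conjunct2, THEN conjunct1] by fast

lemma triv_points: "(U, \<tau>) \<in> trivs Q \<Longrightarrow> x \<in> U \<Longrightarrow> x \<in> points Q"
  using triv_open openin_subset by blast

lemma fibre_ops:
  assumes "x \<in> points Q"
  shows "bzero Q x \<in> fibre Q x" "q \<in> fibre Q x \<Longrightarrow> q' \<in> fibre Q x \<Longrightarrow> badd Q q q' \<in> fibre Q x"
    "q \<in> fibre Q x \<Longrightarrow> bscale Q c q \<in> fibre Q x"
  using line_bundle_parts[THEN conjunct2, THEN conjunct1] assms by fast+

lemma triv_inj:
  assumes "(U, \<tau>) \<in> trivs Q" "x \<in> U" "q \<in> fibre Q x" "q' \<in> fibre Q x" "\<tau> q = \<tau> q'"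
  shows "q = q'"
  using triv(1)[OF assms(1,2)] assms(3-5) by (auto simp: bij_betw_def inj_on_def)

lemma triv_nonzero:
  assumes "(U, \<tau>) \<in> trivs Q" "x \<in> U" "q \<in> nonzero_fibre Q x"
  shows "\<tau> q \<noteq> 0" "q \<in> fibre Q x"
  using triv_inj[OF assms(1,2), of q "bzero Q x"] triv(2)[OF assms(1,2)] fibre_ops(1)[OF triv_points[OF assms(1,2)]] assms(3)
  by (auto simp: nonzero_fibre_def)

lemma triv_surj:
  assumes "(U, \<tau>) \<in> trivs Q" "x \<in> U"
  obtains q where "q \<in> fibre Q x" "\<tau> q = w"
proof -
  have "w \<in> \<tau> ` fibre Q x" using triv(1)[OF assms] by (simp add: bij_betw_def)
  then show ?thesis using that by blast
qed

lemma nonzero_fibre_nonempty: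
  assumes x: "x \<in> points Q" shows "\<exists>q. q \<in> nonzero_fibre Q x"
proof -
  obtain U \<tau> where t: "(U, \<tau>) \<in> trivs Q" "x \<in> U" using triv_at[OF x] .
  obtain q where "q \<in> fibre Q x" "\<tau> q = 1" by (rule triv_surj[OF t])
  then show ?thesis using triv(2)[OF t] by (intro exI[of _ q]) (auto simp: nonzero_fibre_def)
qed

lemma qhat_eq:
  assumes t: "(U, \<tau>) \<in> trivs Q" "x \<in> U" and q: "q \<in> nonzero_fibre Q x" and \<phi>: "\<phi> x \<in> fibre Q x"
  shows "qhat Q q \<phi> = \<tau> (\<phi> x) / \<tau> q"
proof -
  note q' = triv_nonzero[OF t q]
  have p: "proj Q q = x" using q' by (simp add: fibre_def)
  have "\<phi> x = bscale Q c q \<longleftrightarrow> \<tau> (\<phi> x) = c * \<tau> q" for c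
    using triv(4)[OF t q'(2)] triv_inj[OF t \<phi> fibre_ops(3)[OF triv_points[OF t] q'(2)]] by metis
  note scale_iff = this
  show ?thesis unfolding qhat_def p
    by (rule the_equality) (use q'(1) in \<open>auto simp: scale_iff\<close>)
qed

lemma qhat_scale:
  assumes x: "x \<in> points Q" and q: "q \<in> nonzero_fibre Q x" and \<phi>: "\<phi> x \<in> fibre Q x"
  shows "bscale Q (qhat Q q \<phi>) q = \<phi> x"
proof -
  obtain U \<tau> where t: "(U, \<tau>) \<in> trivs Q" "x \<in> U" using triv_at[OF x] .
  note q' = triv_nonzero[OF t q]
  show ?thesis
    by (rule triv_inj[OF t fibre_ops(3)[OF x q'(2)] \<phi>])
      (simp add: triv(4)[OF t q'(2)] qhat_eq[where U = U and \<phi> = \<phi>, OF t q \<phi>] q')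
qed

text \<open>The value is specified by its coordinates in all trivialisations at once. This matches
  \<open>is_lin_comb\<close> and avoids forming a finite sum with \<open>badd\<close>.\<close>

definition comb :: "('j::finite \<Rightarrow> 'm \<Rightarrow> 'l) \<Rightarrow> ('j \<Rightarrow> complex) \<Rightarrow> 'm \<Rightarrow> 'l" where
  "comb s c = (\<lambda>x\<in>points Q. SOME q. q \<in> fibre Q x \<and> (\<forall>(U, \<tau>)\<in>trivs Q. x \<in> U \<longrightarrow> \<tau> q = (\<Sum>j\<in>UNIV. c j * \<tau> (s j x))))"

text \<open>An element with the right coordinate in one trivialisation exists by surjectivity. It
  has the right coordinate in every other one, because a transition function multiplies all
  coordinates over \<open>x\<close> by the same factor.\<close>

lemma comb:
  assumes s: "\<And>j. s j x \<in> fibre Q x" and x: "x \<in> points Q"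
  shows "comb s c x \<in> fibre Q x"
    "(U, \<tau>) \<in> trivs Q \<Longrightarrow> x \<in> U \<Longrightarrow> \<tau> (comb s c x) = (\<Sum>j\<in>UNIV. c j * \<tau> (s j x))"
proof -
  obtain U \<tau> where t: "(U, \<tau>) \<in> trivs Q" "x \<in> U" using triv_at[OF x] .
  obtain q where q: "q \<in> fibre Q x" "\<tau> q = (\<Sum>j\<in>UNIV. c j * \<tau> (s j x))"
    by (rule triv_surj[OF t])
  have "\<tau>' q = (\<Sum>j\<in>UNIV. c j * \<tau>' (s j x))" if t': "(U', \<tau>') \<in> trivs Q" "x \<in> U'" for U' \<tau>'
  proof -
    have "\<exists>g. \<forall>y\<in>U \<inter> U'. \<forall>q\<in>fibre Q y. \<tau>' q = g y * \<tau> q"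
      using bspec[OF bspec[OF line_bundle_parts[THEN conjunct2, THEN conjunct2, THEN conjunct2, THEN conjunct2] t(1), unfolded split_conv] t'(1), unfolded split_conv]
      by (rule ex_forward) (rule conjunct1)
    then obtain g where g: "\<And>q. q \<in> fibre Q x \<Longrightarrow> \<tau>' q = g x * \<tau> q" using t(2) t'(2) by blast
    show ?thesis using s by (simp add: g[OF q(1)] g q(2) sum_distrib_left mult_ac)
  qed
  then have "\<exists>q. q \<in> fibre Q x \<and> (\<forall>(U, \<tau>)\<in>trivs Q. x \<in> U \<longrightarrow> \<tau> q = (\<Sum>j\<in>UNIV. c j * \<tau> (s j x)))"
    using q(1) by blast
  from someI_ex[OF this] x
  have *: "comb s c x \<in> fibre Q x \<and> (\<forall>(U, \<tau>)\<in>trivs Q. x \<in> U \<longrightarrow> \<tau> (comb s c x) = (\<Sum>j\<in>UNIV. c j * \<tau> (s j x)))"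
    by (simp add: comb_def)
  then show "comb s c x \<in> fibre Q x" by blast
  show "(U, \<tau>) \<in> trivs Q \<Longrightarrow> x \<in> U \<Longrightarrow> \<tau> (comb s c x) = (\<Sum>j\<in>UNIV. c j * \<tau> (s j x))" for U \<tau>
    using * by blast
qed

lemma hol_section_fibre: "\<phi> \<in> hol_sections Q \<Longrightarrow> x \<in> points Q \<Longrightarrow> \<phi> x \<in> fibre Q x"
  by (simp add: hol_sections_def)

lemma chart_open: assumes "(V, z) \<in> atlas Q" "openin (mtop Q) U" shows "open (z ` (U \<inter> V))"
proof -
  have V: "openin (mtop Q) V" "open (z ` V)" "homeomorphic_map (subtopology (mtop Q) V) (top_of_set (z ` V)) z"
    using manifold assms(1) unfolding complex_manifold_def by blast+
  have "openin (subtopology (mtop Q) V) (U \<inter> V)" using assms(2) by (auto simp: openin_subtopology)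
  then have "openin (top_of_set (z ` V)) (z ` (U \<inter> V))"
    using homeomorphic_imp_open_map[OF V(3)] by (auto simp: open_map_def)
  then show ?thesis using V(2) openin_open_trans by blast
qed

lemma chart_inj: assumes "(V, z) \<in> atlas Q" shows "inj_on z V"
proof -
  have V: "openin (mtop Q) V" "homeomorphic_map (subtopology (mtop Q) V) (top_of_set (z ` V)) z"
    using manifold assms unfolding complex_manifold_def by blast+
  then show ?thesis using homeomorphic_imp_injective_map[OF V(2)] openin_subset[OF V(1)] by (simp add: Int_absorb1)
qed

lemma chart_inv: "(V, z) \<in> atlas Q \<Longrightarrow> x \<in> V \<Longrightarrow> inv_into V z (z x) = x"
  using chart_inj by simp

lemma comb_hol_section:
  assumes s: "\<And>j. s j \<in> hol_sections Q"
  shows "comb s c \<in> hol_sections Q"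
  unfolding hol_sections_def
proof (intro CollectI conjI ballI, goal_cases)
  case 1 show ?case by (simp add: comb_def)
next
  case (2 x) then show ?case using comb(1) hol_section_fibre[OF s] by blast
next
  case (3 Ut)
  obtain U \<tau> where Ut: "Ut = (U, \<tau>)" by force
  show ?case unfolding Ut
  proof (simp, intro ballI, clarify)
    fix V z assume Vz: "(V, z) \<in> atlas Q"
    have t: "(U, \<tau>) \<in> trivs Q" using 3 Ut by simp
    show "mv_holomorphic_on (z ` (U \<inter> V)) (\<lambda>p. \<tau> (comb s c (inv_into V z p)))"
    proof (rule mv_holomorphic_on_cong[OF chart_open[OF Vz triv_open[OF t]] mv_holomorphic_on_lin_comb])
      show "mv_holomorphic_on (z ` (U \<inter> V)) (\<lambda>p. \<tau> (s j (inv_into V z p)))" for j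
        using s[of j] t Vz unfolding hol_sections_def by blast
      show "(\<Sum>j\<in>UNIV. c j * \<tau> (s j (inv_into V z p))) = \<tau> (comb s c (inv_into V z p))" if "p \<in> z ` (U \<inter> V)" for p
        using that chart_inv[OF Vz] comb(2)[of s, OF hol_section_fibre[OF s] _ t] triv_points[OF t] by auto
    qed
  qed
qed

lemma comb_eqI:
  assumes s: "\<And>j. s j \<in> hol_sections Q" and \<phi>: "\<phi> \<in> hol_sections Q" and lc: "is_lin_comb Q c s \<phi>"
  shows "\<phi> = comb s c"
proof (rule extensionalityI[where A = "points Q"])
  fix x assume x: "x \<in> points Q"
  obtain U \<tau> where t: "(U, \<tau>) \<in> trivs Q" "x \<in> U" using triv_at[OF x] .
  have "\<tau> (\<phi> x) = (\<Sum>j\<in>UNIV. c j * \<tau> (s j x))" using lc t unfolding is_lin_comb_def by blast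
  moreover note comb[of s x, OF hol_section_fibre[OF s x] x, where c = c]
  ultimately show "\<phi> x = comb s c x" using triv_inj[OF t] hol_section_fibre[OF \<phi> x] t by metis
qed (use \<phi> in \<open>auto simp: hol_sections_def comb_def\<close>)

text \<open>Every element of the fibre is its coordinate times the frame vector of coordinate 1, and
  hermitian symmetry makes the square of that vector real.\<close>

lemma metric_local:
  assumes t: "(U, \<tau>) \<in> trivs Q" "x \<in> U" and q: "q \<in> fibre Q x" "q' \<in> fibre Q x"
  shows "metric Q q q' = cnj (\<tau> q) * \<tau> q' * complex_of_real (local_metric Q \<tau> x)"
proof -
  note x = triv_points[OF t]
  have m1: "metric Q b a = cnj (metric Q a b)" if "a \<in> fibre Q x" "b \<in> fibre Q x" for a b
    using herm x that unfolding hermitian_metric_def by blast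
  have m2: "metric Q a (bscale Q c b) = c * metric Q a b" if "a \<in> fibre Q x" "b \<in> fibre Q x" for a b c
    using herm x that unfolding hermitian_metric_def by blast
  obtain f where f: "f \<in> fibre Q x" "\<tau> f = 1" by (rule triv_surj[OF t])
  have lf: "local_frame Q \<tau> x = f"
    unfolding local_frame_def using f triv_inj[OF t] by (intro the_equality) auto
  have sc: "a = bscale Q (\<tau> a) f" if "a \<in> fibre Q x" for a
    using triv_inj[OF t that fibre_ops(3)[OF x f(1)]] triv(4)[OF t f(1)] f(2) by simp
  have "metric Q f f = cnj (metric Q f f)" using m1 f by blast
  then have r: "cnj (metric Q f f) = complex_of_real (Re (metric Q f f))" by (simp add: complex_eq_iff)
  have "metric Q q q' = \<tau> q' * metric Q q f" using m2[OF q(1) f(1)] sc[OF q(2)] by metis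
  also have "metric Q q f = cnj (metric Q f q)" using m1 f q by blast
  also have "metric Q f q = \<tau> q * metric Q f f" using m2[OF f(1) f(1)] sc[OF q(1)] by metis
  finally show ?thesis using r by (simp add: local_metric_def lf mult_ac)
qed

lemma local_metric_pos:
  assumes t: "(U, \<tau>) \<in> trivs Q" "x \<in> U"
  shows "0 < local_metric Q \<tau> x"
proof -
  note x = triv_points[OF t]
  obtain f where f: "f \<in> fibre Q x" "\<tau> f = 1" by (rule triv_surj[OF t])
  then have "f \<noteq> bzero Q x" using triv(2)[OF t] by auto
  then have "0 < Re (metric Q f f)" using herm x f unfolding hermitian_metric_def by blast
  then show ?thesis using metric_local[OF t f(1) f(1)] f by simp
qed

text \<open>Continuity of the function \<open>h(\<phi>,\<psi>)\<close>, phrased through open sets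
  because the manifold carries a topology given as an object. It is checked near each point in a
  chart and a trivialisation, and it is the source of measurability.\<close>

lemma open_metric_preimage:
  assumes \<phi>: "\<phi> \<in> hol_sections Q" and \<psi>: "\<psi> \<in> hol_sections Q" and S: "open S"
  shows "openin (mtop Q) {x \<in> points Q. metric Q (\<phi> x) (\<psi> x) \<in> S}"
proof (subst openin_subopen, intro ballI)
  fix x assume "x \<in> {x \<in> points Q. metric Q (\<phi> x) (\<psi> x) \<in> S}"
  then have x: "x \<in> points Q" "metric Q (\<phi> x) (\<psi> x) \<in> S" by auto
  obtain U \<tau> where t: "(U, \<tau>) \<in> trivs Q" "x \<in> U" using triv_at[OF x(1)] .
  have "(\<Union>(V, z)\<in>atlas Q. V) = points Q" using manifold by (simp add: complex_manifold_def)
  then obtain V z where V: "(V, z) \<in> atlas Q" "x \<in> V" using x(1) by blast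
  have V': "openin (mtop Q) V" "homeomorphic_map (subtopology (mtop Q) V) (top_of_set (z ` V)) z"
    using manifold V(1) unfolding complex_manifold_def by blast+
  let ?W = "z ` (U \<inter> V)"
  define F where "F p = cnj (\<tau> (\<phi> (inv_into V z p))) * \<tau> (\<psi> (inv_into V z p)) * complex_of_real (local_metric Q \<tau> (inv_into V z p))" for p
  have "smooth_on ?W (\<lambda>p. local_metric Q \<tau> (inv_into V z p))"
    using herm t(1) V(1) unfolding hermitian_metric_def by blast
  then have "Ck_on 0 ?W (\<lambda>p. local_metric Q \<tau> (inv_into V z p))" unfolding smooth_on_def by blast
  then have c1: "continuous_on ?W (\<lambda>p. local_metric Q \<tau> (inv_into V z p))" by simp
  have c2: "continuous_on ?W (\<lambda>p. \<tau> (\<xi> (inv_into V z p)))" if "\<xi> \<in> hol_sections Q" for \<xi>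
    using that t(1) V(1) unfolding hol_sections_def by (blast intro: mv_holomorphic_on_imp_continuous_on)
  have "continuous_on ?W F" unfolding F_def by (intro continuous_intros c1 c2 \<phi> \<psi>)
  moreover have "open ?W" by (rule chart_open[OF V(1) triv_open[OF t(1)]])
  ultimately have O: "open (F -` S \<inter> ?W)" using S continuous_on_open_vimage by blast
  define T where "T = {y \<in> V. z y \<in> F -` S \<inter> ?W}"
  have "openin (subtopology (mtop Q) V) {y \<in> topspace (subtopology (mtop Q) V). z y \<in> F -` S \<inter> ?W}"
  proof (rule openin_continuous_map_preimage)
    show "continuous_map (subtopology (mtop Q) V) (top_of_set (z ` V)) z"
      using V'(2) by (rule homeomorphic_imp_continuous_map)
    show "openin (top_of_set (z ` V)) (F -` S \<inter> ?W)" using O by (auto simp: openin_open)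
  qed
  moreover have "{y \<in> topspace (subtopology (mtop Q) V). z y \<in> F -` S \<inter> ?W} = T"
    using openin_subset[OF V'(1)] by (auto simp: T_def)
  ultimately have oT: "openin (mtop Q) T" using V'(1) by (metis openin_trans_full)
  have TF: "y \<in> U \<and> F (z y) = metric Q (\<phi> y) (\<psi> y)" if "y \<in> V" "z y \<in> ?W" for y
  proof -
    have yU: "y \<in> U" using that chart_inj[OF V(1)] by (auto simp: inj_on_def)
    have yp: "y \<in> points Q" using triv_points[OF t(1) yU] .
    show ?thesis using yU metric_local[OF t(1) yU hol_section_fibre[OF \<phi> yp] hol_section_fibre[OF \<psi> yp]] chart_inv[OF V(1) that(1)]
      by (simp add: F_def)
  qed
  have "x \<in> T" using TF[of x] x V t by (auto simp: T_def)
  moreover have "T \<subseteq> {x \<in> points Q. metric Q (\<phi> x) (\<psi> x) \<in> S}"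
    using TF triv_points[OF t(1)] by (force simp: T_def)
  ultimately show "\<exists>T. openin (mtop Q) T \<and> x \<in> T \<and> T \<subseteq> {x \<in> points Q. metric Q (\<phi> x) (\<psi> x) \<in> S}"
    using oT by blast
qed

end

section \<open>Sections over a quantizable manifold\<close>

lemma has_derivative_vec_lambda:
  fixes f :: "'a::real_normed_vector \<Rightarrow> complex^'n::finite"
  assumes "\<And>a. ((\<lambda>p. f p $ a) has_derivative f' a) F"
  shows "(f has_derivative (\<lambda>v. \<chi> a. f' a v)) F"
proof -
  have emb: "bounded_linear (\<lambda>c. axis a c :: complex^'n)" for a
  proof (rule bounded_linear_intro[where K = 1])
    show "axis a (x + y) = axis a x + axis a y" for x y :: complex by (simp add: axis_def vec_eq_iff)
    show "axis a (r *\<^sub>R x) = r *\<^sub>R axis a x" for r and x :: complex by (simp add: axis_def vec_eq_iff)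
    show "norm (axis a x) \<le> norm x * 1" for x :: complex
    proof -
      have "(\<Sum>i\<in>UNIV. (norm ((axis a x :: complex^'n) $ i))\<^sup>2) = (\<Sum>i\<in>UNIV. if i = a then (norm x)\<^sup>2 else 0)"
        by (intro sum.cong) (auto simp: axis_def)
      then show ?thesis by (simp add: norm_vec_def L2_set_def)
    qed
  qed
  have expand: "w = (\<Sum>a\<in>UNIV. axis a (w $ a))" for w :: "complex^'n"
    by (simp add: vec_eq_iff axis_def)
  have "((\<lambda>p. \<Sum>a\<in>UNIV. axis a (f p $ a)) has_derivative (\<lambda>v. \<Sum>a\<in>UNIV. axis a (f' a v))) F"
    by (intro has_derivative_sum bounded_linear.has_derivative[OF emb] assms)
  moreover have "(\<Sum>a\<in>UNIV. axis a (f' a v)) = (\<chi> a. f' a v)" for v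
    by (simp add: vec_eq_iff axis_def)
  ultimately show ?thesis by (simp flip: expand)
qed

lemma has_derivative_vec_mv_holomorphic:
  fixes g :: "complex^'n::finite \<Rightarrow> complex^'k::finite"
  assumes "\<And>a. mv_holomorphic_on S (\<lambda>p. g p $ a)" "p \<in> S"
  obtains D where "(g has_derivative D) (at p)" "\<And>c v. D (c *s v) = c *s D v"
proof -
  have "\<exists>f'. ((\<lambda>p. g p $ a) has_derivative f') (at p) \<and> (\<forall>c v. f' (c *s v) = c * f' v)" for a
    using assms unfolding mv_holomorphic_on_def by blast
  then obtain f' where f': "\<And>a. ((\<lambda>p. g p $ a) has_derivative f' a) (at p)" "\<And>a c v. f' a (c *s v) = c * f' a v"
    by metis
  have "(g has_derivative (\<lambda>v. \<chi> a. f' a v)) (at p)" by (rule has_derivative_vec_lambda[OF f'(1)])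
  then show thesis by (rule that) (simp add: vec_eq_iff f'(2))
qed

text \<open>Second countability makes the space Lindelof, so countably many chart domains cover it;
  one chart for each of these domains forms \<open>C\<close>. Smoothness of the form gives the
  continuous density, and holomorphy of the transition maps their complex linear
  derivatives.\<close>

lemma kaehler_manifold_liouville_manifold:
  assumes "kaehler_manifold M"
  obtains C where "liouville_manifold M C"
proof -
  have cm: "complex_manifold M" and sf: "smooth_two_form M"
    using assms by (auto simp: kaehler_manifold_def)
  have cover: "(\<Union>c\<in>atlas M. fst c) = points M"
    using cm unfolding complex_manifold_def by (simp add: case_prod_beta)
  have ch: "openin (mtop M) (fst c)" "open (snd c ` fst c)"
    "homeomorphic_map (subtopology (mtop M) (fst c)) (top_of_set (snd c ` fst c)) (snd c)" if "c \<in> atlas M" for c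
    using cm that unfolding complex_manifold_def by (auto simp: case_prod_beta)
  have "Lindelof_space (mtop M)"
    using cm[unfolded complex_manifold_def, THEN conjunct2, THEN conjunct1]
    by (rule second_countable_imp_Lindelof_space)
  then have "\<exists>\<V>. countable \<V> \<and> \<V> \<subseteq> fst ` atlas M \<and> \<Union>\<V> = topspace (mtop M)"
    unfolding Lindelof_space_def
    by (elim allE[of _ "fst ` atlas M"] impE) (use ch(1) cover in simp_all)
  then obtain \<V> where V: "countable \<V>" "\<V> \<subseteq> fst ` atlas M" "\<Union>\<V> = points M" by (elim exE conjE)
  have "\<exists>C. countable C \<and> C \<subseteq> atlas M \<and> \<V> = fst ` C"
    using V(1,2) by (simp only: countable_subset_image[symmetric])
  then obtain C where C: "countable C" "C \<subseteq> atlas M" "\<V> = fst ` C" by (elim exE conjE)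
  have sf1: "bilinear (kform M c x)" if "c \<in> atlas M" "x \<in> fst c" for c x
    using bspec[OF sf[unfolded smooth_two_form_def case_prod_beta, THEN conjunct1] that(1)] that(2) by simp
  have sf2: "smooth_on (snd c ` fst c) (\<lambda>p. kform M c (inv_into (fst c) (snd c) p) u v)" if "c \<in> atlas M" for c u v
    using bspec[OF sf[unfolded smooth_two_form_def case_prod_beta, THEN conjunct1] that] by simp
  have sf3: "kform M c x u v = kform M d x (frechet_derivative (\<lambda>p. snd d (inv_into (fst c) (snd c) p)) (at (snd c x)) u)
      (frechet_derivative (\<lambda>p. snd d (inv_into (fst c) (snd c) p)) (at (snd c x)) v)"
    if "c \<in> atlas M" "d \<in> atlas M" "x \<in> fst c \<inter> fst d" for c d x u v
    using bspec[OF bspec[OF sf[unfolded smooth_two_form_def case_prod_beta Let_def, THEN conjunct2] that(1)] that(2)] that(3)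
    by simp
  have hol: "mv_holomorphic_on (snd c ` (fst c \<inter> fst d)) (\<lambda>p. snd d (inv_into (fst c) (snd c) p) $ a)"
    if "c \<in> atlas M" "d \<in> atlas M" for c d a
    using cm that unfolding complex_manifold_def by (auto simp: case_prod_beta)
  have "liouville_manifold M C"
  proof
    show "pulls_back_form M c d (\<lambda>x. x) x" if cd: "c \<in> atlas M" "d \<in> atlas M" and x: "x \<in> fst c \<inter> fst d" for c d x
    proof -
      let ?g = "\<lambda>p. snd d (inv_into (fst c) (snd c) p)"
      obtain D where D: "(?g has_derivative D) (at (snd c x))" "\<And>a v. D (a *s v) = a *s D v"
        using x by (rule has_derivative_vec_mv_holomorphic[OF hol[OF cd] imageI]) blast
      have "frechet_derivative ?g (at (snd c x)) = D" using frechet_derivative_at[OF D(1)] by simp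
      then show ?thesis unfolding pulls_back_form_def using D sf3[OF cd x] by (intro exI[of _ D]) simp
    qed
    show "continuous_on (snd c ` fst c) (\<lambda>p. liouville_density (kform M c (inv_into (fst c) (snd c) p)))" if c: "c \<in> atlas M" for c
    proof -
      have "continuous_on (snd c ` fst c) (\<lambda>p. kform M c (inv_into (fst c) (snd c) p) u v)" for u v
        using sf2[OF c, of u v] unfolding smooth_on_def by (metis Ck_on.simps(1))
      note entry = this
      show ?thesis unfolding liouville_density_def
        by (intro continuous_on_divide continuous_on_sum continuous_on_mult continuous_on_prod continuous_on_const entry) auto
    qed
  qed (use ch C V sf1 in auto)
  then show thesis by (rule that)
qed

locale quantum_sections = hermitian_line_bundle Q for Q :: "('m, 'n::finite, 'l) line_bundle_data" +
  fixes s :: "'j::finite \<Rightarrow> 'm \<Rightarrow> 'l"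
  assumes kaehler: "kaehler_manifold Q" and onb: "orthonormal_section_basis Q s"
begin

lemma basis: "section_basis Q s" and ortho: "sec_inner Q (s j) (s k) = (if j = k then 1 else 0)"
  using onb by (auto simp: orthonormal_section_basis_def)

lemma s_hol: "s j \<in> hol_sections Q"
  using basis by (simp add: section_basis_def)

lemma hol_section_comb: "\<phi> \<in> hol_sections Q \<Longrightarrow> \<exists>c. \<phi> = comb s c"
  using basis comb_eqI[of s] s_hol unfolding section_basis_def by metis

lemma space_measure: "space (liouville_measure Q) = points Q"
  using kaehler_manifold_liouville_manifold[OF kaehler] liouville_manifold.space_liouville_measure by blast

lemma measurable_metric:
  assumes "\<phi> \<in> hol_sections Q" "\<psi> \<in> hol_sections Q"
  shows "(\<lambda>x. metric Q (\<phi> x) (\<psi> x)) \<in> borel_measurable (liouville_measure Q)"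
proof (rule borel_measurableI)
  fix S :: "complex set" assume S: "open S"
  obtain C where "liouville_manifold Q C" using kaehler_manifold_liouville_manifold[OF kaehler] .
  then interpret liouville_manifold Q C .
  have "(\<lambda>x. metric Q (\<phi> x) (\<psi> x)) -` S \<inter> space (liouville_measure Q) = {x \<in> points Q. metric Q (\<phi> x) (\<psi> x) \<in> S}"
    by (auto simp: space_liouville_measure)
  then show "(\<lambda>x. metric Q (\<phi> x) (\<psi> x)) -` S \<inter> space (liouville_measure Q) \<in> sets (liouville_measure Q)"
    using open_in_borel_sets[OF open_metric_preimage[OF assms S]] by (simp add: sets_liouville_measure)
qed

text \<open>The integral of a function that is not integrable is 0 by convention, so squared norm 1
  forces the functions \<open>h(s_j, s_j)\<close> to be integrable. The mixed ones follow from
  \<open>|a| |b| \<le> |a|\<^sup>2 + |b|\<^sup>2\<close> for the local coordinates of the two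
  sections.\<close>

lemma integrable_metric: "integrable (liouville_measure Q) (\<lambda>x. metric Q (s j x) (s k x))"
proof -
  have self: "integrable (liouville_measure Q) (\<lambda>x. metric Q (s j x) (s j x))" for j
  proof (rule ccontr)
    assume "\<not> ?thesis"
    then have "sec_inner Q (s j) (s j) = 0" unfolding sec_inner_def by (rule not_integrable_integral_eq)
    then show False using ortho[of j j] by simp
  qed
  show ?thesis
  proof (rule Bochner_Integration.integrable_bound)
    show "integrable (liouville_measure Q) (\<lambda>x. norm (metric Q (s j x) (s j x)) + norm (metric Q (s k x) (s k x)))"
      by (intro Bochner_Integration.integrable_add integrable_norm self)
    show "AE x in liouville_measure Q. norm (metric Q (s j x) (s k x))
        \<le> norm (norm (metric Q (s j x) (s j x)) + norm (metric Q (s k x) (s k x)))"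
    proof (intro AE_I2)
      fix x assume "x \<in> space (liouville_measure Q)"
      then have x: "x \<in> points Q" by (simp add: space_measure)
      obtain U \<tau> where t: "(U, \<tau>) \<in> trivs Q" "x \<in> U" using triv_at[OF x] .
      note f = hol_section_fibre[OF s_hol x]
      let ?a = "cmod (\<tau> (s j x))" and ?b = "cmod (\<tau> (s k x))" and ?h = "local_metric Q \<tau> x"
      have "0 \<le> (?a - ?b)\<^sup>2" "0 \<le> ?a * ?b" by simp_all
      moreover from this have "2 * (?a * ?b) \<le> ?a * ?a + ?b * ?b" by (simp add: power2_eq_square algebra_simps)
      ultimately have "?a * ?b \<le> ?a * ?a + ?b * ?b" by linarith
      then have "?a * ?b * ?h \<le> (?a * ?a + ?b * ?b) * ?h"
        using local_metric_pos[OF t] by (intro mult_right_mono) auto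
      then show "norm (metric Q (s j x) (s k x)) \<le> norm (norm (metric Q (s j x) (s j x)) + norm (metric Q (s k x) (s k x)))"
        using local_metric_pos[OF t] by (simp add: metric_local[OF t f f] norm_mult algebra_simps)
    qed
  qed (rule measurable_metric[OF s_hol s_hol])
qed

sublocale section_frame Q s 1 "comb s"
proof
  show "comb s c \<in> hol_sections Q" for c by (rule comb_hol_section[OF s_hol])
  show "qhat Q q (comb s a) = (\<Sum>j\<in>UNIV. a j * qhat Q q (s j))" if x: "x \<in> points Q" and q: "q \<in> nonzero_fibre Q x" for x q a
  proof -
    obtain U \<tau> where t: "(U, \<tau>) \<in> trivs Q" "x \<in> U" using triv_at[OF x] .
    note f = hol_section_fibre[OF s_hol x]
    note c = comb[of s x, OF f x, where c = a]
    show ?thesis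
      by (simp add: qhat_eq[where \<phi> = "s j" for j, OF t q f] qhat_eq[where \<phi> = "comb s a", OF t q c(1)] c(2)[OF t] sum_divide_distrib)
  qed
  show "sec_inner Q (comb s a) (comb s b) = complex_of_real 1 * (\<Sum>j\<in>UNIV. cnj (a j) * b j)" for a b
  proof -
    have "sec_inner Q (comb s a) (comb s b) = (\<integral>x. (\<Sum>j\<in>UNIV. \<Sum>k\<in>UNIV. (cnj (a j) * b k) * metric Q (s j x) (s k x)) \<partial>liouville_measure Q)"
      unfolding sec_inner_def
    proof (rule Bochner_Integration.integral_cong[OF refl])
      fix x assume "x \<in> space (liouville_measure Q)"
      then have x: "x \<in> points Q" by (simp add: space_measure)
      obtain U \<tau> where t: "(U, \<tau>) \<in> trivs Q" "x \<in> U" using triv_at[OF x] .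
      note f = hol_section_fibre[OF s_hol x]
      note c = comb[of s x, OF f x]
      show "metric Q (comb s a x) (comb s b x) = (\<Sum>j\<in>UNIV. \<Sum>k\<in>UNIV. (cnj (a j) * b k) * metric Q (s j x) (s k x))"
        unfolding metric_local[OF t c(1) c(1)] metric_local[OF t f f] c(2)[OF t] cnj_sum sum_product
        unfolding sum_distrib_right by (intro sum.cong refl) (simp add: mult_ac)
    qed
    also have "\<dots> = (\<Sum>j\<in>UNIV. \<Sum>k\<in>UNIV. (cnj (a j) * b k) * sec_inner Q (s j) (s k))"
      unfolding sec_inner_def
      by (simp add: integrable_metric Bochner_Integration.integral_sum Bochner_Integration.integrable_sum)
    also have "\<dots> = (\<Sum>j\<in>UNIV. cnj (a j) * b j)"
      by (simp add: ortho if_distrib[of "\<lambda>x. _ * x"] cong: if_cong)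
    finally show ?thesis by simp
  qed
qed (use hol_section_comb in auto)

lemma hcoord_rescale:
  assumes x: "x \<in> points Q" and q: "q \<in> nonzero_fibre Q x" and q0: "q0 \<in> nonzero_fibre Q x"
  obtains c where "c \<noteq> 0" "hcoord Q s q = c *s hcoord Q s q0"
proof -
  obtain U \<tau> where t: "(U, \<tau>) \<in> trivs Q" "x \<in> U" using triv_at[OF x] .
  note f = hol_section_fibre[OF s_hol x]
  show thesis
  proof (rule that[of "\<tau> q0 / \<tau> q"])
    show "\<tau> q0 / \<tau> q \<noteq> 0" using triv_nonzero[OF t] q q0 by simp
    show "hcoord Q s q = (\<tau> q0 / \<tau> q) *s hcoord Q s q0"
      using triv_nonzero(1)[OF t q] triv_nonzero(1)[OF t q0]
      by (simp add: hcoord_def vec_eq_iff qhat_eq[where \<phi> = "s j" for j, OF t q f] qhat_eq[where \<phi> = "s j" for j, OF t q0 f])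
  qed
qed

end

section \<open>Projective space\<close>

type_synonym 'k projective_data = "('k hvec set, 'k, 'k hvec set \<times> ('k hvec \<Rightarrow> complex)) line_bundle_data"

abbreviation (input) pspace :: "'k::finite projective_data" where
  "pspace \<equiv> projective_space"

text \<open>The homogeneous index whose entry becomes the affine coordinate \<open>a\<close> in
  chart \<open>j\<close>, as in \<open>affine_coord\<close>: it identifies \<open>'k\<close> with
  the indices other than \<open>j\<close>.\<close>

definition slot :: "'k::finite option \<Rightarrow> 'k \<Rightarrow> 'k option" where
  "slot j a = (if Some a = j then None else Some a)"

definition unslot :: "'k::finite option \<Rightarrow> 'k option \<Rightarrow> 'k" where
  "unslot j i = (case i of None \<Rightarrow> the j | Some a \<Rightarrow> a)"

lemma slot_neq: "slot j a \<noteq> j"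
  by (cases j) (auto simp: slot_def)

lemma unslot_slot: "unslot j (slot j a) = a"
  by (cases j) (auto simp: slot_def unslot_def)

lemma slot_unslot: "i \<noteq> j \<Longrightarrow> slot j (unslot j i) = i"
  by (cases i; cases j) (auto simp: slot_def unslot_def)

lemma sum_slot: "(\<Sum>i\<in>UNIV. f i) = f j + (\<Sum>a\<in>UNIV. f (slot j a))"
proof -
  have "(\<Sum>i\<in>UNIV - {j}. f i) = (\<Sum>a\<in>UNIV. f (slot j a))"
    by (rule sum.reindex_bij_witness[of _ "slot j" "unslot j"]) (auto simp: slot_neq unslot_slot slot_unslot)
  then show ?thesis by (simp add: sum.remove[of UNIV j])
qed

text \<open>The differential of the affine map \<open>emb j\<close>, whose \<open>j\<close>-th entry
  is constantly 1.\<close>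

definition emb0 :: "'k::finite option \<Rightarrow> complex^'k \<Rightarrow> 'k hvec" where
  "emb0 j w = (\<chi> i. if i = j then 0 else w $ unslot j i)"

definition emb :: "'k::finite option \<Rightarrow> complex^'k \<Rightarrow> 'k hvec" where
  "emb j w = (\<chi> i. if i = j then 1 else w $ unslot j i)"

lemma emb_nth [simp]: "emb j w $ j = 1" "emb j w $ slot j a = w $ a" "emb0 j w $ j = 0" "emb0 j w $ slot j a = w $ a"
  by (simp_all add: emb_def emb0_def slot_neq unslot_slot)

lemma slot_cases: obtains "i = j" | a where "i = slot j a"
  using slot_unslot by metis

lemma vec_eq_slotI: "u $ j = v $ j \<Longrightarrow> (\<And>a. u $ slot j a = v $ slot j a) \<Longrightarrow> u = v"
  unfolding vec_eq_iff by (metis slot_cases)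

lemma emb_nonzero [simp]: "emb j w \<noteq> 0"
  by (metis emb_nth(1) zero_index zero_neq_one)

lemma hinner_emb:
  "hinner (emb0 j u) (emb0 j v) = hinner u v" "hinner (emb0 j u) (emb j w) = hinner u w"
  "hinner (emb j w) (emb0 j u) = hinner w u" "hinner (emb j w) (emb j w) = 1 + hinner w w"
  by (simp_all add: hinner_def sum_slot[of _ j])

lemma continuous_emb: "continuous_on S (emb j)"
proof -
  have "continuous_on S (\<lambda>w. if i = j then 1 else w $ unslot j i)" for i
    by (cases "i = j") (auto intro: continuous_intros)
  then show ?thesis unfolding emb_def by (rule continuous_on_vec_lambda)
qed

lemma has_derivative_emb: "(emb j has_derivative emb0 j) F"
proof -
  have "((\<lambda>w. emb j w $ i) has_derivative (\<lambda>w. emb0 j w $ i)) F" for i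
    by (cases "i = j") (auto simp: emb_def emb0_def intro: bounded_linear_imp_has_derivative bounded_linear_vec_nth)
  from has_derivative_vec_lambda[OF this] show ?thesis by simp
qed

lemma emb0_scale: "emb0 j (c *s u) = c *s emb0 j u"
  by (rule vec_eq_slotI[of _ j]) simp_all

section \<open>Lines, affine charts and the quotient topology\<close>

lemma mem_hline: "u \<in> hline v \<longleftrightarrow> (\<exists>c. u = c *s v)"
  by (auto simp: hline_def)

lemma self_in_hline [simp]: "v \<in> hline v"
  unfolding mem_hline by (rule exI[of _ 1]) simp

lemma hline_scale: "c \<noteq> 0 \<Longrightarrow> hline (c *s v) = hline v"
  unfolding set_eq_iff mem_hline
  by (metis (no_types, lifting) nonzero_divide_eq_eq vector_smult_assoc)

lemma hline_eqI: "u \<in> hline v \<Longrightarrow> u \<noteq> 0 \<Longrightarrow> hline u = hline v"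
  by (auto simp: mem_hline hline_scale)

lemma hline_in_proj_points: "v \<noteq> 0 \<Longrightarrow> hline v \<in> proj_points"
  by (simp add: proj_points_def)

lemma proj_points_cases:
  assumes "L \<in> proj_points" obtains v where "v \<noteq> 0" "L = hline v"
  using assms by (auto simp: proj_points_def)

lemma hline_affine_domain: "hline v \<in> affine_domain j \<longleftrightarrow> v $ j \<noteq> 0"
proof
  assume "v $ j \<noteq> 0"
  then have "v \<noteq> 0" by auto
  then show "hline v \<in> affine_domain j"
    unfolding affine_domain_def using \<open>v $ j \<noteq> 0\<close> by (auto intro: hline_in_proj_points bexI[of _ v])
qed (auto simp: affine_domain_def mem_hline)

lemma affine_domain_cases:
  assumes "L \<in> affine_domain j" obtains v where "v $ j \<noteq> 0" "v \<noteq> 0" "L = hline v"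
  using assms by (metis (no_types, lifting) affine_domain_def hline_affine_domain mem_Collect_eq proj_points_cases)

lemma normalized_rep_hline: "v $ j \<noteq> 0 \<Longrightarrow> normalized_rep j (hline v) = (1 / v $ j) *s v"
  unfolding normalized_rep_def
  by (rule the_equality) (auto simp: mem_hline field_simps intro: exI[of _ "1 / v $ j"])

lemma affine_coord_hline: "v $ j \<noteq> 0 \<Longrightarrow> affine_coord j (hline v) = (\<chi> a. v $ slot j a / v $ j)"
  unfolding affine_coord_def by (simp add: normalized_rep_hline slot_def)

lemma affine_coord_emb [simp]: "affine_coord j (hline (emb j w)) = w"
  by (simp add: affine_coord_hline vec_eq_iff)

lemma emb_affine_coord: "v $ j \<noteq> 0 \<Longrightarrow> emb j (affine_coord j (hline v)) = (1 / v $ j) *s v"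
  by (rule vec_eq_slotI[of _ j]) (simp_all add: affine_coord_hline)

lemma hline_emb_affine_coord: "L \<in> affine_domain j \<Longrightarrow> hline (emb j (affine_coord j L)) = L"
  by (erule affine_domain_cases) (simp add: emb_affine_coord hline_scale)

lemma affine_coord_image: "affine_coord j ` affine_domain j = UNIV"
proof -
  have "w \<in> affine_coord j ` affine_domain j" for w
    by (rule image_eqI[of _ _ "hline (emb j w)"]) (simp_all add: hline_affine_domain)
  then show ?thesis by auto
qed

lemma inv_affine_coord: "inv_into (affine_domain j) (affine_coord j) w = hline (emb j w)"
proof (rule inv_into_f_eq)
  show "inj_on (affine_coord j) (affine_domain j)" by (metis hline_emb_affine_coord inj_onI)
qed (simp_all add: hline_affine_domain)

lemma openin_proj_topology: "openin proj_topology W \<longleftrightarrow> W \<subseteq> proj_points \<and> open {v. v \<noteq> 0 \<and> hline v \<in> W}"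
proof -
  have "istopology (\<lambda>W. W \<subseteq> proj_points \<and> open {v :: 'a hvec. v \<noteq> 0 \<and> hline v \<in> W})"
    unfolding istopology_def
  proof (intro conjI allI impI)
    fix S T :: "'a hvec set set"
    assume "S \<subseteq> proj_points \<and> open {v. v \<noteq> 0 \<and> hline v \<in> S}" "T \<subseteq> proj_points \<and> open {v. v \<noteq> 0 \<and> hline v \<in> T}"
    then have "open ({v. v \<noteq> 0 \<and> hline v \<in> S} \<inter> {v. v \<noteq> 0 \<and> hline v \<in> T})" by (intro open_Int) auto
    then show "open {v. v \<noteq> 0 \<and> hline v \<in> S \<inter> T}" by (rule back_subst[of "open"]) auto
  next
    fix \<K> :: "'a hvec set set set"
    assume "\<forall>K\<in>\<K>. K \<subseteq> proj_points \<and> open {v. v \<noteq> 0 \<and> hline v \<in> K}"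
    then have "open (\<Union>K\<in>\<K>. {v. v \<noteq> 0 \<and> hline v \<in> K})" by (intro open_UN) auto
    then show "open {v. v \<noteq> 0 \<and> hline v \<in> \<Union>\<K>}" by (rule back_subst[of "open"]) auto
  qed auto
  then show ?thesis by (simp add: proj_topology_def topology_inverse')
qed

lemma topspace_proj_topology: "topspace proj_topology = proj_points"
proof
  show "topspace proj_topology \<subseteq> proj_points" using openin_proj_topology openin_topspace by blast
  have "{v :: 'a hvec. v \<noteq> 0 \<and> hline v \<in> proj_points} = - {0}" by (auto intro: hline_in_proj_points)
  then have "openin proj_topology (proj_points :: 'a hvec set set)" by (simp add: openin_proj_topology open_Compl)
  then show "(proj_points :: 'a hvec set set) \<subseteq> topspace proj_topology" by (rule openin_subset)
qed

lemma projective_space_simps: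
  "mtop projective_space = proj_topology"
  "atlas projective_space = range (\<lambda>j. (affine_domain j, affine_coord j))"
  "kform projective_space = fubini_study"
  "proj projective_space = fst"
  "bzero projective_space = (\<lambda>L. (L, \<lambda>v\<in>L. 0))"
  "bscale projective_space = (\<lambda>c (L, f). (L, \<lambda>v\<in>L. c * f v))"
  "badd projective_space = (\<lambda>(L, f) (L', g). (L, \<lambda>v\<in>L. f v + g v))"
  "trivs projective_space = range (\<lambda>j. (affine_domain j, \<lambda>(L, f). f (normalized_rep j L)))"
  "metric projective_space = hyperplane_metric"
  by (simp_all add: projective_space_def)

lemma points_projective_space: "points projective_space = proj_points"
  by (simp add: projective_space_simps topspace_proj_topology)

lemma open_nth_nonzero: "open {v :: 'k::finite hvec. v $ j \<noteq> 0}"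
  by (intro open_Collect_neq continuous_intros)

lemma affine_domain_subset: "affine_domain j \<subseteq> proj_points"
  by (auto simp: affine_domain_def)

lemma openin_affine_domain: "openin proj_topology (affine_domain j)"
proof -
  have "{v :: 'a hvec. v \<noteq> 0 \<and> hline v \<in> affine_domain j} = {v. v $ j \<noteq> 0}" by (auto simp: hline_affine_domain)
  then show ?thesis by (simp add: openin_proj_topology open_nth_nonzero affine_domain_subset)
qed

lemma homeomorphic_affine_coord:
  "homeomorphic_map (subtopology proj_topology (affine_domain j)) (top_of_set UNIV) (affine_coord j)"
proof -
  have "homeomorphic_maps (subtopology proj_topology (affine_domain j)) (top_of_set UNIV) (affine_coord j) (\<lambda>w. hline (emb j w))"
    unfolding homeomorphic_maps_def
  proof (intro conjI ballI)
    show "continuous_map (subtopology proj_topology (affine_domain j)) (top_of_set UNIV) (affine_coord j)"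
    proof (subst subtopology_UNIV, unfold continuous_map_def, intro conjI allI impI)
      fix S :: "(complex^'a) set" assume "openin euclidean S"
      then have S: "open S" by simp
      let ?W = "{L \<in> affine_domain j. affine_coord j L \<in> S}"
      let ?P = "\<lambda>v::'a hvec. \<chi> a. v $ slot j a / v $ j"
      have "continuous_on {v. v $ j \<noteq> 0} ?P"
        by (intro continuous_on_vec_lambda continuous_intros) auto
      then have "open (?P -` S \<inter> {v. v $ j \<noteq> 0})"
        using S by (simp add: continuous_on_open_vimage open_nth_nonzero)
      moreover have "?P -` S \<inter> {v. v $ j \<noteq> 0} = {v. v \<noteq> 0 \<and> hline v \<in> ?W}"
        by (auto simp: hline_affine_domain affine_coord_hline)
      ultimately have "openin proj_topology ?W"
        using affine_domain_subset by (auto simp: openin_proj_topology)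
      then show "openin (subtopology proj_topology (affine_domain j)) {x \<in> topspace (subtopology proj_topology (affine_domain j)). affine_coord j x \<in> S}"
        using affine_domain_subset[of j]
        by (auto simp: openin_subtopology topspace_proj_topology intro!: exI[of _ ?W])
    qed auto
    show "continuous_map (top_of_set UNIV) (subtopology proj_topology (affine_domain j)) (\<lambda>w. hline (emb j w))"
      unfolding continuous_map_in_subtopology subtopology_UNIV
    proof (intro conjI)
      show "continuous_map euclidean proj_topology (\<lambda>w. hline (emb j w))"
        unfolding continuous_map_def
      proof (intro conjI allI impI)
        fix W :: "'a hvec set set" assume "openin proj_topology W"
        then have "open (emb j -` {v. v \<noteq> 0 \<and> hline v \<in> W})"
          by (intro continuous_open_vimage) (auto simp: openin_proj_topology intro: has_derivative_continuous[OF has_derivative_emb])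
        then show "openin euclidean {w \<in> topspace euclidean. hline (emb j w) \<in> W}" by (simp add: vimage_def)
      qed (auto simp: topspace_proj_topology hline_in_proj_points)
    qed (auto simp: hline_affine_domain)
  qed (auto simp: hline_emb_affine_coord)
  then show ?thesis by (rule homeomorphic_maps_imp_map)
qed

text \<open>The form \<open>i \<partial> \<partial>\<close>-bar of \<open>log |Z|\<^sup>2\<close> on
  the punctured space of homogeneous coordinates, at \<open>Z\<close> on the vectors
  \<open>X\<close> and \<open>Y\<close>. It vanishes as soon as \<open>X\<close> or \<open>Y\<close>
  is a multiple of \<open>Z\<close>.\<close>

definition fs_form :: "complex^'j::finite \<Rightarrow> complex^'j \<Rightarrow> complex^'j \<Rightarrow> real" where
  "fs_form Z X Y = 2 * Im (hinner X Y / hinner Z Z - hinner X Z * hinner Z Y / (hinner Z Z)\<^sup>2)"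

lemma hinner_add: "hinner (u + u') v = hinner u v + hinner u' v" "hinner u (v + v') = hinner u v + hinner u v'"
  by (simp_all add: hinner_def algebra_simps sum.distrib)

lemma hinner_cnj: "cnj (hinner u v) = hinner v u"
  by (simp add: hinner_def mult.commute)

lemma hinner_self_nonzero: "v \<noteq> 0 \<Longrightarrow> hinner v v \<noteq> 0"
  by (simp add: hinner_self)

text \<open>Independence of the lift: the form has degree 0 in the joint scaling of point and
  vectors and vanishes in the direction of \<open>Z\<close>. Hence points and tangent vectors of
  projective space may be lifted in any way.\<close>

lemma fs_form_projective:
  assumes c: "c \<noteq> 0" and Z: "Z \<noteq> 0"
  shows "fs_form (c *s Z) (c *s X + a *s Z) (c *s Y + b *s Z) = fs_form Z X Y"
proof -
  let ?z = "hinner Z Z"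
  have z: "?z \<noteq> 0" using Z by (rule hinner_self_nonzero)
  \<comment> \<open>This is a mixed Gram determinant of the pairs \<open>(X, Z)\<close> and
    \<open>(Y, Z)\<close>: multiples of \<open>Z\<close> added to \<open>X\<close> or
    \<open>Y\<close> cancel.\<close>
  have "hinner (c *s X + a *s Z) (c *s Y + b *s Z) * hinner (c *s Z) (c *s Z)
      - hinner (c *s X + a *s Z) (c *s Z) * hinner (c *s Z) (c *s Y + b *s Z)
      = (cnj c * c)\<^sup>2 * (hinner X Y * ?z - hinner X Z * hinner Z Y)"
    unfolding hinner_add hinner_scale by (simp add: algebra_simps power2_eq_square)
  moreover have frac: "p / d - q / d\<^sup>2 = (p * d - q) / d\<^sup>2" if "d \<noteq> 0" for p q d :: complex
    using that by (simp add: field_simps power2_eq_square)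
  moreover have "hinner (c *s Z) (c *s Z) \<noteq> 0" "(hinner (c *s Z) (c *s Z))\<^sup>2 = (cnj c * c)\<^sup>2 * ?z\<^sup>2"
    using c z by (simp_all add: hinner_scale power2_eq_square mult_ac)
  ultimately show ?thesis
    unfolding fs_form_def frac[OF z] using z c frac[of "hinner (c *s Z) (c *s Z)"] by simp
qed

lemma has_derivative_hinner_right: "((\<lambda>p. hinner v p) has_derivative (\<lambda>u. hinner v u)) F"
  unfolding hinner_def
  by (intro has_derivative_sum has_derivative_mult_right bounded_linear_imp_has_derivative bounded_linear_vec_nth)

lemma norm2_derivative:
  "((\<lambda>p. 1 + (norm p)\<^sup>2) has_derivative (\<lambda>u. 2 * Re (hinner p u))) (at (p :: complex^'n::finite))"
proof -
  have "inner p u = Re (hinner p u)" for u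
    by (simp add: hinner_def inner_vec_def inner_complex_def)
  moreover have "((\<lambda>p. 1 + inner p p) has_derivative (\<lambda>u. 0 + (inner p u + inner u p))) (at p)"
    by (intro has_derivative_add has_derivative_const has_derivative_inner has_derivative_ident)
  ultimately show ?thesis unfolding power2_norm_eq_inner by (simp add: inner_commute)
qed

lemma hinner_mult_i: "hinner p (\<i> *s v) = \<i> * hinner p v"
  by (rule hinner_scale)

text \<open>The differential in the direction \<open>u\<close> is \<open>2 * Re (hinner p u)\<close>
  divided by \<open>1 + |p|\<^sup>2\<close>, and \<open>delbar\<close> retains its antilinear
  part.\<close>

lemma delbar_log_norm:
  "delbar (\<lambda>w. complex_of_real (ln (1 + (norm w)\<^sup>2))) p v = hinner v p / complex_of_real (1 + (norm p)\<^sup>2)"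
proof -
  have pos: "0 < 1 + (norm p)\<^sup>2" by (simp add: add_pos_nonneg)
  have "((\<lambda>w. complex_of_real (ln (1 + (norm w)\<^sup>2))) has_derivative
      (\<lambda>u. complex_of_real (2 * Re (hinner p u) * inverse (1 + (norm p)\<^sup>2)))) (at p)"
    by (intro has_derivative_of_real has_derivative_ln norm2_derivative pos)
  from frechet_derivative_at[OF this]
  have "frechet_derivative (\<lambda>w. complex_of_real (ln (1 + (norm w)\<^sup>2))) (at p)
      = (\<lambda>u. complex_of_real (2 * Re (hinner p u) * inverse (1 + (norm p)\<^sup>2)))" ..
  note D = this
  have alg: "(complex_of_real (2 * a * inverse h) + \<i> * complex_of_real (2 * b * inverse h)) / 2
     = (complex_of_real a + \<i> * complex_of_real b) / complex_of_real h" for a b h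
    by (cases "h = 0") (simp_all add: field_simps)
  have "delbar (\<lambda>w. complex_of_real (ln (1 + (norm w)\<^sup>2))) p v =
     (complex_of_real (Re (hinner p v)) - \<i> * complex_of_real (Im (hinner p v))) / complex_of_real (1 + (norm p)\<^sup>2)"
    unfolding delbar_def D alg hinner_mult_i by simp
  also have "complex_of_real (Re (hinner p v)) - \<i> * complex_of_real (Im (hinner p v)) = hinner v p"
    unfolding hinner_cnj[of p v, symmetric] by (simp add: complex_eq_iff)
  finally show ?thesis .
qed

text \<open>The affine expression is the homogeneous one on the slice where the \<open>j\<close>-th
  coordinate is 1. The index \<open>j\<close> is free, since the definition uses the same affine
  formula in all charts.\<close>

lemma fubini_study_eq: "fubini_study c L u v = fs_form (emb j (snd c L)) (emb0 j u) (emb0 j v)"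
proof -
  let ?p = "snd c L"
  define h where "h = 1 + (norm ?p)\<^sup>2"
  have pos: "0 < h" by (simp add: h_def add_pos_nonneg)
  have D0: "((\<lambda>p. hinner v p / complex_of_real (1 + (norm p)\<^sup>2)) has_derivative
      (\<lambda>u. - hinner v ?p * (inverse (complex_of_real h) * complex_of_real (2 * Re (hinner ?p u)) * inverse (complex_of_real h))
         + hinner v u / complex_of_real h)) (at ?p)" for v
    unfolding h_def
    by (intro has_derivative_divide has_derivative_hinner_right has_derivative_of_real norm2_derivative)
      (use pos in \<open>simp del: of_real_add add: h_def\<close>)
  have "((\<lambda>p. hinner v p / complex_of_real (1 + (norm p)\<^sup>2)) has_derivative
      (\<lambda>u. hinner v u / complex_of_real h - hinner v ?p * complex_of_real (2 * Re (hinner ?p u)) / (complex_of_real h)\<^sup>2)) (at ?p)" for v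
    by (rule has_derivative_eq_rhs[OF D0]) (simp add: fun_eq_iff power2_eq_square divide_inverse)
  from frechet_derivative_at[OF this]
  have D: "frechet_derivative (\<lambda>p. hinner v p / complex_of_real (1 + (norm p)\<^sup>2)) (at ?p)
     = (\<lambda>u. hinner v u / complex_of_real h - hinner v ?p * complex_of_real (2 * Re (hinner ?p u)) / (complex_of_real h)\<^sup>2)" for v ..
  have c: "hinner v u = cnj (hinner u v)" "hinner v ?p = cnj (hinner ?p v)" "hinner u ?p = cnj (hinner ?p u)"
    by (simp_all add: hinner_cnj)
  have "hinner (emb j ?p) (emb j ?p) = complex_of_real h" unfolding hinner_emb(4) by (simp add: hinner_self h_def)
  then have "fs_form (emb j ?p) (emb0 j u) (emb0 j v) =
      2 * Im (hinner u v / complex_of_real h - hinner u ?p * hinner ?p v / (complex_of_real h)\<^sup>2)"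
    by (simp only: fs_form_def hinner_emb)
  also have "\<dots> = 2 * (Im (hinner u v) / h - Im (hinner u ?p * hinner ?p v) / h\<^sup>2)"
    by (simp flip: of_real_power)
  also have "\<dots> = fubini_study c L u v"
    unfolding fubini_study_def del_delbar_def ext_d_def delbar_log_norm D c
    by (simp flip: of_real_power add: algebra_simps diff_divide_distrib add_divide_distrib)
  finally show ?thesis ..
qed

section \<open>The Fubini--Study measure\<close>

lemma scaleR_complex_vec: "r *\<^sub>R (v :: complex^'n) = complex_of_real r *s v"
  by (simp add: vec_eq_iff) (simp add: scaleR_conv_of_real)

text \<open>The inverse \<open>B\<close> and its linearity belong to the assumptions so that the
  roles of \<open>A\<close> and \<open>B\<close> can be exchanged.\<close>

locale unitary =
  fixes A B :: "'k::finite hvec \<Rightarrow> 'k hvec"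
  assumes add: "A (u + v) = A u + A v" and scale: "A (c *s u) = c *s A u"
    and inner: "hinner (A u) (A v) = hinner u v"
    and inverse: "A (B u) = u" "B (A u) = u"
    and add': "B (u + v) = B u + B v" and scale': "B (c *s u) = c *s B u"
begin

lemma zero: "A 0 = 0"
  using scale[of 0 0] by simp

lemma nonzero: "u \<noteq> 0 \<Longrightarrow> A u \<noteq> 0"
  by (metis inverse(2) add_0 scale' vector_smult_lzero zero)

lemma linear: "linear A"
  by (intro linearI add) (simp add: scaleR_complex_vec scale)

lemma continuous: "continuous_on S A"
  using linear by (simp add: linear_continuous_on linear_conv_bounded_linear)

lemma image_hline: "A ` hline v = hline (A v)"
  by (auto simp: hline_def scale image_iff)

lemma measurable_image:
  assumes "liouville_manifold (pspace :: 'k projective_data) C"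
  shows "(`) A \<in> measurable (liouville_manifold.borel_sets (pspace :: 'k projective_data))
     (liouville_manifold.borel_sets (pspace :: 'k projective_data))"
proof -
  interpret P: liouville_manifold "pspace :: 'k projective_data" C by fact
  show ?thesis
  proof (rule P.measurable_borel_setsI)
    show "A ` L \<in> points projective_space" if "L \<in> space P.borel_sets" for L
      using that unfolding P.space_borel_sets points_projective_space
      by (elim proj_points_cases) (simp add: image_hline hline_in_proj_points nonzero)
    fix U assume "openin (mtop (pspace :: 'k projective_data)) U"
    then have U: "open {v. v \<noteq> 0 \<and> hline v \<in> U}" "U \<subseteq> proj_points"
      by (simp_all add: projective_space_simps openin_proj_topology)
    let ?W = "(`) A -` U \<inter> proj_points"
    have "A -` {v. v \<noteq> 0 \<and> hline v \<in> U} = {v. v \<noteq> 0 \<and> hline v \<in> ?W}"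
    proof -
      have "A v = 0 \<longleftrightarrow> v = 0" for v using nonzero[of v] zero by auto
      then show ?thesis
        by (simp add: set_eq_iff image_hline hline_in_proj_points cong: conj_cong)
    qed
    moreover have "open (A -` {v. v \<noteq> 0 \<and> hline v \<in> U})"
      using U(1) by (rule continuous_open_vimage)
        (use linear in \<open>simp add: linear_continuous_at linear_conv_bounded_linear\<close>)
    ultimately have "openin (mtop projective_space) ?W"
      by (simp add: projective_space_simps openin_proj_topology)
    then show "(`) A -` U \<inter> space P.borel_sets \<in> sets P.borel_sets"
      by (simp add: P.space_borel_sets points_projective_space P.open_in_borel_sets)
  qed
qed

text \<open>In charts \<open>A\<close> is a fractional linear map. Lifted to homogeneous
  coordinates, its derivative is \<open>A\<close> up to a factor and a multiple of the base point,
  neither of which changes \<open>fs_form\<close>. For the identity this is the compatibility of the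
  affine charts with each other.\<close>

lemma pulls_back_form_image:
  assumes L: "L \<in> affine_domain i" and AL: "A ` L \<in> affine_domain j"
  shows "pulls_back_form projective_space (affine_domain i, affine_coord i) (affine_domain j, affine_coord j) ((`) A) L"
proof -
  let ?w = "affine_coord i L"
  let ?Z = "A (emb i ?w)"
  let ?c = "?Z $ j"
  have AL': "A ` L = hline ?Z" using hline_emb_affine_coord[OF L] image_hline[of "emb i ?w"] by simp
  then have c: "?c \<noteq> 0" using AL by (simp add: hline_affine_domain)
  define g where "g w = (\<chi> a. A (emb i w) $ slot j a / A (emb i w) $ j)" for w
  define D where "D u = (\<chi> a. (A (emb0 i u) $ slot j a * ?c - ?Z $ slot j a * A (emb0 i u) $ j) / (?c * ?c))" for u
  have "((\<lambda>w. A (emb i w) $ l) has_derivative (\<lambda>u. A (emb0 i u) $ l)) (at ?w)" for l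
  proof -
    have "bounded_linear (\<lambda>v. A v $ l)"
      using linear by (intro bounded_linear_compose[OF bounded_linear_vec_nth]) (simp add: linear_conv_bounded_linear)
    then show ?thesis by (rule bounded_linear.has_derivative) (rule has_derivative_emb)
  qed
  then have "((\<lambda>w. g w $ a) has_derivative (\<lambda>u. (A (emb0 i u) $ slot j a * ?c - ?Z $ slot j a * A (emb0 i u) $ j) / (?c * ?c))) (at ?w)" for a
    unfolding g_def vec_lambda_beta by (intro has_derivative_divide' c)
  from has_derivative_vec_lambda[OF this] have g: "(g has_derivative D) (at ?w)"
    by (rule has_derivative_eq_rhs) (simp add: D_def fun_eq_iff)
  have "continuous_on UNIV (\<lambda>w. A (emb i w) $ j)"
    by (intro continuous_intros continuous_on_compose2[OF continuous[of UNIV] continuous_emb]) auto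
  then have op: "open {w. A (emb i w) $ j \<noteq> 0}" by (intro open_Collect_neq continuous_on_const)
  have der: "((\<lambda>w. affine_coord j (A ` (inv_into (affine_domain i) (affine_coord i) w))) has_derivative D) (at ?w)"
    by (rule has_derivative_transform_within_open[OF g op])
      (use c in \<open>auto simp: g_def inv_affine_coord image_hline affine_coord_hline\<close>)
  have cl: "D (a *s v) = a *s D v" for a v
    by (simp add: D_def vec_eq_iff emb0_scale scale field_simps)
  have wA: "affine_coord j (A ` L) = (\<chi> a. ?Z $ slot j a / ?c)" unfolding AL' using c by (rule affine_coord_hline)
  have e1: "emb j (affine_coord j (A ` L)) = (1 / ?c) *s ?Z"
    by (rule vec_eq_slotI[of _ j]) (use c in \<open>simp_all add: wA\<close>)
  \<comment> \<open>The quotient rule in homogeneous form: differentiating \<open>Z / Z_j\<close>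
    gives the derivative of \<open>Z\<close> divided by \<open>Z_j\<close>, plus a multiple of
    \<open>Z\<close>.\<close>
  have e2: "emb0 j (D u) = (1 / ?c) *s A (emb0 i u) + (- A (emb0 i u) $ j / (?c * ?c)) *s ?Z" for u
    by (rule vec_eq_slotI[of _ j]) (use c in \<open>simp_all add: D_def field_simps\<close>)
  have c': "1 / ?c \<noteq> 0" using c by simp
  have fs: "fs_form ?Z (A u) (A v) = fs_form (emb i ?w) u v" for u v
    by (simp add: fs_form_def inner)
  have "fubini_study (affine_domain i, affine_coord i) L u v =
      fubini_study (affine_domain j, affine_coord j) (A ` L) (D u) (D v)" for u v
    unfolding fubini_study_eq[where j = i and c = "(affine_domain i, affine_coord i)"] fubini_study_eq[where j = j and c = "(affine_domain j, affine_coord j)"]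
    unfolding snd_conv e1 e2 fs_form_projective[OF c' nonzero[OF emb_nonzero]] fs ..
  then show ?thesis
    unfolding pulls_back_form_def using der cl by (auto simp: projective_space_simps)
qed

end

lemma unitary_ident: "unitary (\<lambda>v. v) (\<lambda>v. v)"
  by unfold_locales auto

lemma bilinear_fs_form: "bilinear (\<lambda>u v. fs_form Z (emb0 j u) (emb0 j v))"
proof -
  have add: "fs_form Z (X + X') Y = fs_form Z X Y + fs_form Z X' Y"
    "fs_form Z X (Y + Y') = fs_form Z X Y + fs_form Z X Y'" for X X' Y Y'
    unfolding fs_form_def hinner_add by (simp_all add: algebra_simps add_divide_distrib)
  have real_factor: "Im (complex_of_real r * a / z - (complex_of_real r * b) * c / z\<^sup>2) = r * Im (a / z - b * c / z\<^sup>2)" for r a b c z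
  proof -
    have "complex_of_real r * a / z - (complex_of_real r * b) * c / z\<^sup>2 = complex_of_real r * (a / z - b * c / z\<^sup>2)"
      by (simp add: algebra_simps)
    then show ?thesis by simp
  qed
  have scale: "fs_form Z (complex_of_real r *s X) Y = r * fs_form Z X Y"
    "fs_form Z X (complex_of_real r *s Y) = r * fs_form Z X Y" for r X Y
    unfolding fs_form_def hinner_scale complex_cnj_complex_of_real
    using real_factor[of r "hinner X Y" "hinner Z Z" "hinner X Z" "hinner Z Y"]
      real_factor[of r "hinner X Y" "hinner Z Z" "hinner Z Y" "hinner X Z"]
    by (simp_all add: mult_ac)
  have emb0_add: "emb0 j (u + v) = emb0 j u + emb0 j v" for u v
    by (rule vec_eq_slotI[of _ j]) simp_all
  show ?thesis unfolding bilinear_def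
    by (intro conjI allI linearI) (simp_all add: emb0_add add scaleR_complex_vec emb0_scale scale)
qed

lemma continuous_fs_density:
  "continuous_on S (\<lambda>w. liouville_density (\<lambda>u v. fs_form (emb j w) (emb0 j u) (emb0 j v)))"
proof -
  have "continuous_on S (\<lambda>w. fs_form (emb j w) X Y)" for X Y
  proof -
    have "continuous_on S (\<lambda>w. emb j w $ i)" for i by (intro continuous_intros continuous_emb)
    note this[continuous_intros]
    show ?thesis unfolding fs_form_def
      unfolding hinner_self
      by (intro continuous_intros continuous_on_divide continuous_emb)
        (auto simp: hinner_def intro!: continuous_intros)
  qed
  note entry = this
  show ?thesis unfolding liouville_density_def
    by (intro continuous_on_divide continuous_on_sum continuous_on_mult continuous_on_prod continuous_on_const entry) auto
qed

text \<open>The finite atlas is its own countable subcover, and a change of charts is the action of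
  the identity, a unitary map.\<close>

lemma liouville_manifold_projective_space: "liouville_manifold pspace (atlas pspace)"
proof
  fix c d :: "('k::finite hvec set, 'k) chart" and x
  assume c: "c \<in> atlas pspace"
  then obtain j where j: "c = (affine_domain j, affine_coord j)" by (auto simp: projective_space_simps)
  show "openin (mtop pspace) (fst c) \<and> open (snd c ` fst c) \<and>
      homeomorphic_map (subtopology (mtop pspace) (fst c)) (top_of_set (snd c ` fst c)) (snd c)"
    by (simp add: j projective_space_simps affine_coord_image openin_affine_domain homeomorphic_affine_coord[unfolded subtopology_UNIV])
  have k: "kform pspace c L = (\<lambda>u v. fs_form (emb j (snd c L)) (emb0 j u) (emb0 j v))" for L
    by (simp add: projective_space_simps fubini_study_eq[where j = j] fun_eq_iff)
  show "bilinear (kform pspace c x)" unfolding k by (rule bilinear_fs_form)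
  show "continuous_on (snd c ` fst c) (\<lambda>p. liouville_density (kform pspace c (inv_into (fst c) (snd c) p)))"
    unfolding k by (simp add: j inv_affine_coord continuous_fs_density)
  assume "d \<in> atlas pspace" "x \<in> fst c \<inter> fst d"
  then show "pulls_back_form pspace c d (\<lambda>x. x) x"
    using unitary.pulls_back_form_image[OF unitary_ident, of x] by (auto simp: j projective_space_simps image_ident[abs_def])
next
  show "(\<Union>c\<in>atlas pspace. fst c) = points pspace"
  proof
    show "(\<Union>c\<in>atlas pspace. fst c) \<subseteq> points pspace"
      unfolding points_projective_space using affine_domain_subset by (auto simp: projective_space_simps)
    show "points pspace \<subseteq> (\<Union>c\<in>atlas pspace. fst c)"
    proof
      fix L :: "'k::finite hvec set" assume "L \<in> points pspace"
      then obtain v where v: "v \<noteq> 0" "L = hline v" unfolding points_projective_space by (elim proj_points_cases)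
      then obtain j where "v $ j \<noteq> 0" by (auto simp: vec_eq_iff)
      then have "L \<in> affine_domain j" using v by (simp add: hline_affine_domain)
      then show "L \<in> (\<Union>c\<in>atlas pspace. fst c)" by (auto simp: projective_space_simps)
    qed
  qed
qed (auto simp: projective_space_simps countable_finite)

interpretation P: liouville_manifold pspace "atlas pspace"
  by (rule liouville_manifold_projective_space)

lemma (in unitary) distr_liouville_measure:
  "distr (liouville_measure pspace) (liouville_measure pspace) ((`) A) = liouville_measure pspace"
proof (rule P.distr_liouville_measure[where \<psi> = "(`) B"])
  interpret B: unitary B A
    by unfold_locales (metis add' scale' inner inverse add scale)+
  show "(`) A \<in> P.borel_sets \<rightarrow>\<^sub>M P.borel_sets" by (rule measurable_image[OF liouville_manifold_projective_space])
  show "(`) B \<in> P.borel_sets \<rightarrow>\<^sub>M P.borel_sets" by (rule B.measurable_image[OF liouville_manifold_projective_space])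
  show "B ` A ` L = L" "A ` B ` L = L" for L by (simp_all add: image_image inverse)
  show "pulls_back_form pspace c d ((`) A) x"
    if "c \<in> atlas pspace" "d \<in> atlas pspace" "x \<in> fst c" "A ` x \<in> fst d" for c d x
    using that pulls_back_form_image by (auto simp: projective_space_simps)
qed

text \<open>Every nonzero term of the sum is positive. Its permutation sends each pair of indices
  \<open>(j, False)\<close>, \<open>(j, True)\<close> to such a pair; it is therefore a permutation
  of whole pairs, which is even, up to exchanges within pairs, and each exchange changes both the
  sign and the product by -1. The identity contributes \<open>2 ^ CARD('n)\<close>.\<close>

lemma liouville_density_standard_pos:
  fixes \<beta> :: "complex^'n::finite \<Rightarrow> complex^'n \<Rightarrow> real"
  assumes \<beta>: "\<And>i s j t. \<beta> (coord_frame (i, s)) (coord_frame (j, t)) = (if i = j \<and> s \<noteq> t then (if t then 2 else - 2) else 0)"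
  shows "0 < liouville_density \<beta>"
proof -
  define T where "T \<sigma> = of_int (sign \<sigma>) * (\<Prod>j\<in>UNIV. \<beta> (coord_frame (\<sigma> (j, False))) (coord_frame (\<sigma> (j, True))))" for \<sigma> :: "'n \<times> bool \<Rightarrow> 'n \<times> bool"
  define flip where "flip S = (\<lambda>(j::'n, b). (j, if j \<in> S then \<not> b else b))" for S
  have flip: "flip S permutes UNIV \<and> sign (flip S) = (- 1) ^ card S" if "finite S" for S
    using that
  proof (induction S)
    case empty
    have "flip {} = id" by (auto simp: flip_def)
    then show ?case using permutes_id sign_id by (metis card.empty power_0)
  next
    case (insert j S)
    have e: "flip (insert j S) = Transposition.transpose (j, False) (j, True) \<circ> flip S"
      using insert(2) by (auto simp: flip_def fun_eq_iff Transposition.transpose_def)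
    have p: "Transposition.transpose (j, False) (j, True) permutes UNIV" by (rule permutes_swap_id) auto
    have "flip (insert j S) permutes UNIV" unfolding e using insert p by (intro permutes_compose) auto
    moreover have "sign (flip (insert j S)) = sign (Transposition.transpose (j, False) (j, True)) * sign (flip S)"
      unfolding e using insert p by (intro sign_compose) (auto simp: permutation_permutes)
    ultimately show ?case using insert by (simp add: sign_swap_id)
  qed
  \<comment> \<open>The permutation is the product of its actions on the two copies of
    \<open>'n\<close>. These are conjugate under the exchange of the copies, so their signs are
    equal and multiply to 1.\<close>
  have block: "sign (\<lambda>(j::'n, b::bool). (\<pi> j, b)) = 1" if \<pi>: "\<pi> permutes UNIV" for \<pi> :: "'n \<Rightarrow> 'n"
  proof -
    define \<rho> where "\<rho> b0 = (\<lambda>(j::'n, b::bool). (if b = b0 then \<pi> j else j, b))" for b0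
    have bij\<pi>: "inj \<pi>" "surj \<pi>" using permutes_inj[OF \<pi>] permutes_surj[OF \<pi>] by auto
    have "bij (\<rho> b0)" for b0
    proof -
      have "inj (\<rho> b0)"
      proof (rule injI)
        fix x y assume "\<rho> b0 x = \<rho> b0 y"
        then show "x = y"
          by (cases x; cases y) (auto simp: \<rho>_def split: if_splits dest: injD[OF bij\<pi>(1)])
      qed
      then show ?thesis using finite_UNIV_inj_surj[of "\<rho> b0"] by (simp add: bij_def)
    qed
    then have perm: "\<rho> b0 permutes UNIV" for b0 by (intro bij_imp_permutes) auto
    define sw where "sw = (\<lambda>(j::'n, b::bool). (j, \<not> b))"
    have "inj sw" by (auto simp: inj_def sw_def)
    have "map_permutation UNIV sw (\<rho> True) x = \<rho> False x" for x
    proof -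
      have "map_permutation UNIV sw (\<rho> True) (sw (sw x)) = sw (\<rho> True (sw x))"
        by (rule map_permutation_apply) (use \<open>inj sw\<close> in auto)
      then show ?thesis by (cases x) (auto simp: sw_def \<rho>_def)
    qed
    then have "map_permutation UNIV sw (\<rho> True) = \<rho> False" ..
    then have s: "sign (\<rho> False) = sign (\<rho> True)"
      using sign_map_permutation[OF \<open>inj sw\<close> perm[of True]] by simp
    have "(\<lambda>(j::'n, b::bool). (\<pi> j, b)) = \<rho> True \<circ> \<rho> False" by (auto simp: \<rho>_def fun_eq_iff)
    then have "sign (\<lambda>(j::'n, b::bool). (\<pi> j, b)) = sign (\<rho> True) * sign (\<rho> False)"
      using perm by (simp only:) (intro sign_compose, auto simp: permutation_permutes)
    then show ?thesis by (simp add: s)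
  qed
  have nonneg: "0 \<le> T \<sigma>" if \<sigma>: "\<sigma> permutes UNIV" for \<sigma>
  proof (cases "T \<sigma> = 0")
    case False
    then have nz: "\<beta> (coord_frame (\<sigma> (j, False))) (coord_frame (\<sigma> (j, True))) \<noteq> 0" for j
      by (auto simp: T_def)
    have fst: "fst (\<sigma> (j, True)) = fst (\<sigma> (j, False))" and snd: "snd (\<sigma> (j, True)) = (\<not> snd (\<sigma> (j, False)))" for j
      using nz[of j] by (cases "\<sigma> (j, False)"; cases "\<sigma> (j, True)"; auto simp: \<beta> split: if_splits)+
    define S where "S = {j. snd (\<sigma> (j, False))}"
    define \<pi> where "\<pi> j = fst (\<sigma> (j, False))" for j
    have "finite S" by simp
    have val: "\<beta> (coord_frame (\<sigma> (j, False))) (coord_frame (\<sigma> (j, True))) = (if j \<in> S then - 2 else 2)" for j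
      using fst[of j] snd[of j] by (cases "\<sigma> (j, False)"; cases "\<sigma> (j, True)") (auto simp: \<beta> S_def)
    have \<rho>: "\<sigma> \<circ> flip S = (\<lambda>(j, b). (\<pi> j, b))"
    proof
      fix x :: "'n \<times> bool"
      obtain j b where x: "x = (j, b)" by force
      show "(\<sigma> \<circ> flip S) x = (\<lambda>(j, b). (\<pi> j, b)) x"
        using fst[of j] snd[of j] by (cases b) (auto simp: x flip_def S_def \<pi>_def prod_eq_iff)
    qed
    have "inj (\<sigma> \<circ> flip S)" using permutes_inj[OF \<sigma>] permutes_inj flip[OF \<open>finite S\<close>] by (metis inj_compose)
    then have "inj \<pi>" unfolding \<rho> inj_def by (metis (mono_tags, lifting) case_prod_conv prod.inject)
    then have "bij \<pi>" using finite_UNIV_inj_surj[of \<pi>] by (simp add: bij_def)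
    then have \<pi>: "\<pi> permutes UNIV" by (intro bij_imp_permutes) auto
    have "sign (\<sigma> \<circ> flip S) = 1" unfolding \<rho> by (rule block[OF \<pi>])
    moreover have "sign (\<sigma> \<circ> flip S) = sign \<sigma> * sign (flip S)"
      using \<sigma> flip[OF \<open>finite S\<close>] by (intro sign_compose) (auto simp: permutation_permutes)
    ultimately have s1: "sign \<sigma> * (- 1) ^ card S = 1" using flip[OF \<open>finite S\<close>] by simp
    have pr: "(\<Prod>j\<in>UNIV. \<beta> (coord_frame (\<sigma> (j, False))) (coord_frame (\<sigma> (j, True)))) = (- 1) ^ card S * 2 ^ CARD('n)"
    proof -
      have "(\<Prod>j\<in>UNIV. \<beta> (coord_frame (\<sigma> (j, False))) (coord_frame (\<sigma> (j, True)))) = (\<Prod>j\<in>UNIV. (if j \<in> S then - 1 else 1) * 2)"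
        unfolding val by (intro prod.cong) auto
      also have "\<dots> = (\<Prod>j\<in>UNIV. if j \<in> S then - 1 else 1) * 2 ^ CARD('n)" by (simp only: prod.distrib prod_constant)
      also have "(\<Prod>j\<in>UNIV. if j \<in> S then - 1 else (1::real)) = (- 1) ^ card S" by (simp add: prod.If_cases)
      finally show ?thesis .
    qed
    have "T \<sigma> = real_of_int (sign \<sigma> * (- 1) ^ card S) * 2 ^ CARD('n)"
      unfolding T_def pr by simp
    then have "T \<sigma> = 2 ^ CARD('n)" unfolding s1 by simp
    then show ?thesis by simp
  qed simp
  have "T id = 2 ^ CARD('n)" by (simp add: T_def \<beta>)
  moreover have "T id \<le> (\<Sum>\<sigma> | \<sigma> permutes UNIV. T \<sigma>)"
    using nonneg by (intro member_le_sum) (auto simp: permutes_id[unfolded id_def])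
  ultimately have "0 < (\<Sum>\<sigma> | \<sigma> permutes UNIV. T \<sigma>)" by (metis less_le_trans zero_less_numeral zero_less_power)
  then show ?thesis unfolding liouville_density_def T_def by simp
qed

section \<open>Finiteness and positivity of the total mass of projective space\<close>

definition fs_density :: "'k::finite option \<Rightarrow> complex^'k \<Rightarrow> real" where
  "fs_density j w = liouville_density (\<lambda>u v. fs_form (emb j w) (emb0 j u) (emb0 j v))"

lemma emeasure_affine:
  assumes "B \<in> sets P.borel_sets" "B \<subseteq> affine_domain j"
  shows "emeasure (liouville_measure pspace) B = (\<integral>\<^sup>+w\<in>affine_coord j ` B. ennreal (fs_density j w) \<partial>lborel)"
proof -
  have "(affine_domain j, affine_coord j) \<in> atlas pspace" by (simp add: projective_space_simps)
  moreover have "fubini_study c L = (\<lambda>u v. fs_form (emb j (snd c L)) (emb0 j u) (emb0 j v))" for c and L :: "'a hvec set"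
    by (intro ext) (rule fubini_study_eq)
  ultimately show ?thesis
    using P.emeasure_liouville_measure[of "(affine_domain j, affine_coord j)" B] assms
    by (simp add: chart_measure_def projective_space_simps inv_affine_coord fs_density_def)
qed

lemma continuous_fs_density': "continuous_on S (fs_density j)"
  unfolding fs_density_def by (rule continuous_fs_density)

text \<open>In the chart \<open>j\<close> this is the closed unit polydisc. Finitely many such sets
  cover projective space, which reduces finiteness of the mass to bounded sets of affine
  coordinates.\<close>

definition max_coord :: "'k::finite option \<Rightarrow> 'k hvec set set" where
  "max_coord j = {L \<in> proj_points. \<forall>v\<in>L. \<forall>i. cmod (v $ i) \<le> cmod (v $ j)}"

lemma hline_max_coord: "v \<noteq> 0 \<Longrightarrow> hline v \<in> max_coord j \<longleftrightarrow> (\<forall>i. cmod (v $ i) \<le> cmod (v $ j))"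
  by (auto simp: max_coord_def mem_hline hline_in_proj_points norm_mult intro!: mult_left_mono)

lemma max_coord_subset: "max_coord j \<subseteq> affine_domain j"
proof
  fix L assume L: "L \<in> max_coord j"
  then obtain v where v: "v \<noteq> 0" "L = hline v" by (auto simp: max_coord_def elim: proj_points_cases)
  then have "\<forall>i. cmod (v $ i) \<le> cmod (v $ j)" using L hline_max_coord by blast
  then have "v $ j \<noteq> 0" using v(1) by (auto simp: vec_eq_iff)
  then show "L \<in> affine_domain j" by (simp add: v hline_affine_domain)
qed

lemma max_coord_borel: "max_coord j \<in> sets P.borel_sets"
proof -
  have "{v. v \<noteq> 0 \<and> hline v \<in> proj_points - max_coord j} = (\<Union>i. {v. cmod (v $ j) < cmod (v $ i)})"
    (is "_ = ?R")
  proof (rule set_eqI)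
    fix v show "v \<in> {v. v \<noteq> 0 \<and> hline v \<in> proj_points - max_coord j} \<longleftrightarrow> v \<in> ?R"
      by (cases "v = 0") (simp_all add: hline_max_coord hline_in_proj_points not_le)
  qed
  moreover have "open (\<Union>i. {v::'a hvec. cmod (v $ j) < cmod (v $ i)})"
    by (intro open_UN ballI open_Collect_less continuous_intros)
  ultimately have "openin (mtop pspace) (proj_points - max_coord j)"
    by (auto simp: projective_space_simps openin_proj_topology)
  then have "points pspace - (proj_points - max_coord j) \<in> sets P.borel_sets"
    using P.open_in_borel_sets P.space_borel_sets sets.compl_sets by metis
  moreover have "points pspace - (proj_points - max_coord j) = max_coord j"
    by (auto simp: points_projective_space max_coord_def)
  ultimately show ?thesis by simp
qed

lemma emeasure_max_coord_finite: "emeasure (liouville_measure pspace) (max_coord j) < \<infinity>"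
proof -
  \<comment> \<open>A vector with \<open>CARD('a)\<close> entries of modulus at most 1 has norm at
    most \<open>CARD('a)\<close>.\<close>
  let ?R = "real CARD('a)"
  let ?K = "cball 0 ?R :: (complex^'a) set"
  have sub: "affine_coord j ` max_coord j \<subseteq> ?K"
  proof
    fix w assume "w \<in> affine_coord j ` max_coord j"
    then obtain L where L: "L \<in> max_coord j" "w = affine_coord j L" by auto
    then have "hline (emb j w) \<in> max_coord j" using hline_emb_affine_coord max_coord_subset by (metis subsetD)
    then have "cmod (emb j w $ i) \<le> 1" for i using hline_max_coord[of "emb j w" j] by simp
    then have "cmod (w $ a) \<le> 1" for a by (metis emb_nth(2))
    then have "norm w \<le> ?R"
      unfolding norm_vec_def using L2_set_le_sum[of UNIV "\<lambda>a. cmod (w $ a)"] sum_bounded_above[of UNIV "\<lambda>a. cmod (w $ a)" 1]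
      by simp
    then show "w \<in> ?K" by simp
  qed
  have "compact (fs_density j ` ?K)"
    by (intro compact_continuous_image continuous_fs_density' compact_cball)
  then obtain b where b: "\<And>w. w \<in> ?K \<Longrightarrow> norm (fs_density j w) \<le> b"
    unfolding bounded_iff[symmetric] using compact_imp_bounded by (meson bounded_iff image_eqI)
  have "emeasure (liouville_measure pspace) (max_coord j) = (\<integral>\<^sup>+w\<in>affine_coord j ` max_coord j. ennreal (fs_density j w) \<partial>lborel)"
    by (rule emeasure_affine[OF max_coord_borel max_coord_subset])
  also have "\<dots> \<le> (\<integral>\<^sup>+w. ennreal b * indicator ?K w \<partial>lborel)"
    using sub b by (intro nn_integral_mono) (force simp: indicator_def intro: ennreal_leI)
  also have "\<dots> = ennreal b * emeasure lborel ?K" by (rule nn_integral_cmult_indicator) simp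
  also have "\<dots> < \<infinity>" using emeasure_bounded_finite[of ?K] by (simp add: ennreal_mult_less_top)
  finally show ?thesis .
qed

lemma space_liouville_pspace: "space (liouville_measure pspace) = proj_points"
  by (simp add: P.space_liouville_measure points_projective_space)

lemma finite_measure_pspace: "finite_measure (liouville_measure (pspace :: 'k::finite projective_data))"
  (is "finite_measure ?L")
proof (rule finite_measureI)
  have cover: "(proj_points :: 'k hvec set set) = (\<Union>j. max_coord j)"
  proof
    show "(proj_points :: 'k hvec set set) \<subseteq> (\<Union>j. max_coord j)"
    proof
      fix L :: "'k hvec set" assume "L \<in> proj_points"
      then obtain v where v: "v \<noteq> 0" "L = hline v" by (elim proj_points_cases)
      obtain j where "\<forall>i. cmod (v $ i) \<le> cmod (v $ j)"
        using Max_in[of "range (\<lambda>i. cmod (v $ i))"] Max_ge[of "range (\<lambda>i. cmod (v $ i))"] by fastforce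
      then have "L \<in> max_coord j" using v by (simp add: hline_max_coord)
      then show "L \<in> (\<Union>j. max_coord j)" by blast
    qed
  qed (auto simp: max_coord_def)
  have "emeasure ?L (space ?L) \<le> (\<Sum>j\<in>UNIV. emeasure ?L (max_coord j))"
    unfolding space_liouville_pspace cover
    by (rule emeasure_subadditive_finite) (auto simp: P.sets_liouville_measure max_coord_borel)
  also have "\<dots> < \<infinity>" using emeasure_max_coord_finite[where ?'a = 'k] by (simp add: less_top)
  finally show "emeasure ?L (space ?L) \<noteq> \<infinity>" by simp
qed

text \<open>At the origin of the chart tangent vectors are orthogonal to the base point, so the
  second term of \<open>fs_form\<close> vanishes and twice the standard symplectic form
  remains.\<close>

lemma fs_density_zero_pos: "0 < fs_density None 0"
  unfolding fs_density_def
proof (rule liouville_density_standard_pos)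
  fix i j :: 'a and s t
  have "hinner (coord_frame (i, s)) (coord_frame (j, t)) =
      (\<Sum>l\<in>UNIV. if l = i then (if i = j then cnj (if s then \<i> else 1) * (if t then \<i> else 1) else 0) else 0)"
    unfolding hinner_def by (intro sum.cong) (auto simp: coord_frame_nth)
  then have h: "hinner (coord_frame (i, s)) (coord_frame (j, t)) = (if i = j then cnj (if s then \<i> else 1) * (if t then \<i> else 1) else 0)"
    by simp
  have z: "hinner u 0 = 0" "hinner 0 u = 0" for u :: "complex^'a" by (simp_all add: hinner_def)
  show "fs_form (emb None 0) (emb0 None (coord_frame (i, s))) (emb0 None (coord_frame (j, t))) =
      (if i = j \<and> s \<noteq> t then (if t then 2 else - 2) else 0)"
    unfolding fs_form_def hinner_emb z h by simp
qed

text \<open>Positivity of the density at one point suffices: by continuity the density stays above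
  half that value on a ball, and a ball has positive Lebesgue measure.\<close>

lemma measure_pspace_pos: "0 < measure (liouville_measure pspace) (proj_points :: 'k::finite hvec set set)"
proof -
  interpret F: finite_measure "liouville_measure (pspace :: 'k projective_data)" by (rule finite_measure_pspace)
  let ?d = "fs_density None (0 :: complex^'k)"
  have "isCont (fs_density None) (0 :: complex^'k)"
    using continuous_fs_density'[of "UNIV :: (complex^'k) set" None] by (simp add: continuous_on_eq_continuous_at)
  then have "\<exists>e>0. \<forall>w :: complex^'k. dist w 0 < e \<longrightarrow> dist (fs_density None w) ?d < ?d / 2"
    unfolding continuous_at_eps_delta
    by (elim allE[of _ "?d / 2"] impE) (use half_gt_zero[OF fs_density_zero_pos[where ?'a = 'k]] in simp_all)
  then obtain e where e: "e > 0" "\<And>w :: complex^'k. dist w 0 < e \<Longrightarrow> dist (fs_density None w) ?d < ?d / 2" by blast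
  have lower: "?d / 2 \<le> fs_density None w" if "w \<in> ball 0 e" for w :: "complex^'k"
  proof -
    have "\<bar>fs_density None w - ?d\<bar> < ?d / 2" using e(2)[of w] that by (simp add: dist_real_def dist_commute)
    then show ?thesis by linarith
  qed
  have "0 < ennreal (?d / 2) * emeasure lborel (ball (0::complex^'k) e)"
  proof -
    have "emeasure lborel (ball (0::complex^'k) e) = ennreal (measure lborel (ball (0::complex^'k) e))"
      by (intro emeasure_eq_ennreal_measure) (metis bounded_ball emeasure_bounded_finite infinity_ennreal_def less_irrefl)
    then show ?thesis using fs_density_zero_pos[where ?'a = 'k] content_ball_pos[OF e(1), of "0::complex^'k"]
      by (simp add: ennreal_zero_less_mult_iff)
  qed
  also have "\<dots> = (\<integral>\<^sup>+w. ennreal (?d / 2) * indicator (ball (0::complex^'k) e) w \<partial>lborel)"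
    by (rule nn_integral_cmult_indicator[symmetric]) simp
  also have "\<dots> \<le> (\<integral>\<^sup>+w\<in>affine_coord None ` (affine_domain None :: 'k hvec set set). ennreal (fs_density None w) \<partial>lborel)"
    unfolding affine_coord_image using lower by (intro nn_integral_mono) (auto simp: indicator_def intro: ennreal_leI)
  also have "\<dots> = emeasure (liouville_measure pspace) (affine_domain None :: 'k hvec set set)"
    using P.open_in_borel_sets openin_affine_domain by (intro emeasure_affine[symmetric]) (auto simp: projective_space_simps)
  also have "\<dots> \<le> emeasure (liouville_measure pspace) (proj_points :: 'k hvec set set)"
    using affine_domain_subset sets.top[of "liouville_measure pspace"]
    by (intro emeasure_mono) (auto simp: space_liouville_pspace)
  finally show ?thesis by (simp add: F.emeasure_eq_measure)
qed

section \<open>Scalar products of linear forms\<close>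

definition lform :: "('k::finite option \<Rightarrow> complex) \<Rightarrow> 'k hvec set \<Rightarrow> 'k hvec set \<times> ('k hvec \<Rightarrow> complex)" where
  "lform a = (\<lambda>L\<in>proj_points. (L, \<lambda>v\<in>L. \<Sum>l\<in>UNIV. a l * v $ l))"

lemma coord_section_lform: "coord_section j = lform (\<lambda>l. if l = j then 1 else 0)"
  by (simp add: coord_section_def lform_def if_distrib[of "\<lambda>x. x * _"] cong: if_cong)

text \<open>The quotient has degree 0 in the representative of the line, so the vector picked in
  \<open>hyperplane_metric\<close> may be replaced by \<open>v\<close>.\<close>

lemma metric_lform:
  assumes v: "v \<noteq> 0"
  shows "metric pspace (lform a (hline v)) (lform b (hline v)) =
    cnj (\<Sum>l\<in>UNIV. a l * v $ l) * (\<Sum>l\<in>UNIV. b l * v $ l) / complex_of_real ((norm v)\<^sup>2)"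
proof -
  define u where "u = (SOME u. u \<in> hline v \<and> u \<noteq> 0)"
  have u: "u \<in> hline v \<and> u \<noteq> 0" unfolding u_def by (rule someI[of _ v]) (use v in simp)
  then obtain c where c: "u = c *s v" "c \<noteq> 0" by (auto simp: mem_hline)
  have s: "(\<Sum>l\<in>UNIV. a l * u $ l) = c * (\<Sum>l\<in>UNIV. a l * v $ l)" for a
    by (simp add: c sum_distrib_left mult_ac)
  have n: "complex_of_real ((norm u)\<^sup>2) = cnj c * c * complex_of_real ((norm v)\<^sup>2)"
    by (simp add: c norm_cscale power_mult_distrib complex_norm_square mult_ac del: of_real_power)
  have "metric pspace (lform a (hline v)) (lform b (hline v)) =
    cnj (\<Sum>l\<in>UNIV. a l * u $ l) * (\<Sum>l\<in>UNIV. b l * u $ l) / complex_of_real ((norm u)\<^sup>2)"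
    using v u by (simp add: projective_space_simps hyperplane_metric_def lform_def hline_in_proj_points Let_def u_def[symmetric])
  also have "\<dots> = cnj (\<Sum>l\<in>UNIV. a l * v $ l) * (\<Sum>l\<in>UNIV. b l * v $ l) / complex_of_real ((norm v)\<^sup>2)"
    unfolding s n using c(2) by (simp add: mult_ac)
  finally show ?thesis .
qed

definition pmetric :: "'k::finite option \<Rightarrow> 'k option \<Rightarrow> 'k hvec set \<Rightarrow> complex" where
  "pmetric j k L = metric pspace (coord_section j L) (coord_section k L)"

lemma pmetric_hline: "v \<noteq> 0 \<Longrightarrow> pmetric j k (hline v) = cnj (v $ j) * v $ k / complex_of_real ((norm v)\<^sup>2)"
  by (simp add: pmetric_def coord_section_lform metric_lform if_distrib[of "\<lambda>x. x * _"] cong: if_cong)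

lemma pmetric_measurable: "pmetric j k \<in> borel_measurable (liouville_measure pspace)"
proof (rule borel_measurableI)
  fix S :: "complex set" assume S: "open S"
  let ?f = "\<lambda>v::'a hvec. cnj (v $ j) * v $ k / complex_of_real ((norm v)\<^sup>2)"
  let ?W = "pmetric j k -` S \<inter> proj_points"
  have "continuous_on (- {0}) ?f" by (intro continuous_intros) auto
  then have "open (?f -` S \<inter> - {0})" using S by (simp add: continuous_on_open_vimage open_Compl)
  moreover have "{v. v \<noteq> 0 \<and> hline v \<in> ?W} = ?f -` S \<inter> - {0}"
    by (auto simp: pmetric_hline hline_in_proj_points)
  ultimately have "openin (mtop pspace) ?W" by (simp add: projective_space_simps openin_proj_topology)
  then show "pmetric j k -` S \<inter> space (liouville_measure pspace) \<in> sets (liouville_measure pspace)"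
    unfolding space_liouville_pspace P.sets_liouville_measure by (rule P.open_in_borel_sets)
qed

lemma pmetric_integrable: "integrable (liouville_measure pspace) (pmetric j k)"
proof -
  interpret F: finite_measure "liouville_measure pspace" by (rule finite_measure_pspace)
  show ?thesis
  proof (rule F.integrable_const_bound[where B = 1])
    show "AE L in liouville_measure pspace. norm (pmetric j k L) \<le> 1"
    proof (rule AE_I2)
      fix L :: "'a hvec set" assume "L \<in> space (liouville_measure pspace)"
      then obtain v where v: "v \<noteq> 0" "L = hline v" unfolding space_liouville_pspace by (elim proj_points_cases)
      have "cmod (v $ j) * cmod (v $ k) \<le> norm v * norm v"
        by (intro mult_mono Finite_Cartesian_Product.norm_nth_le) auto
      then show "norm (pmetric j k L) \<le> 1"
        using v by (simp add: pmetric_hline norm_divide norm_mult power2_eq_square)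
    qed
  qed (rule pmetric_measurable)
qed

lemma (in unitary) integral_invariant:
  "(\<integral>L. pmetric j l (A ` L) \<partial>liouville_measure pspace) = (\<integral>L. pmetric j l L \<partial>liouville_measure pspace)"
proof -
  have m: "(`) A \<in> liouville_measure pspace \<rightarrow>\<^sub>M liouville_measure pspace"
    using measurable_image[OF liouville_manifold_projective_space]
    by (simp cong: measurable_cong_sets add: P.sets_liouville_measure)
  have "(\<integral>L. pmetric j l (A ` L) \<partial>liouville_measure pspace) =
      (\<integral>L. pmetric j l L \<partial>distr (liouville_measure pspace) (liouville_measure pspace) ((`) A))"
    by (rule integral_distr[OF m pmetric_measurable, symmetric])
  then show ?thesis unfolding distr_liouville_measure .
qed

lemma hinner_unitary_scale:
  assumes "\<And>l. cnj (c l) * c l = 1"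
  shows "hinner (\<chi> l. c l * u $ l) (\<chi> l. c l * v $ l) = hinner u v"
  unfolding hinner_def
proof (rule sum.cong[OF refl])
  fix l
  have "cnj (c l * u $ l) * (c l * v $ l) = (cnj (c l) * c l) * (cnj (u $ l) * v $ l)" by (simp add: mult_ac)
  then show "cnj ((\<chi> l. c l * u $ l) $ l) * (\<chi> l. c l * v $ l) $ l = cnj (u $ l) * v $ l" by (simp add: assms)
qed

lemma unitary_sign_flip:
  fixes j :: "'k::finite option"
  defines "A \<equiv> \<lambda>v :: 'k hvec. \<chi> l. (if l = j then - 1 else 1) * v $ l"
  shows "unitary A A"
proof
  show "hinner (A u) (A v) = hinner u v" for u v
    unfolding A_def by (rule hinner_unitary_scale) simp
qed (simp_all add: A_def vec_eq_iff algebra_simps)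

lemma unitary_swap:
  fixes j k :: "'k::finite option"
  defines "A \<equiv> \<lambda>v :: 'k hvec. \<chi> l. v $ Transposition.transpose j k l"
  shows "unitary A A"
proof
  show "hinner (A u) (A v) = hinner u v" for u v
    unfolding hinner_def A_def vec_lambda_beta
    by (rule sum.reindex_bij_betw[where h = "Transposition.transpose j k"]) (simp add: bij_swap_iff)
qed (simp_all add: A_def vec_eq_iff)

lemma pmetric_orthogonal:
  assumes "j \<noteq> k"
  shows "(\<integral>L. pmetric j k L \<partial>liouville_measure pspace) = 0"
proof -
  define A where "A = (\<lambda>v :: 'a hvec. \<chi> l. (if l = j then - 1 else 1) * v $ l)"
  interpret unitary A A unfolding A_def by (rule unitary_sign_flip)
  have "(\<integral>L. pmetric j k L \<partial>liouville_measure pspace) = (\<integral>L. pmetric j k (A ` L) \<partial>liouville_measure pspace)"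
    by (rule integral_invariant[symmetric])
  also have "\<dots> = (\<integral>L. - pmetric j k L \<partial>liouville_measure pspace)"
  proof (rule Bochner_Integration.integral_cong[OF refl])
    fix L :: "'a hvec set" assume "L \<in> space (liouville_measure pspace)"
    then obtain v where v: "v \<noteq> 0" "L = hline v" unfolding space_liouville_pspace by (elim proj_points_cases)
    have "hinner (A v) (A v) = hinner v v" by (rule inner)
    then have n: "complex_of_real ((norm (A v))\<^sup>2) = complex_of_real ((norm v)\<^sup>2)" by (simp only: hinner_self)
    show "pmetric j k (A ` L) = - pmetric j k L"
      unfolding v(2) image_hline pmetric_hline[OF nonzero[OF v(1)]] pmetric_hline[OF v(1)] n
      using assms by (simp add: A_def)
  qed
  also have "\<dots> = - (\<integral>L. pmetric j k L \<partial>liouville_measure pspace)" by simp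
  finally show ?thesis by (simp add: eq_neg_iff_add_eq_0 flip: mult_2)
qed

lemma pmetric_diag:
  fixes j k :: "'k::finite option"
  shows "(\<integral>L. pmetric j j L \<partial>liouville_measure pspace) = (\<integral>L. pmetric k k L \<partial>liouville_measure pspace)"
proof -
  define A where "A = (\<lambda>v :: 'k hvec. \<chi> l. v $ Transposition.transpose j k l)"
  interpret unitary A A unfolding A_def by (rule unitary_swap)
  have "(\<integral>L. pmetric j j L \<partial>liouville_measure pspace) = (\<integral>L. pmetric j j (A ` L) \<partial>liouville_measure pspace)"
    by (rule integral_invariant[symmetric])
  also have "\<dots> = (\<integral>L. pmetric k k L \<partial>liouville_measure pspace)"
  proof (rule Bochner_Integration.integral_cong[OF refl])
    fix L :: "'k hvec set" assume "L \<in> space (liouville_measure pspace)"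
    then obtain v where v: "v \<noteq> 0" "L = hline v" unfolding space_liouville_pspace by (elim proj_points_cases)
    have "hinner (A v) (A v) = hinner v v" by (rule inner)
    then have n: "complex_of_real ((norm (A v))\<^sup>2) = complex_of_real ((norm v)\<^sup>2)" by (simp only: hinner_self)
    show "pmetric j j (A ` L) = pmetric k k L"
      unfolding v(2) image_hline pmetric_hline[OF nonzero[OF v(1)]] pmetric_hline[OF v(1)] n
      by (simp add: A_def)
  qed
  finally show ?thesis .
qed

text \<open>The common squared norm of the coordinate sections; it is not 1, but it cancels in all
  normalised quantities.\<close>

definition coord_norm2 :: "'k::finite itself \<Rightarrow> real" where
  "coord_norm2 _ = measure (liouville_measure pspace) (proj_points :: 'k hvec set set) / real CARD('k option)"

lemma coord_norm2_pos: "0 < coord_norm2 TYPE('k::finite)"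
  unfolding coord_norm2_def using measure_pspace_pos by (intro divide_pos_pos) auto

text \<open>At every point the squared lengths of the coordinate sections add up to 1. Their
  integrals, all equal by symmetry, therefore add up to the total mass, and each is the mass divided
  by the number of coordinates.\<close>

lemma sec_inner_coord_section:
  fixes j k :: "'k::finite option"
  shows "sec_inner pspace (coord_section j) (coord_section k) = (if j = k then complex_of_real (coord_norm2 TYPE('k)) else 0)"
proof (cases "j = k")
  case False
  then show ?thesis using pmetric_orthogonal[OF False] by (simp add: sec_inner_def pmetric_def)
next
  case True
  let ?L = "liouville_measure (pspace :: 'k projective_data)"
  have "(\<Sum>l::'k option\<in>UNIV. \<integral>L. pmetric l l L \<partial>?L) = (\<integral>L. (\<Sum>l\<in>UNIV. pmetric l l L) \<partial>?L)"
    by (rule Bochner_Integration.integral_sum[symmetric]) (rule pmetric_integrable)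
  also have "\<dots> = (\<integral>L. 1 \<partial>?L)"
  proof (rule Bochner_Integration.integral_cong[OF refl])
    fix L assume "L \<in> space ?L"
    then obtain v where v: "v \<noteq> 0" "L = hline v" unfolding space_liouville_pspace by (elim proj_points_cases)
    have "(\<Sum>l\<in>UNIV. pmetric l l L) = hinner v v / complex_of_real ((norm v)\<^sup>2)"
      unfolding v(2) pmetric_hline[OF v(1)] hinner_def by (rule sum_divide_distrib[symmetric])
    also have "\<dots> = 1" using v(1) by (simp add: hinner_self)
    finally show "(\<Sum>l\<in>UNIV. pmetric l l L) = 1" .
  qed
  also have "\<dots> = complex_of_real (measure ?L proj_points)"
    by (simp add: space_liouville_pspace scaleR_conv_of_real)
  finally have "(\<Sum>l::'k option\<in>UNIV. \<integral>L. pmetric j j L \<partial>?L) = complex_of_real (measure ?L proj_points)"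
    using pmetric_diag[of _ j] by (metis (no_types, lifting) sum.cong)
  then have "of_nat CARD('k option) * (\<integral>L. pmetric j j L \<partial>?L) = complex_of_real (measure ?L proj_points)"
    by (simp only: sum_constant)
  then have "(\<integral>L. pmetric j j L \<partial>?L) = complex_of_real (coord_norm2 TYPE('k))"
    by (simp add: coord_norm2_def field_simps del: card_option)
  then show ?thesis using True by (simp add: sec_inner_def pmetric_def)
qed

lemma sec_inner_lform:
  fixes a b :: "'k::finite option \<Rightarrow> complex"
  shows "sec_inner pspace (lform a) (lform b) = complex_of_real (coord_norm2 TYPE('k)) * (\<Sum>j\<in>UNIV. cnj (a j) * b j)"
proof -
  have "sec_inner pspace (lform a) (lform b) =
     (\<integral>L. (\<Sum>j\<in>UNIV. \<Sum>l\<in>UNIV. (cnj (a j) * b l) * pmetric j l L) \<partial>liouville_measure pspace)"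
    unfolding sec_inner_def
  proof (rule Bochner_Integration.integral_cong[OF refl])
    fix L :: "'k hvec set" assume "L \<in> space (liouville_measure pspace)"
    then obtain v where v: "v \<noteq> 0" "L = hline v" unfolding space_liouville_pspace by (elim proj_points_cases)
    show "metric pspace (lform a L) (lform b L) = (\<Sum>j\<in>UNIV. \<Sum>l\<in>UNIV. (cnj (a j) * b l) * pmetric j l L)"
      unfolding v(2) metric_lform[OF v(1)] pmetric_hline[OF v(1)] cnj_sum sum_product sum_divide_distrib
      by (intro sum.cong refl) (simp add: mult_ac)
  qed
  also have "\<dots> = (\<Sum>j\<in>UNIV. \<Sum>l\<in>UNIV. (cnj (a j) * b l) * sec_inner pspace (coord_section j) (coord_section l))"
    unfolding sec_inner_def pmetric_def[symmetric]
    by (simp add: pmetric_integrable Bochner_Integration.integral_sum Bochner_Integration.integrable_sum)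
  also have "\<dots> = complex_of_real (coord_norm2 TYPE('k)) * (\<Sum>j\<in>UNIV. cnj (a j) * b j)"
    by (simp add: sec_inner_coord_section if_distrib[of "\<lambda>x. _ * x"] sum_distrib_left mult_ac cong: if_cong)
  finally show ?thesis .
qed

section \<open>Sections of the hyperplane bundle\<close>

lemma hline_add: assumes "u \<in> hline w" "v \<in> hline w" shows "u + v \<in> hline w"
proof -
  obtain a b where "u = a *s w" "v = b *s w" using assms by (auto simp: mem_hline)
  then have "u + v = (a + b) *s w" by (simp add: vec_eq_iff algebra_simps)
  then show ?thesis unfolding mem_hline by blast
qed

lemma hline_cscale: assumes "u \<in> hline w" shows "c *s u \<in> hline w"
proof -
  obtain a where "u = a *s w" using assms by (auto simp: mem_hline)
  then have "c *s u = (c * a) *s w" by simp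
  then show ?thesis unfolding mem_hline by blast
qed

lemma fibre_pspace:
  "q \<in> fibre pspace L \<longleftrightarrow> L \<in> proj_points \<and> fst q = L \<and> snd q \<in> extensional L \<and>
     (\<forall>u\<in>L. \<forall>v\<in>L. snd q (u + v) = snd q u + snd q v) \<and> (\<forall>c. \<forall>v\<in>L. snd q (c *s v) = c * snd q v)"
  by (cases q) (auto simp: fibre_def projective_space_def)

lemma fibre_pspace_scale:
  assumes "q \<in> fibre pspace L" "u \<in> L"
  shows "snd q (c *s u) = c * snd q u"
  using assms by (simp add: fibre_pspace)

lemma fibre_pspace_eqI:
  assumes q: "q \<in> fibre pspace (hline v)" and q': "q' \<in> fibre pspace (hline v)" and eq: "snd q v = snd q' v"
  shows "q = q'"
proof (rule prod_eqI)
  show "fst q = fst q'" using q q' by (simp add: fibre_pspace)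
  show "snd q = snd q'"
  proof (rule extensionalityI[where A = "hline v"])
    fix u assume "u \<in> hline v"
    then obtain c where "u = c *s v" by (auto simp: mem_hline)
    then show "snd q u = snd q' u"
      using fibre_pspace_scale[OF q self_in_hline] fibre_pspace_scale[OF q' self_in_hline] eq by simp
  qed (use q q' in \<open>simp_all add: fibre_pspace\<close>)
qed

lemma bzero_pspace: "L \<in> proj_points \<Longrightarrow> bzero pspace L \<in> fibre pspace L \<and> (v \<in> L \<longrightarrow> snd (bzero pspace L) v = 0)"
proof (elim proj_points_cases, hypsubst)
  fix w :: "'a hvec" assume "w \<noteq> 0"
  then show "bzero pspace (hline w) \<in> fibre pspace (hline w) \<and> (v \<in> hline w \<longrightarrow> snd (bzero pspace (hline w)) v = 0)"
    by (simp add: fibre_pspace projective_space_simps hline_in_proj_points hline_add hline_cscale)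
qed

lemma nonzero_fibre_pspace:
  assumes v: "v \<noteq> 0"
  shows "q \<in> nonzero_fibre pspace (hline v) \<longleftrightarrow> q \<in> fibre pspace (hline v) \<and> snd q v \<noteq> 0"
  using bzero_pspace[OF hline_in_proj_points[OF v], of v] fibre_pspace_eqI[of q v "bzero pspace (hline v)"]
  by (auto simp: nonzero_fibre_def)

lemma qhat_pspace:
  assumes v: "v \<noteq> 0" and q: "q \<in> nonzero_fibre pspace (hline v)" and \<phi>: "\<phi> (hline v) \<in> fibre pspace (hline v)"
  shows "qhat pspace q \<phi> = snd (\<phi> (hline v)) v / snd q v"
proof -
  have q': "q \<in> fibre pspace (hline v)" "snd q v \<noteq> 0" using q nonzero_fibre_pspace[OF v] by auto
  have p: "proj pspace q = hline v" using q'(1) by (simp add: fibre_def)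
  have s: "bscale pspace c q = (hline v, \<lambda>u\<in>hline v. c * snd q u)" for c
    using q'(1) by (simp add: projective_space_simps case_prod_beta fibre_pspace)
  have f: "bscale pspace c q \<in> fibre pspace (hline v)" for c
    using q'(1) by (simp add: s fibre_pspace hline_add hline_cscale algebra_simps)
  have "\<phi> (hline v) = bscale pspace c q \<longleftrightarrow> snd (\<phi> (hline v)) v = c * snd q v" for c
    using fibre_pspace_eqI[OF \<phi> f[of c]] by (auto simp: s)
  note iff = this
  show ?thesis unfolding qhat_def p by (rule the_equality) (use q'(2) in \<open>auto simp: iff\<close>)
qed

lemma lform_hline: "v \<noteq> 0 \<Longrightarrow> u \<in> hline v \<Longrightarrow> snd (lform a (hline v)) u = (\<Sum>l\<in>UNIV. a l * u $ l)"
  by (simp add: lform_def hline_in_proj_points)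

lemma lform_fibre:
  assumes "L \<in> proj_points" shows "lform a L \<in> fibre pspace L"
  using assms
proof (elim proj_points_cases, hypsubst)
  fix v :: "'a hvec" assume v: "v \<noteq> 0"
  show "lform a (hline v) \<in> fibre pspace (hline v)"
    using v by (simp add: fibre_pspace lform_def hline_in_proj_points hline_add hline_cscale distrib_left sum.distrib sum_distrib_left mult_ac)
qed

text \<open>In the chart \<open>i\<close> and the trivialisation \<open>j\<close>, a linear form is a quotient of affine functions.\<close>

lemma lform_hol: "lform a \<in> hol_sections pspace"
  unfolding hol_sections_def
proof (intro CollectI conjI ballI)
  show "lform a \<in> extensional (points pspace)" by (simp add: points_projective_space lform_def)
  show "lform a L \<in> fibre pspace L" if "L \<in> points pspace" for L
    using that lform_fibre by (simp add: points_projective_space)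
  fix Ut assume "Ut \<in> trivs (pspace :: 'a projective_data)"
  then obtain j :: "'a option" where Ut: "Ut = (affine_domain j, \<lambda>(L, f). f (normalized_rep j L))"
    by (auto simp: projective_space_simps)
  show "case Ut of (U, \<tau>) \<Rightarrow> \<forall>(V, z)\<in>atlas pspace. mv_holomorphic_on (z ` (U \<inter> V)) (\<lambda>p. \<tau> (lform a (inv_into V z p)))"
    unfolding Ut split_conv
  proof (intro ballI)
    fix Vz :: "('a hvec set, 'a) chart" assume "Vz \<in> atlas pspace"
    then obtain i where Vz: "Vz = (affine_domain i, affine_coord i)" by (auto simp: projective_space_simps)
    have "mv_holomorphic_on (affine_coord i ` (affine_domain j \<inter> affine_domain i))
       (\<lambda>p. case lform a (hline (emb i p)) of (L, f) \<Rightarrow> f (normalized_rep j L))"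
      unfolding mv_holomorphic_on_def
    proof
      fix w assume "w \<in> affine_coord i ` (affine_domain j \<inter> affine_domain i)"
      then have "hline (emb i w) \<in> affine_domain j" using hline_emb_affine_coord by fastforce
      then have wj: "emb i w $ j \<noteq> 0" by (simp add: hline_affine_domain)
      define N where "N p = (\<Sum>l\<in>UNIV. a l * p $ l)" for p :: "'a hvec"
      have dn: "((\<lambda>p. emb i p $ l) has_derivative (\<lambda>u. emb0 i u $ l)) (at w)" for l
        by (rule bounded_linear.has_derivative[OF bounded_linear_vec_nth has_derivative_emb])
      have dN: "((\<lambda>p. N (emb i p)) has_derivative (\<lambda>u. N (emb0 i u))) (at w)"
        unfolding N_def by (intro has_derivative_sum has_derivative_mult_right dn)
      define D where "D u = (N (emb0 i u) * emb i w $ j - N (emb i w) * emb0 i u $ j) / (emb i w $ j * emb i w $ j)" for u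
      have "((\<lambda>p. N (emb i p) / emb i p $ j) has_derivative D) (at w)"
        unfolding D_def by (rule has_derivative_divide'[OF dN dn wj])
      moreover have "open {p. emb i p $ j \<noteq> 0}"
        by (intro open_Collect_neq continuous_intros continuous_emb)
      moreover have "N (emb i p) / emb i p $ j = (case lform a (hline (emb i p)) of (L, f) \<Rightarrow> f (normalized_rep j L))"
        if "p \<in> {p. emb i p $ j \<noteq> 0}" for p
      proof -
        have "(1 / emb i p $ j) *s emb i p \<in> hline (emb i p)" unfolding mem_hline by blast
        then show ?thesis using that
          by (simp add: lform_def hline_in_proj_points normalized_rep_hline N_def sum_divide_distrib mult_ac)
      qed
      ultimately have "((\<lambda>p. case lform a (hline (emb i p)) of (L, f) \<Rightarrow> f (normalized_rep j L)) has_derivative D) (at w)"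
        using has_derivative_transform_within_open[of "\<lambda>p. N (emb i p) / emb i p $ j" D w UNIV "{p. emb i p $ j \<noteq> 0}"] wj by simp
      moreover have "D (c *s v) = c * D v" for c v
        by (simp add: D_def emb0_scale N_def sum_distrib_left algebra_simps diff_divide_distrib)
      ultimately show "\<exists>f'. ((\<lambda>p. case lform a (hline (emb i p)) of (L, f) \<Rightarrow> f (normalized_rep j L)) has_derivative f') (at w) \<and>
          (\<forall>c v. f' (c *s v) = c * f' v)" by blast
    qed
    then show "case Vz of (V, z) \<Rightarrow> mv_holomorphic_on (z ` (affine_domain j \<inter> V))
        (\<lambda>p. case lform a (inv_into V z p) of (L, f) \<Rightarrow> f (normalized_rep j L))"
      by (simp add: Vz inv_affine_coord)
  qed
qed

text \<open>A holomorphic section defines a function \<open>F\<close>, homogeneous of degree one, off the origin. For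
  independent \<open>u\<close> and \<open>v\<close> the entire function \<open>F (v + c u)\<close> of \<open>c\<close> grows linearly with
  \<open>F (v + c u) / c\<close> tending to \<open>F u\<close>, hence equals \<open>F v + c F u\<close>.\<close>

lemma hol_section_homogeneous:
  assumes t: "t \<in> hol_sections (pspace :: 'k::finite projective_data)"
  defines "F \<equiv> \<lambda>v :: 'k hvec. snd (t (hline v)) v"
  shows "v \<noteq> 0 \<Longrightarrow> c \<noteq> 0 \<Longrightarrow> F (c *s v) = c * F v" and "mv_holomorphic_on (- {0}) F"
proof -
  have fib: "t (hline v) \<in> fibre pspace (hline v)" if "v \<noteq> 0" for v
    using t that by (simp add: hol_sections_def points_projective_space hline_in_proj_points)
  have hom: "F (c *s v) = c * F v" if "v \<noteq> 0" "c \<noteq> 0" for c v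
    using fibre_pspace_scale[OF fib[OF that(1)] self_in_hline] that by (simp add: F_def hline_scale)
  then show "v \<noteq> 0 \<Longrightarrow> c \<noteq> 0 \<Longrightarrow> F (c *s v) = c * F v" .
  show "mv_holomorphic_on (- {0}) F"
    unfolding mv_holomorphic_on_def
  proof
    fix v :: "'k hvec" assume "v \<in> - {0}"
    then obtain j where j: "v $ j \<noteq> 0" by (auto simp: vec_eq_iff)
    have "mv_holomorphic_on (affine_coord j ` (affine_domain j \<inter> affine_domain j))
        (\<lambda>p. case t (inv_into (affine_domain j) (affine_coord j) p) of (L, f) \<Rightarrow> f (normalized_rep j L))"
    proof -
      have h: "\<forall>(U, \<tau>)\<in>trivs pspace. \<forall>(V, z)\<in>atlas pspace.
          mv_holomorphic_on (z ` (U \<inter> V)) (\<lambda>p. \<tau> (t (inv_into V z p)))"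
        using t by (simp add: hol_sections_def)
      have m: "(affine_domain j, \<lambda>(L, f). f (normalized_rep j L)) \<in> trivs pspace"
        "(affine_domain j, affine_coord j) \<in> atlas pspace"
        by (simp_all add: projective_space_simps)
      show ?thesis using bspec[OF bspec[OF h m(1), unfolded split_conv] m(2), unfolded split_conv] .
    qed
    moreover have "(case t (hline (emb j w)) of (L, f) \<Rightarrow> f (normalized_rep j L)) = F (emb j w)" for w
    proof -
      have "fst (t (hline (emb j w))) = hline (emb j w)" using fib[of "emb j w"] by (simp add: fibre_pspace)
      then show ?thesis by (simp add: F_def case_prod_beta normalized_rep_hline)
    qed
    ultimately have "mv_holomorphic_on UNIV (\<lambda>w. F (emb j w))"
      by (simp add: affine_coord_image inv_affine_coord)
    then obtain f' where f': "((\<lambda>w. F (emb j w)) has_derivative f') (at (\<chi> a. v $ slot j a / v $ j))"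
      "\<And>c u. f' (c *s u) = c * f' u"
      unfolding mv_holomorphic_on_def by blast
    \<comment> \<open>The affine coordinates of \<open>x\<close>. By homogeneity
      \<open>F x = x $ j * F (emb j (P x))\<close> wherever \<open>x $ j \<noteq> 0\<close>, which
      carries holomorphy from the affine slice to a neighbourhood of \<open>v\<close>.\<close>
    define P where "P x = (\<chi> a. x $ slot j a / x $ j)" for x :: "'k hvec"
    define P' where "P' u = (\<chi> a. (u $ slot j a * v $ j - v $ slot j a * u $ j) / (v $ j * v $ j))" for u
    have dn: "((\<lambda>x. x $ l) has_derivative (\<lambda>u. u $ l)) (at v)" for l :: "'k option"
      by (rule bounded_linear_imp_has_derivative[OF bounded_linear_vec_nth])
    have "((\<lambda>x. P x $ a) has_derivative (\<lambda>u. (u $ slot j a * v $ j - v $ slot j a * u $ j) / (v $ j * v $ j))) (at v)" for a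
      unfolding P_def vec_lambda_beta by (rule has_derivative_divide'[OF dn dn j])
    from has_derivative_vec_lambda[OF this] have dP: "(P has_derivative P') (at v)"
      by (rule has_derivative_eq_rhs) (simp add: P'_def fun_eq_iff)
    have "((\<lambda>x. F (emb j (P x))) has_derivative (\<lambda>u. f' (P' u))) (at v)"
      using has_derivative_compose[OF dP, of "\<lambda>w. F (emb j w)" f'] f'(1) by (simp add: P_def)
    from has_derivative_mult[OF dn this, of j]
    have "((\<lambda>x. x $ j * F (emb j (P x))) has_derivative (\<lambda>u. v $ j * f' (P' u) + u $ j * F (emb j (P v)))) (at v)" .
    then have "(F has_derivative (\<lambda>u. v $ j * f' (P' u) + u $ j * F (emb j (P v)))) (at v)"
    proof (rule has_derivative_transform_within_open)
      show "open {x :: 'k hvec. x $ j \<noteq> 0}" by (rule open_nth_nonzero)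
      fix x :: "'k hvec" assume "x \<in> {x. x $ j \<noteq> 0}"
      then have x: "x $ j \<noteq> 0" by simp
      have "x = x $ j *s emb j (P x)" by (rule vec_eq_slotI[of _ j]) (use x in \<open>simp_all add: P_def\<close>)
      then show "x $ j * F (emb j (P x)) = F x" using hom[OF emb_nonzero x, of j "P x"] by simp
    qed (use j in simp)
    moreover have "P' (c *s u) = c *s P' u" for c u by (simp add: P'_def vec_eq_iff algebra_simps diff_divide_distrib)
    then have "v $ j * f' (P' (c *s u)) + (c *s u) $ j * F (emb j (P v)) = c * (v $ j * f' (P' u) + u $ j * F (emb j (P v)))" for c u
      by (simp add: f'(2) algebra_simps)
    ultimately show "\<exists>f'. (F has_derivative f') (at v) \<and> (\<forall>c u. f' (c *s u) = c * f' u)"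
      by blast
  qed
qed

lemma homogeneous_holomorphic_additive:
  fixes F :: "complex^'j::finite \<Rightarrow> complex"
  assumes hom: "\<And>c v. v \<noteq> 0 \<Longrightarrow> c \<noteq> 0 \<Longrightarrow> F (c *s v) = c * F v" and hol: "mv_holomorphic_on (- {0}) F"
    and u: "u \<noteq> 0" and indep: "\<And>c. v + c *s u \<noteq> 0"
  shows "F (v + u) = F v + F u"
proof -
  define G where "G c = F (v + c *s u)" for c
  have "G field_differentiable (at c)" for c
  proof -
    obtain f' where f': "(F has_derivative f') (at (v + c *s u))" "\<And>c v. f' (c *s v) = c * f' v"
      using hol indep[of c] unfolding mv_holomorphic_on_def by blast
    have "((\<lambda>c. (v + c *s u) $ l) has_derivative (\<lambda>h. h * u $ l)) (at c)" for l
      by (auto intro!: derivative_eq_intros)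
    from has_derivative_vec_lambda[OF this] have "((\<lambda>c. v + c *s u) has_derivative (\<lambda>h. h *s u)) (at c)"
      by (rule has_derivative_eq_rhs) (simp add: fun_eq_iff vec_eq_iff)
    from has_derivative_compose[OF this f'(1)] have "(G has_derivative (\<lambda>h. f' u * h)) (at c)"
      unfolding G_def f'(2) by (simp add: mult.commute)
    then show ?thesis unfolding field_differentiable_def has_field_derivative_def by blast
  qed
  then have Ghol: "G holomorphic_on UNIV" by (simp add: holomorphic_on_def)
  have "isCont F u"
    using hol u unfolding mv_holomorphic_on_def by (auto dest: has_derivative_continuous)
  moreover have "((\<lambda>c. u + (1 / c) *s v) \<longlongrightarrow> u + 0 *s v) at_infinity"
  proof (rule vec_tendstoI)
    fix l
    have inv0: "((\<lambda>c::complex. 1 / c) \<longlongrightarrow> 0) at_infinity" by (intro tendsto_divide_0[OF tendsto_const] filterlim_ident)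
    then show "((\<lambda>c. (u + (1 / c) *s v) $ l) \<longlongrightarrow> (u + 0 *s v) $ l) at_infinity"
      using tendsto_add[OF tendsto_const tendsto_mult_right[OF inv0], of "u $ l" "v $ l"] by simp
  qed
  ultimately have "((\<lambda>c. F (u + (1 / c) *s v)) \<longlongrightarrow> F u) at_infinity"
    using isCont_tendsto_compose by fastforce
  \<comment> \<open>Homogeneity translates the behaviour of \<open>G\<close> at infinity into
    continuity of \<open>F\<close> at \<open>u\<close>, where \<open>F\<close> is holomorphic
    because \<open>u \<noteq> 0\<close>.\<close>
  moreover have "F (u + (1 / c) *s v) = G c / c" if "c \<noteq> 0" for c
  proof -
    have "c *s (u + (1 / c) *s v) = v + c *s u" using that by (simp add: vec_eq_iff field_simps)
    moreover from this have "u + (1 / c) *s v \<noteq> 0" using indep[of c] by (metis vector_smult_rzero)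
    ultimately show ?thesis using hom[of "u + (1 / c) *s v" c] that by (simp add: G_def add.commute)
  qed
  moreover have ev: "eventually (\<lambda>c::complex. c \<noteq> 0) at_infinity"
    unfolding eventually_at_infinity by (rule exI[of _ 1]) auto
  ultimately have lim: "((\<lambda>c. G c / c) \<longlongrightarrow> F u) at_infinity"
    by (elim Lim_transform_eventually) (auto elim: eventually_mono)
  then have "eventually (\<lambda>c. dist (G c / c) (F u) < 1) at_infinity" by (rule tendstoD) simp
  then obtain R where R: "\<And>c. R \<le> norm c \<Longrightarrow> dist (G c / c) (F u) < 1"
    unfolding eventually_at_infinity by blast
  have "norm (G c) \<le> (norm (F u) + 1) * norm c ^ 1" if "max R 1 \<le> norm c" for c
  proof -
    have "norm (G c / c) \<le> norm (F u) + 1"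
      using R[of c] that norm_triangle_sub[of "G c / c" "F u"] by (simp add: dist_norm)
    moreover have "0 < norm c" using that by linarith
    ultimately show ?thesis by (simp add: norm_divide field_simps)
  qed
  then have poly: "G c = (\<Sum>k\<le>1. (deriv ^^ k) G 0 / fact k * c ^ k)" for c
    by (rule Liouville_polynomial[OF Ghol, of "max R 1"])
  have lin: "G c = G 0 + deriv G 0 * c" for c using poly[of c] by simp
  \<comment> \<open>Division by \<open>c\<close> isolates the slope of the affine function
    \<open>G\<close> as its limit at infinity, already known to be \<open>F u\<close>. Additivity is
    then the value at \<open>c = 1\<close>.\<close>
  have "((\<lambda>c::complex. G 0 * (1 / c) + deriv G 0) \<longlongrightarrow> G 0 * 0 + deriv G 0) at_infinity"
    by (intro tendsto_intros tendsto_divide_0[OF tendsto_const] filterlim_ident)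
  moreover have "eventually (\<lambda>c. G 0 * (1 / c) + deriv G 0 = G c / c) at_infinity"
    using ev
  proof eventually_elim
    case (elim c)
    then show ?case by (subst lin[of c]) (simp add: field_simps)
  qed
  ultimately have "((\<lambda>c. G c / c) \<longlongrightarrow> deriv G 0) at_infinity"
    using Lim_transform_eventually by fastforce
  with lim have "deriv G 0 = F u" using tendsto_unique[OF trivial_limit_at_infinity] by blast
  then show ?thesis using lin[of 1] by (simp add: G_def)
qed

text \<open>Extended by 0 at the origin, the homogeneous function of the section is linear:
  dependent pairs of vectors are settled by homogeneity, independent ones by
  \<open>homogeneous_holomorphic_additive\<close>. Its values on the coordinate axes are the
  coefficients.\<close>

lemma hol_section_lform:
  assumes t: "t \<in> hol_sections (pspace :: 'k::finite projective_data)"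
  shows "\<exists>a. t = lform a"
proof -
  define F where "F v = snd (t (hline v)) v" for v :: "'k hvec"
  note hom = hol_section_homogeneous(1)[OF t, folded F_def]
  note hol = hol_section_homogeneous(2)[OF t, folded F_def]
  define F0 where "F0 v = (if v = 0 then 0 else F v)" for v
  have sc: "F0 (c *s v) = c * F0 v" for c v
    by (cases "c = 0"; cases "v = 0") (simp_all add: F0_def hom)
  have ad: "F0 (v + u) = F0 v + F0 u" for u v
  proof (cases "u = 0")
    case False
    show ?thesis
    proof (cases "\<exists>c. v + c *s u = 0")
      case True
      then obtain c where "v + c *s u = 0" by blast
      then have v: "v = (- c) *s u" by (simp add: vec_eq_iff eq_neg_iff_add_eq_0)
      have "v + u = (1 - c) *s u" by (simp add: v vec_eq_iff algebra_simps)
      then show ?thesis by (simp only: v sc) (simp add: algebra_simps)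
    next
      case ind: False
      have "v \<noteq> 0" using ind by (metis add_0 vector_smult_lzero)
      moreover have "v + u \<noteq> 0" using ind by (metis vector_smult_lid)
      ultimately show ?thesis
        using homogeneous_holomorphic_additive[of F u v, OF hom hol False] ind False by (auto simp: F0_def)
    qed
  qed (simp add: F0_def)
  have sum: "F0 (\<Sum>l\<in>S. f l) = (\<Sum>l\<in>S. F0 (f l))" if "finite S" for S and f :: "'k option \<Rightarrow> 'k hvec"
    using that by induction (simp_all add: ad, simp add: F0_def)
  have F0: "F0 v = (\<Sum>l\<in>UNIV. F0 (axis l 1) * v $ l)" for v
    by (subst basis_expansion[of v, symmetric]) (simp add: sum sc mult.commute)
  define a where "a l = F0 (axis l 1)" for l
  have "t L = lform a L" for L
  proof (cases "L \<in> proj_points")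
    case False
    then show ?thesis using t by (simp add: hol_sections_def points_projective_space extensional_def lform_def)
  next
    case True
    then obtain v where v: "v \<noteq> 0" "L = hline v" by (elim proj_points_cases)
    have "t L \<in> fibre pspace L" using t True by (simp add: hol_sections_def points_projective_space)
    moreover have "lform a L \<in> fibre pspace L" by (rule lform_fibre[OF True])
    moreover have "snd (t L) v = snd (lform a L) v"
      using F0[of v] v by (simp add: lform_hline F0_def F_def a_def)
    ultimately show ?thesis using fibre_pspace_eqI v(2) by blast
  qed
  then show ?thesis by blast
qed

lemma section_frame_pspace:
  "section_frame pspace (coord_section :: 'k::finite option \<Rightarrow> _) (coord_norm2 TYPE('k)) lform"
proof (unfold_locales)
  fix L :: "'k hvec set" and q and a :: "'k option \<Rightarrow> complex"
  assume L: "L \<in> points pspace" and q: "q \<in> nonzero_fibre pspace L"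
  obtain v where v: "v \<noteq> 0" "L = hline v" using L unfolding points_projective_space by (elim proj_points_cases)
  have f: "lform b (hline v) \<in> fibre pspace (hline v)" for b :: "'k option \<Rightarrow> complex"
    using v by (intro lform_fibre hline_in_proj_points)
  show "qhat pspace q (lform a) = (\<Sum>j\<in>UNIV. a j * qhat pspace q (coord_section j))"
    unfolding coord_section_lform qhat_pspace[where \<phi> = "lform b" for b, OF v(1) q[unfolded v(2)] f] lform_hline[OF v(1) self_in_hline]
    by (simp add: sum_divide_distrib if_distrib[of "\<lambda>x. x * _"] cong: if_cong)
qed (use coord_norm2_pos lform_hol hol_section_lform sec_inner_lform in auto)

section \<open>The coherent state embedding\<close>

lemma coord_section_fibre: "L \<in> proj_points \<Longrightarrow> coord_section j L \<in> fibre pspace L"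
  unfolding coord_section_lform by (rule lform_fibre)

lemma coord_section_value: "v \<noteq> 0 \<Longrightarrow> u \<in> hline v \<Longrightarrow> snd (coord_section j (hline v)) u = u $ j"
  by (simp add: coord_section_def hline_in_proj_points)

text \<open>This is the one vector of the line on which the linear form \<open>q\<close> takes the
  value 1.\<close>

lemma hcoord_pspace:
  assumes v: "v \<noteq> 0" and q: "q \<in> nonzero_fibre pspace (hline v)"
  shows "hcoord pspace coord_section q = (1 / snd q v) *s v"
  using coord_section_fibre[OF hline_in_proj_points[OF v]]
  by (simp add: hcoord_def vec_eq_iff qhat_pspace[OF v q] coord_section_value[OF v self_in_hline])

lemma psi_pspace:
  assumes u: "u \<noteq> 0" and v: "v \<noteq> 0"
  shows "psi pspace (hline u) (hline v) = (cmod (hinner v u))\<^sup>2 / ((norm u)\<^sup>2 * (norm v)\<^sup>2)"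
proof -
  have ex: "\<exists>q. q \<in> nonzero_fibre pspace (hline w)" if w: "w \<noteq> 0" for w :: "'a hvec"
  proof -
    obtain j where "w $ j \<noteq> 0" using w by (auto simp: vec_eq_iff)
    then show ?thesis
      using coord_section_fibre[OF hline_in_proj_points[OF w]] coord_section_value[OF w self_in_hline]
      by (intro exI[of _ "coord_section j (hline w)"]) (simp add: nonzero_fibre_pspace[OF w])
  qed
  have resc: "\<exists>c. c \<noteq> 0 \<and> hcoord pspace coord_section q' = c *s hcoord pspace coord_section q"
    if w: "w \<noteq> 0" and q: "q \<in> nonzero_fibre pspace (hline w)" "q' \<in> nonzero_fibre pspace (hline w)" for w :: "'a hvec" and q q'
    using q nonzero_fibre_pspace[OF w]
    by (intro exI[of _ "snd q w / snd q' w"]) (simp add: hcoord_pspace[OF w])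
  obtain q q' where q: "q \<in> nonzero_fibre pspace (hline u)" "q' \<in> nonzero_fibre pspace (hline v)"
    using ex u v by blast
  have "psi pspace (hline u) (hline v) = (cmod (hinner (hcoord pspace coord_section q') (hcoord pspace coord_section q)))\<^sup>2 /
      ((norm (hcoord pspace coord_section q))\<^sup>2 * (norm (hcoord pspace coord_section q'))\<^sup>2)"
    by (rule section_frame.psi_eq[OF section_frame_pspace])
      (use u v q resc in \<open>auto simp: points_projective_space hline_in_proj_points\<close>)
  also have "\<dots> = (cmod (hinner v u))\<^sup>2 / ((norm u)\<^sup>2 * (norm v)\<^sup>2)"
    unfolding hcoord_pspace[OF u q(1)] hcoord_pspace[OF v q(2)]
    using q nonzero_fibre_pspace[OF u] nonzero_fibre_pspace[OF v] by (intro ratio_cscale) auto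
  finally show ?thesis .
qed

locale ample_sections = quantum_sections Q s
  for Q :: "('m, 'n::finite, 'l) line_bundle_data" and s :: "'k::finite option \<Rightarrow> 'm \<Rightarrow> 'l" +
  assumes ample: "very_ample TYPE('k) Q"
begin

text \<open>Very ampleness speaks of some basis \<open>b\<close>, not of \<open>s\<close>. At a
  common zero of the \<open>s j\<close> all sections vanish, in particular the \<open>b j\<close>;
  the map given by \<open>b\<close> would then take the value \<open>{0}\<close> there, which is not
  a point of projective space.\<close>

lemma hcoord_nonzero:
  assumes x: "x \<in> points Q" and q: "q \<in> nonzero_fibre Q x"
  shows "hcoord Q s q \<noteq> 0"
proof
  assume z: "hcoord Q s q = 0"
  obtain b :: "'k option \<Rightarrow> 'm \<Rightarrow> 'l" where b: "section_basis Q b" "holomorphic_embedding Q pspace (coherent_map Q b)"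
    using ample unfolding very_ample_def by blast
  have zero: "hcoord Q b q' = 0" if q': "q' \<in> nonzero_fibre Q x" for q'
  proof -
    obtain c where c: "hcoord Q s q' = c *s hcoord Q s q" using hcoord_rescale[OF x q' q] .
    then have "hcoord Q s q' = 0" by (simp only: z vector_smult_rzero)
    then have h: "qhat Q q' (s j) = 0" for j by (simp add: hcoord_def vec_eq_iff)
    have "qhat Q q' (b j) = 0" for j
    proof -
      have "b j \<in> hol_sections Q" using b(1) by (simp add: section_basis_def)
      then obtain a where "b j = comb s a" using hol_section_comb by blast
      then show ?thesis using qhat_comb[OF x q'] h by simp
    qed
    then show ?thesis by (simp add: hcoord_def vec_eq_iff)
  qed
  have "continuous_map (mtop Q) proj_topology (coherent_map Q b)"
    using b(2) by (simp add: holomorphic_embedding_def holomorphic_map_def projective_space_simps)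
  then have "coherent_map Q b x \<in> proj_points"
    using x by (auto simp: continuous_map_def topspace_proj_topology Pi_iff)
  moreover have "coherent_map Q b x = {0}"
    using zero q unfolding coherent_map_def hcoord_def by (auto simp: hline_def)
  ultimately show False by (metis proj_points_cases self_in_hline singletonD)
qed

lemma coherent_map_eq:
  assumes x: "x \<in> points Q" and q: "q \<in> nonzero_fibre Q x"
  shows "coherent_map Q s x = hline (hcoord Q s q)"
proof -
  have "hline (hcoord Q s q') = hline (hcoord Q s q)" if q': "q' \<in> nonzero_fibre Q x" for q'
  proof -
    obtain c where "c \<noteq> 0" "hcoord Q s q' = c *s hcoord Q s q" using hcoord_rescale[OF x q' q] .
    then show ?thesis by (simp add: hline_scale)
  qed
  then show ?thesis unfolding coherent_map_def hcoord_def[symmetric] using q by blast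
qed

text \<open>A linear form on the line of \<open>i(x)\<close> is evaluated at the vector attached to
  \<open>q\<close> and the value is multiplied onto \<open>q\<close>; replacing \<open>q\<close> by
  \<open>c q\<close> divides the vector by \<open>c\<close>, so the result stays the same. The
  isomorphism is unique because a coordinate section that is nonzero at this point spans the fibre
  and has a prescribed image.\<close>

lemma pullback_iso_eq:
  assumes x: "x \<in> points Q" and q: "q \<in> nonzero_fibre Q x" and p: "p \<in> fibre pspace (coherent_map Q s x)"
  shows "pullback_iso Q s x p = bscale Q (snd p (hcoord Q s q)) q"
proof -
  let ?v = "hcoord Q s q"
  let ?L = "hline ?v"
  let ?F = "fibre pspace ?L"
  have L: "coherent_map Q s x = ?L" by (rule coherent_map_eq[OF x q])
  have v: "?v \<noteq> 0" by (rule hcoord_nonzero[OF x q])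
  have Lp: "?L \<in> proj_points" using v by (rule hline_in_proj_points)
  obtain j where j: "?v $ j \<noteq> 0" using v by (auto simp: vec_eq_iff)
  obtain U \<tau> where t: "(U, \<tau>) \<in> trivs Q" "x \<in> U" using triv_at[OF x] .
  note q' = triv_nonzero[OF t q]
  note f = hol_section_fibre[OF s_hol x]
  have \<tau>: "\<tau> (bscale Q c q) = c * \<tau> q" "bscale Q c q \<in> fibre Q x" for c
    using triv(4)[OF t q'(2)] fibre_ops(3)[OF x q'(2)] by auto
  have bs: "bscale pspace c p = (?L, \<lambda>u\<in>?L. c * snd p u)" if "p \<in> ?F" for c p
    using that by (simp add: projective_space_simps case_prod_beta fibre_pspace)
  have bsF: "bscale pspace c p \<in> ?F" if "p \<in> ?F" for c p
    using that by (simp add: bs fibre_pspace hline_add hline_cscale algebra_simps)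
  have gen: "p = bscale pspace (snd p ?v / ?v $ j) (coord_section j ?L)" if p: "p \<in> ?F" for p
    by (rule fibre_pspace_eqI[OF p bsF[OF coord_section_fibre[OF Lp]]])
      (use j v in \<open>simp add: bs[OF coord_section_fibre[OF Lp]] coord_section_value\<close>)
  define \<Psi> where "\<Psi> = (\<lambda>p\<in>?F. bscale Q (snd p ?v) q)"
  let ?P = "\<lambda>\<Phi>. \<Phi> \<in> extensional ?F \<and> bij_betw \<Phi> ?F (fibre Q x) \<and>
        (\<forall>p\<in>?F. \<forall>p'\<in>?F. \<Phi> (badd pspace p p') = badd Q (\<Phi> p) (\<Phi> p')) \<and>
        (\<forall>c. \<forall>p\<in>?F. \<Phi> (bscale pspace c p) = bscale Q c (\<Phi> p)) \<and>
        (\<forall>j. \<Phi> (coord_section j ?L) = s j x)"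
  have unique: "\<Phi> = \<Psi>" if \<Phi>: "?P \<Phi>" and \<Psi>: "?P \<Psi>" for \<Phi> \<Psi> :: "'k hvec set \<times> ('k hvec \<Rightarrow> complex) \<Rightarrow> 'l"
  proof (rule extensionalityI[where A = ?F])
    show "\<Phi> p = \<Psi> p" if p: "p \<in> ?F" for p
    proof -
      have "\<Phi> (bscale pspace c (coord_section j ?L)) = \<Psi> (bscale pspace c (coord_section j ?L))" for c
        using \<Phi> \<Psi> coord_section_fibre[OF Lp] by metis
      then show ?thesis using gen[OF p] by metis
    qed
  qed (use \<Phi> \<Psi> in auto)
  have \<Psi>: "?P \<Psi>"
  proof (intro conjI ballI allI)
    show "bij_betw \<Psi> ?F (fibre Q x)"
    proof (rule bij_betwI')
      show "\<Psi> p \<in> fibre Q x" if "p \<in> ?F" for p using that \<tau> by (simp add: \<Psi>_def)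
      show "(\<Psi> p = \<Psi> p') = (p = p')" if "p \<in> ?F" "p' \<in> ?F" for p p'
      proof
        assume "\<Psi> p = \<Psi> p'"
        then have "bscale Q (snd p ?v) q = bscale Q (snd p' ?v) q" using that by (simp add: \<Psi>_def)
        then have "snd p ?v * \<tau> q = snd p' ?v * \<tau> q" using \<tau>(1) by metis
        then show "p = p'" using q'(1) fibre_pspace_eqI[OF that] by simp
      qed simp
      show "\<exists>p\<in>?F. r = \<Psi> p" if r: "r \<in> fibre Q x" for r
      proof
        let ?p = "bscale pspace (\<tau> r / \<tau> q / ?v $ j) (coord_section j ?L)"
        show F: "?p \<in> ?F" by (rule bsF[OF coord_section_fibre[OF Lp]])
        have "snd ?p ?v = \<tau> r / \<tau> q"
          using j v by (simp add: bs[OF coord_section_fibre[OF Lp]] coord_section_value)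
        then show "r = \<Psi> ?p" using F q'(1) \<tau> by (intro triv_inj[OF t r]) (simp_all add: \<Psi>_def)
      qed
    qed
    show "\<Psi> (badd pspace p p') = badd Q (\<Psi> p) (\<Psi> p')" if pp: "p \<in> ?F" "p' \<in> ?F" for p p'
    proof -
      have ba: "badd pspace p p' = (?L, \<lambda>u\<in>?L. snd p u + snd p' u)"
        using pp by (simp add: projective_space_simps case_prod_beta fibre_pspace)
      then have "badd pspace p p' \<in> ?F"
        using pp by (simp add: fibre_pspace hline_add hline_cscale algebra_simps)
      then show ?thesis using pp
        by (intro triv_inj[OF t]) (simp_all add: \<Psi>_def \<tau> fibre_ops(2)[OF x] triv(3)[OF t] ba algebra_simps)
    qed
    show "\<Psi> (bscale pspace c p) = bscale Q c (\<Psi> p)" if "p \<in> ?F" for c p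
      using that bsF[OF that] fibre_ops(3)[OF x]
      by (intro triv_inj[OF t]) (simp_all add: \<Psi>_def \<tau> triv(4)[OF t] bs)
    show "\<Psi> (coord_section j ?L) = s j x" for j
      using coord_section_fibre[OF Lp] qhat_scale[where \<phi> = "s j", OF x q f] v
      by (simp add: \<Psi>_def coord_section_value hcoord_def)
  qed (simp add: \<Psi>_def)
  have "pullback_iso Q s x = \<Psi>"
    unfolding pullback_iso_def Let_def L by (rule the_equality[of ?P, OF \<Psi> unique[OF _ \<Psi>]])
  then show ?thesis using p by (simp add: \<Psi>_def L)
qed

text \<open>The last claim is an equality of vectors, not merely of the lines they span, and thus
  keeps the phases. With \<open>a\<close> the value of the form \<open>t(i(x))\<close> at the vector
  \<open>v\<close> of some \<open>q\<close>, the pulled back section is \<open>a q\<close> at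
  \<open>x\<close>, and both sides are \<open>v / a\<close>.\<close>

lemma pullback_section_hcoord:
  assumes x: "x \<in> points Q" and t: "t \<in> hol_sections pspace" and nz: "pullback_section Q s t x \<noteq> bzero Q x"
  shows "pullback_section Q s t x \<in> nonzero_fibre Q x"
    "coherent_map Q s x \<in> points pspace"
    "t (coherent_map Q s x) \<in> nonzero_fibre pspace (coherent_map Q s x)"
    "hcoord pspace coord_section (t (coherent_map Q s x)) = hcoord Q s (pullback_section Q s t x)"
proof -
  obtain q where q: "q \<in> nonzero_fibre Q x" using nonzero_fibre_nonempty[OF x] by blast
  let ?v = "hcoord Q s q"
  have v: "?v \<noteq> 0" by (rule hcoord_nonzero[OF x q])
  have L: "coherent_map Q s x = hline ?v" by (rule coherent_map_eq[OF x q])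
  show Lp: "coherent_map Q s x \<in> points pspace" using v by (simp add: L points_projective_space hline_in_proj_points)
  have tf: "t (hline ?v) \<in> fibre pspace (hline ?v)" using t Lp by (simp add: L hol_sections_def)
  define a where "a = snd (t (hline ?v)) ?v"
  have ps: "pullback_section Q s t x = bscale Q a q"
    using x tf by (simp add: pullback_section_def pullback_iso_eq[OF x q] L a_def)
  obtain U \<tau> where tr: "(U, \<tau>) \<in> trivs Q" "x \<in> U" using triv_at[OF x] .
  note q' = triv_nonzero[OF tr q]
  show N: "pullback_section Q s t x \<in> nonzero_fibre Q x"
    using nz fibre_ops(3)[OF x q'(2)] by (simp add: nonzero_fibre_def ps)
  have \<tau>: "\<tau> (bscale Q a q) = a * \<tau> q" using triv(4)[OF tr q'(2)] .
  have a: "a \<noteq> 0" using triv_nonzero(1)[OF tr N] \<tau> by (auto simp: ps)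
  show N': "t (coherent_map Q s x) \<in> nonzero_fibre pspace (coherent_map Q s x)"
    unfolding L nonzero_fibre_pspace[OF v] using tf a by (simp add: a_def)
  have "hcoord Q s (bscale Q a q) = (1 / a) *s ?v"
    using a q'(1) by (simp add: hcoord_def vec_eq_iff \<tau>
      qhat_eq[where \<phi> = "s j" for j, OF tr N[unfolded ps] hol_section_fibre[OF s_hol x]]
      qhat_eq[where \<phi> = "s j" for j, OF tr q hol_section_fibre[OF s_hol x]])
  then show "hcoord pspace coord_section (t (coherent_map Q s x)) = hcoord Q s (pullback_section Q s t x)"
    using hcoord_pspace[OF v N'[unfolded L]] by (simp add: L ps a_def)
qed

lemma two_point_pullback:
  assumes x: "x \<in> points Q" "pullback_section Q s t x \<noteq> bzero Q x" and y: "y \<in> points Q" "pullback_section Q s t y \<noteq> bzero Q y"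
    and t: "t \<in> hol_sections pspace"
  shows "two_point Q (pullback_section Q s t) x y = two_point pspace t (coherent_map Q s x) (coherent_map Q s y)"
proof -
  note X = pullback_section_hcoord[OF x(1) t x(2)]
  note Y = pullback_section_hcoord[OF y(1) t y(2)]
  show ?thesis
    unfolding two_point_def normalized_inner[OF x(1) X(1) y(1) Y(1)]
      section_frame.normalized_inner[OF section_frame_pspace X(2,3) Y(2,3)] X(4) Y(4) ..
qed

lemma pullback_coord_section: "pullback_section Q s (coord_section j) = s j"
proof (rule extensionalityI[where A = "points Q"])
  fix x assume x: "x \<in> points Q"
  obtain q where q: "q \<in> nonzero_fibre Q x" using nonzero_fibre_nonempty[OF x] by blast
  have v: "hcoord Q s q \<noteq> 0" by (rule hcoord_nonzero[OF x q])
  have L: "coherent_map Q s x = hline (hcoord Q s q)" by (rule coherent_map_eq[OF x q])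
  show "pullback_section Q s (coord_section j) x = s j x"
    using x v qhat_scale[where \<phi> = "s j", OF x q hol_section_fibre[OF s_hol x]]
      coord_section_fibre[OF hline_in_proj_points[OF v]]
    by (simp add: pullback_section_def pullback_iso_eq[OF x q] L coord_section_value hcoord_def)
qed (use s_hol in \<open>auto simp: pullback_section_def hol_sections_def\<close>)

text \<open>For \<open>q = s_j(x)\<close> the section \<open>s j\<close> has coefficient 1, so this
  choice of \<open>q\<close> singles out the representative normalised at \<open>j\<close>.\<close>

lemma hcoord_normalized_rep:
  assumes x: "x \<in> points Q" and nz: "s j x \<noteq> bzero Q x"
  shows "s j x \<in> nonzero_fibre Q x" "hcoord Q s (s j x) = normalized_rep j (coherent_map Q s x)"
proof -
  show N: "s j x \<in> nonzero_fibre Q x" using nz hol_section_fibre[OF s_hol x] by (simp add: nonzero_fibre_def)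
  obtain U \<tau> where t: "(U, \<tau>) \<in> trivs Q" "x \<in> U" using triv_at[OF x] .
  have "hcoord Q s (s j x) $ j = 1"
    using triv_nonzero(1)[OF t N] by (simp add: hcoord_def qhat_eq[where \<phi> = "s j", OF t N hol_section_fibre[OF s_hol x]])
  then show "hcoord Q s (s j x) = normalized_rep j (coherent_map Q s x)"
    by (simp add: coherent_map_eq[OF x N] normalized_rep_hline)
qed

lemma psi_pullback:
  assumes x: "x \<in> points Q" and y: "y \<in> points Q"
  shows "psi Q x y = psi pspace (coherent_map Q s x) (coherent_map Q s y)"
proof -
  obtain q q' where q: "q \<in> nonzero_fibre Q x" "q' \<in> nonzero_fibre Q y"
    using nonzero_fibre_nonempty x y by blast
  have "psi Q x y = (cmod (hinner (hcoord Q s q') (hcoord Q s q)))\<^sup>2 / ((norm (hcoord Q s q))\<^sup>2 * (norm (hcoord Q s q'))\<^sup>2)"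
    using hcoord_rescale[OF x _ q(1)] hcoord_rescale[OF y _ q(2)]
    by (intro psi_eq[OF x q(1) y q(2)]) metis+
  also have "\<dots> = psi pspace (coherent_map Q s x) (coherent_map Q s y)"
    unfolding coherent_map_eq[OF x q(1)] coherent_map_eq[OF y q(2)]
    by (rule psi_pspace[OF hcoord_nonzero[OF x q(1)] hcoord_nonzero[OF y q(2)], symmetric])
  finally show ?thesis .
qed

lemma coherent_map_representative:
  assumes x: "x \<in> points Q" and u: "u \<in> coherent_map Q s x - {0}"
  shows "coherent_map Q s x = hline u"
proof -
  obtain q where q: "q \<in> nonzero_fibre Q x" using nonzero_fibre_nonempty[OF x] by blast
  show ?thesis using u hline_eqI unfolding coherent_map_eq[OF x q] by blast
qed

end

theorem proposition4p6:
  fixes Q :: "('m, 'n::finite, 'l) line_bundle_data"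
    and s :: "'k::finite option \<Rightarrow> 'm \<Rightarrow> 'l"
    and t :: "'k hvec set \<Rightarrow> 'k hvec set \<times> ('k hvec \<Rightarrow> complex)"
  assumes "kaehler_manifold Q" and "compact_space (mtop Q)" and "connected_space (mtop Q)"
    and "quantum_line_bundle Q" and "very_ample TYPE('k) Q"
    and "orthonormal_section_basis Q s"
    and "t \<in> hol_sections projective_space"
    and "\<exists>L\<in>points projective_space. t L \<noteq> bzero projective_space L"
  shows
    "(\<forall>x\<in>points Q. \<forall>y\<in>points Q.
        pullback_section Q s t x \<noteq> bzero Q x \<longrightarrow> pullback_section Q s t y \<noteq> bzero Q y \<longrightarrow>
          two_point Q (pullback_section Q s t) x y =
            two_point projective_space t (coherent_map Q s x) (coherent_map Q s y) \<and>
          two_point projective_space t (coherent_map Q s x) (coherent_map Q s y) =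
            pullback_fun2 (coherent_map Q s) (two_point projective_space t) x y)
     \<and>
     (s None = pullback_section Q s (coord_section None) \<and>
      (\<forall>x\<in>points Q. \<forall>y\<in>points Q.
        s None x \<noteq> bzero Q x \<longrightarrow> s None y \<noteq> bzero Q y \<longrightarrow>
          two_point Q (s None) x y =
            hinner (normalized_rep None (coherent_map Q s y)) (normalized_rep None (coherent_map Q s x)) /
            complex_of_real (norm (normalized_rep None (coherent_map Q s x)) * norm (normalized_rep None (coherent_map Q s y)))))
     \<and>
     (\<forall>x\<in>points Q. \<forall>y\<in>points Q.
        psi Q x y = pullback_fun2 (coherent_map Q s) (psi projective_space) x y \<and>
        pullback_fun2 (coherent_map Q s) (psi projective_space) x y =
          psi projective_space (coherent_map Q s x) (coherent_map Q s y) \<and>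
        (\<forall>u\<in>coherent_map Q s x - {0}. \<forall>v\<in>coherent_map Q s y - {0}.
           psi projective_space (coherent_map Q s x) (coherent_map Q s y) =
             (cmod (hinner v u))\<^sup>2 / ((norm u)\<^sup>2 * (norm v)\<^sup>2)))"
proof -
  interpret ample_sections Q s
    using assms unfolding quantum_line_bundle_def kaehler_manifold_def
    by unfold_locales (auto simp: kaehler_manifold_def)
  have b: "two_point Q (s None) x y =
      hinner (normalized_rep None (coherent_map Q s y)) (normalized_rep None (coherent_map Q s x)) /
      complex_of_real (norm (normalized_rep None (coherent_map Q s x)) * norm (normalized_rep None (coherent_map Q s y)))"
    if "x \<in> points Q" "y \<in> points Q" "s None x \<noteq> bzero Q x" "s None y \<noteq> bzero Q y" for x y
    using hcoord_normalized_rep[OF that(1,3)] hcoord_normalized_rep[OF that(2,4)]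
      normalized_inner[OF that(1) _ that(2)] by (simp add: two_point_def)
  have c: "psi pspace (coherent_map Q s x) (coherent_map Q s y) = (cmod (hinner v u))\<^sup>2 / ((norm u)\<^sup>2 * (norm v)\<^sup>2)"
    if "x \<in> points Q" "y \<in> points Q" "u \<in> coherent_map Q s x - {0}" "v \<in> coherent_map Q s y - {0}" for x y u v
    using psi_pspace[of u v] coherent_map_representative[OF that(1,3)] coherent_map_representative[OF that(2,4)] that
    by simp
  show ?thesis
    unfolding pullback_fun2_def
    using two_point_pullback[OF _ _ _ _ assms(7)] b c psi_pullback pullback_coord_section by auto
qed

end
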